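(* Let $(f_t)_{t\in I}$ be a $\mathcal P^2_0$-DLC. Then there exists a unique function $P:\mathbb C^+\times\mathcal B_{\rm c}(I)\to\overline{\mathbb C^+}$ satisfying (HM1)--(HM4) such that $$f_t(z)=z+\int_0^t\frac{\partial f_s(z)}{\partial z}\,P(z,ds),\qquad t\in I,\ z\in\mathbb C^+.$$ Moreover, let $\Theta$ be the compound driving measure of $P$ and let $f_{s,t}:=f_s^{-1}\circ f_t$ ($s\le t$) be the reverse evolution family associated with $(f_t)$. Then $$f_{s,t}(z)=z+\int_{\mathbb R\times[s,t]}\frac{1}{x-f_{r,t}(z)}\,\Theta(dx\,dr),\qquad s\le t,\ z\in\mathbb C^+.$$
   Context: $I$ is a fixed interval $[0,T_0)$ ($0<T_0\le+\infty$) or $[0,T_0]$ ($0<T_0<+\infty$). $\mathbb C^+$ is the open upper half-plane and $\overline{\mathbb C^+}=\mathbb C^+\cup\mathbb R$. For a Borel probability measure $\mu$ on $\mathbb R$, $G_\mu(z)=\int\frac1{z-x}\mu(dx)$ and $F_\mu=1/G_\mu$ on $\mathbb C^+$. Let $\mathcal P^2_0$ be the set of $F_\mu$ with $\mu$ a Borel probability measure on $\mathbb R$ of finite second moment and mean $0$. A $\mathcal P^2_0$-DLC is a family $(f_t)_{t\in I}\subset\mathcal P^2_0$ of univalent functions on $\mathbb C^+$ with $f_0=\mathrm{id}$, $f_s(\mathbb C^+)\supset f_t(\mathbb C^+)$ for $s\le t$, and $t\mapsto f_t$ continuous for locally uniform convergence. $\mathcal B_{\rm c}(I)$ is the collection of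 precompact Borel subsets of $I$. Conditions on $P:\mathbb C^+\times\mathcal B_{\rm c}(I)\to\overline{\mathbb C^+}$: (HM1) $B\mapsto P(z,B)$ is countably additive on $\mathcal B_{\rm c}(I)$ for each fixed $z\in\mathbb C^+$; (HM2) $P(z,\{t\})=0$ for all $z\in\mathbb C^+$, $t\in I$; (HM3) $z\mapsto P(z,B)$ is holomorphic on $\mathbb C^+$ for each $B\in\mathcal B_{\rm c}(I)$; (HM4) $\lim_{y\to+\infty}y\,P(iy,B)$ exists finitely for each $B\in\mathcal B_{\rm c}(I)$. For every $P$ satisfying these conditions there is a unique Borel measure $\Theta$ on $\mathbb R\times I$ with $\Theta(\mathbb R\times[0,t])<+\infty$ and $\Theta(\mathbb R\times\{t\})=0$ for every $t\in I$ such that $P(z,B)=\int_{\mathbb R}\frac1{x-z}\,\Theta(dx\times B)$ for $z\in\mathbb C^+$, $B\in\mathcal B_{\rm c}(I)$; it is called the compound driving measure of $P$. *)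

theory Defs
  imports "HOL-Complex_Analysis.Complex_Analysis" "HOL-Probability.Probability"
begin

definition upper_half_plane :: "complex set" where
  "upper_half_plane = {z. 0 < Im z}"

definition closed_upper_half_plane :: "complex set" where
  "closed_upper_half_plane = {z. 0 \<le> Im z}"

definition time_interval :: "real set \<Rightarrow> bool" where
  "time_interval I \<longleftrightarrow> I = {0..} \<or> (\<exists>T>0. I = {0..<T} \<or> I = {0..T})"

definition cauchy_transform :: "real measure \<Rightarrow> complex \<Rightarrow> complex" where
  "cauchy_transform \<mu> z = (\<integral>x. 1 / (z - complex_of_real x) \<partial>\<mu>)"

definition recip_cauchy_transform :: "real measure \<Rightarrow> complex \<Rightarrow> complex" where
  "recip_cauchy_transform \<mu> z = 1 / cauchy_transform \<mu> z"

text \<open>Functions on the upper half-plane are represented by total functions whose values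
  elsewhere are irrelevant.\<close>

definition P20 :: "(complex \<Rightarrow> complex) set" where
  "P20 = {f. \<exists>\<mu>. real_distribution \<mu> \<and> integrable \<mu> (\<lambda>x. x\<^sup>2) \<and> (\<integral>x. x \<partial>\<mu>) = 0 \<and>
                 (\<forall>z\<in>upper_half_plane. f z = recip_cauchy_transform \<mu> z)}"

definition P20_DLC :: "real set \<Rightarrow> (real \<Rightarrow> complex \<Rightarrow> complex) \<Rightarrow> bool" where
  "P20_DLC I f \<longleftrightarrow>
     (\<forall>t\<in>I. f t \<in> P20 \<and> f t holomorphic_on upper_half_plane \<and> inj_on (f t) upper_half_plane) \<and>
     (\<forall>z\<in>upper_half_plane. f 0 z = z) \<and>
     (\<forall>s\<in>I. \<forall>t\<in>I. s \<le> t \<longrightarrow> f t ` upper_half_plane \<subseteq> f s ` upper_half_plane) \<and>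
     (\<forall>t\<in>I. \<forall>K. compact K \<and> K \<subseteq> upper_half_plane \<longrightarrow> uniform_limit K f (f t) (at t within I))"

definition reverse_evolution ::
  "(real \<Rightarrow> complex \<Rightarrow> complex) \<Rightarrow> real \<Rightarrow> real \<Rightarrow> complex \<Rightarrow> complex" where
  "reverse_evolution f s t = inv_into upper_half_plane (f s) \<circ> f t"

text \<open>Precompact means relatively compact in \<open>I\<close>: for \<open>I = {0..<T}\<close> the set must stay away
  from \<open>T\<close>.\<close>

definition precompact_borel :: "real set \<Rightarrow> real set set" where
  "precompact_borel I = {B \<in> sets borel. compact (closure B) \<and> closure B \<subseteq> I}"

text \<open>The family \<open>precompact_borel I\<close> need not be closed under countable unions, so countable
  additivity is only required of sequences whose union lies in the family.\<close>

definition HM1 :: "real set \<Rightarrow> (complex \<times> real set \<Rightarrow> complex) \<Rightarrow> bool" where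
  "HM1 I P \<longleftrightarrow> (\<forall>z\<in>upper_half_plane. \<forall>B :: nat \<Rightarrow> real set.
     range B \<subseteq> precompact_borel I \<and> disjoint_family B \<and> (\<Union>n. B n) \<in> precompact_borel I \<longrightarrow>
     (\<lambda>n. P (z, B n)) sums P (z, \<Union>n. B n))"

definition HM2 :: "real set \<Rightarrow> (complex \<times> real set \<Rightarrow> complex) \<Rightarrow> bool" where
  "HM2 I P \<longleftrightarrow> (\<forall>z\<in>upper_half_plane. \<forall>t\<in>I. P (z, {t}) = 0)"

definition HM3 :: "real set \<Rightarrow> (complex \<times> real set \<Rightarrow> complex) \<Rightarrow> bool" where
  "HM3 I P \<longleftrightarrow> (\<forall>B\<in>precompact_borel I. (\<lambda>z. P (z, B)) holomorphic_on upper_half_plane)"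

definition HM4 :: "real set \<Rightarrow> (complex \<times> real set \<Rightarrow> complex) \<Rightarrow> bool" where
  "HM4 I P \<longleftrightarrow> (\<forall>B\<in>precompact_borel I. \<exists>L :: complex.
     ((\<lambda>y :: real. complex_of_real y * P (\<i> * complex_of_real y, B)) \<longlongrightarrow> L) at_top)"

text \<open>The extensional function space makes \<open>P\<close> determined by its values on its domain, so that
  unique existence of \<open>P\<close> can be expressed by \<open>\<exists>!\<close>.\<close>

definition herglotz_family :: "real set \<Rightarrow> (complex \<times> real set \<Rightarrow> complex) \<Rightarrow> bool" where
  "herglotz_family I P \<longleftrightarrow>
     P \<in> upper_half_plane \<times> precompact_borel I \<rightarrow>\<^sub>E closed_upper_half_plane \<and>
     HM1 I P \<and> HM2 I P \<and> HM3 I P \<and> HM4 I P"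

text \<open>Integration against a complex measure \<open>\<nu>\<close> on the Borel subsets of \<open>S\<close>, by the Jordan
  decompositions of its real and imaginary parts. The positive part of a finite signed measure is
  \<open>A \<mapsto> sup {\<nu> B | B \<subseteq> A}\<close>, the negative part is the positive part of \<open>- \<nu>\<close>;
  \<open>ennreal\<close> truncates negative values to 0, harmlessly since \<open>B = {}\<close> is allowed.\<close>

definition positive_variation :: "real set \<Rightarrow> (real set \<Rightarrow> real) \<Rightarrow> real measure" where
  "positive_variation S \<nu> = measure_of S (sets (restrict_space borel S))
     (\<lambda>A. SUP B\<in>{B \<in> sets (restrict_space borel S). B \<subseteq> A}. ennreal (\<nu> B))"

definition signed_integral :: "real set \<Rightarrow> (real set \<Rightarrow> real) \<Rightarrow> (real \<Rightarrow> complex) \<Rightarrow> complex" where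
  "signed_integral S \<nu> g =
     (\<integral>x. g x \<partial>positive_variation S \<nu>) - (\<integral>x. g x \<partial>positive_variation S (\<lambda>B. - \<nu> B))"

definition complex_measure_integral ::
  "real set \<Rightarrow> (real set \<Rightarrow> complex) \<Rightarrow> (real \<Rightarrow> complex) \<Rightarrow> complex" where
  "complex_measure_integral S \<nu> g =
     signed_integral S (\<lambda>B. Re (\<nu> B)) g + \<i> * signed_integral S (\<lambda>B. Im (\<nu> B)) g"

text \<open>The measure \<open>A \<mapsto> \<Theta> (A \<times> B)\<close> on the real line, written \<open>\<Theta>(dx \<times> B)\<close>.\<close>

definition section_measure :: "(real \<times> real) measure \<Rightarrow> real set \<Rightarrow> real measure" where
  "section_measure \<Theta> B = measure_of UNIV (sets borel) (\<lambda>A. emeasure \<Theta> (A \<times> B))"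

definition is_compound_driving_measure ::
  "real set \<Rightarrow> (complex \<times> real set \<Rightarrow> complex) \<Rightarrow> (real \<times> real) measure \<Rightarrow> bool" where
  "is_compound_driving_measure I P \<Theta> \<longleftrightarrow>
     sets \<Theta> = sets (restrict_space borel (UNIV \<times> I)) \<and>
     (\<forall>t\<in>I. emeasure \<Theta> (UNIV \<times> {0..t}) < \<infinity> \<and> emeasure \<Theta> (UNIV \<times> {t}) = 0) \<and>
     (\<forall>z\<in>upper_half_plane. \<forall>B\<in>precompact_borel I.
        P (z, B) = (\<integral>x. 1 / (complex_of_real x - z) \<partial>section_measure \<Theta> B))"

definition compound_driving_measure ::
  "real set \<Rightarrow> (complex \<times> real set \<Rightarrow> complex) \<Rightarrow> (real \<times> real) measure" where
  "compound_driving_measure I P = (THE \<Theta>. is_compound_driving_measure I P \<Theta>)"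

definition loewner_integral_equation ::
  "real set \<Rightarrow> (real \<Rightarrow> complex \<Rightarrow> complex) \<Rightarrow> (complex \<times> real set \<Rightarrow> complex) \<Rightarrow> bool" where
  "loewner_integral_equation I f P \<longleftrightarrow> (\<forall>t\<in>I. \<forall>z\<in>upper_half_plane.
     f t z = z + complex_measure_integral {0..t} (\<lambda>B. P (z, B)) (\<lambda>s. deriv (f s) z))"

end

theory Submission
  imports Defs
begin

text \<open>
  For \<open>f\<^sub>t\<close> in \<open>P20\<close> let \<open>V t\<close> be the variance of its measure, so that
  \<open>f\<^sub>t(iy) = iy + i V(t)/y + o(1/y)\<close>. The Schwarz-Pick inequality with one of its two points sent to
  infinity along the imaginary axis turns this expansion into bounds at every point:
  \<open>|f\<^sub>t(z) - z| \<le> V(t) / Im z\<close>, and \<open>f\<^sub>t - id\<close> has Lipschitz constant \<open>V(t) / (Im z Im w)\<close>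
  between \<open>z\<close> and \<open>w\<close> (\<open>pick_bound\<close>, \<open>hydrodynamic_lipschitz\<close>). The transition maps
  \<open>f\<^sub>s\<^sub>t = inv(f\<^sub>s) \<circ> f\<^sub>t\<close> have an expansion of the same kind with \<open>V t - V s\<close> in place of \<open>V t\<close>.
  Hence \<open>V\<close> is nondecreasing; it is also continuous, because the coefficient in the expansion is lower
  semicontinuous, both along \<open>f\<^sub>t\<close> and along \<open>f\<^sub>u\<^sub>T\<close> as \<open>u\<close> decreases. So \<open>V\<close> serves as a clock:
  everything moves at most at the speed of \<open>V\<close>, and \<open>V\<close> has no jumps.

  The displacement \<open>f\<^sub>s\<^sub>t(z) - z\<close> is almost additive in time: its defect over \<open>s \<le> t \<le> u\<close> is at most
  \<open>(V t - V s) (V u - V t) / (Im z)\<^sup>3\<close>. By the sewing lemma it agrees, up to the square of the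
  increment of \<open>V\<close>, with the increment of a function of time. These increments are holomorphic in \<open>z\<close>,
  have nonnegative imaginary part and are bounded by \<open>(V t - V s) / Im z\<close>, so they are of the form
  \<open>\<integral> 1/(x - z) \<rho>(dx)\<close> (\<open>herglotz_representation\<close>). As the measure \<open>\<rho>\<close> is determined by this integral,
  the measures belonging to \<open>[0,t]\<close> increase with \<open>t\<close>, and they are the slices of one measure \<open>\<Theta>\<close> on
  \<open>\<real> \<times> I\<close> (\<open>spacetime_measure\<close>). The required family is \<open>P(z,B) = \<integral> 1/(x - z) \<Theta>(dx \<times> B)\<close>.

  Either of the two equations equates functions of time whose increments agree up to an error of second
  order in \<open>V\<close>, or of first order with a small factor. Errors of this kind vanish when they are summed over
  fine partitions (\<open>constant_if_small_increments\<close>).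

  For uniqueness fix \<open>z\<close>. The integral equation prescribes the complex measure \<open>f\<^sub>s'(z) P(z,ds)\<close> on all
  intervals \<open>[0,t]\<close>, hence on all Borel sets, and \<open>f\<^sub>s'(z)\<close> is continuous in \<open>s\<close> and vanishes nowhere since
  \<open>f\<^sub>s\<close> is univalent, so it can be divided out. That \<open>P(z,_)\<close> has finite total variation
  follows from \<open>pick_bound\<close> and the limits in condition \<open>HM4\<close>.
\<close>

section \<open>Holomorphic self-maps of the upper half-plane\<close>

lemma uhp_iff [simp]: "z \<in> upper_half_plane \<longleftrightarrow> 0 < Im z"
  by (simp add: upper_half_plane_def)

lemma open_uhp: "open upper_half_plane"
  unfolding upper_half_plane_def by (rule open_halfspace_Im_gt)

lemma norm_diff_cnj_square:
  "(norm (a - cnj b))\<^sup>2 = (norm (a - b))\<^sup>2 + 4 * Im a * Im b"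
  unfolding cmod_power2 by (simp add: power2_eq_square algebra_simps)

text \<open>The Schwarz lemma for \<open>\<psi> \<circ> g \<circ> c\<close>, where the Moebius maps \<open>c\<close> and \<open>\<psi>\<close> take the unit disc to the
  half-plane with \<open>0 \<mapsto> w\<close> and the half-plane to the disc with \<open>g w \<mapsto> 0\<close>. The form without
  denominators keeps its meaning when an imaginary part vanishes.\<close>

lemma schwarz_pick_strict:
  assumes hol: "g holomorphic_on upper_half_plane"
    and pos: "\<And>z. 0 < Im z \<Longrightarrow> 0 < Im (g z)"
    and z: "0 < Im z" and w: "0 < Im w"
  shows "(norm (g z - g w))\<^sup>2 * (Im z * Im w) \<le> Im (g z) * Im (g w) * (norm (z - w))\<^sup>2"
proof -
  define c where "c = (\<lambda>\<zeta>. (w - cnj w * \<zeta>) / (1 - \<zeta>))"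
  define \<psi> where "\<psi> = (\<lambda>u. (u - g w) / (u - cnj (g w)))"
  have Imc: "0 < Im (c \<zeta>)" if "norm \<zeta> < 1" for \<zeta>
  proof -
    have ne: "1 - \<zeta> \<noteq> 0" using that by auto
    have "c \<zeta> = (w - cnj w * \<zeta>) * cnj (1 - \<zeta>) / ((norm (1 - \<zeta>))\<^sup>2)"
      unfolding c_def complex_norm_square using ne by (simp add: divide_simps)
    also have "Im \<dots> = Im ((w - cnj w * \<zeta>) * cnj (1 - \<zeta>)) / (norm (1 - \<zeta>))\<^sup>2"
      by (metis Im_divide_of_real of_real_power)
    also have "Im ((w - cnj w * \<zeta>) * cnj (1 - \<zeta>)) = Im w * (1 - (norm \<zeta>)\<^sup>2)"
      unfolding cmod_power2 by (simp add: algebra_simps power2_eq_square)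
    finally have "Im (c \<zeta>) = Im w * (1 - (norm \<zeta>)\<^sup>2) / (norm (1 - \<zeta>))\<^sup>2" .
    moreover have "(norm \<zeta>)\<^sup>2 < 1" using that by (simp add: power_less_one_iff)
    ultimately show ?thesis using w ne by simp
  qed
  have den: "u - cnj (g w) \<noteq> 0" if "0 < Im u" for u
    using that pos[OF w] by (metis add_less_same_cancel1 complex_cnj_cancel_iff diff_0_right diff_add_cancel eq_iff_diff_eq_0 cnj.simps(2) less_numeral_extra(3) neg_0_less_iff_less not_less_iff_gr_or_eq)
  have \<psi>lt: "norm (\<psi> u) < 1" if "0 < Im u" for u
  proof -
    have "(norm (u - g w))\<^sup>2 < (norm (u - cnj (g w)))\<^sup>2"
      unfolding norm_diff_cnj_square using that pos[OF w] by simp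
    hence "norm (u - g w) < norm (u - cnj (g w))" by (rule power_less_imp_less_base) simp
    thus ?thesis unfolding \<psi>_def norm_divide using den[OF that] by (simp add: divide_simps)
  qed
  define h where "h = \<psi> \<circ> g \<circ> c"
  have holc: "c holomorphic_on ball 0 1" unfolding c_def by (intro holomorphic_intros) auto
  have hol\<psi>: "\<psi> holomorphic_on upper_half_plane" unfolding \<psi>_def
    using den by (intro holomorphic_intros) auto
  have holh: "h holomorphic_on ball 0 1" unfolding h_def
    apply (intro holomorphic_on_compose_gen[where t=upper_half_plane] holc hol hol\<psi>)
    using Imc pos by auto
  have h0: "h 0 = 0" by (simp add: h_def c_def \<psi>_def)
  have hlt: "norm (h \<zeta>) < 1" if "norm \<zeta> < 1" for \<zeta>
    unfolding h_def using \<psi>lt pos Imc that by simp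
  define \<zeta> where "\<zeta> = (z - w) / (z - cnj w)"
  have zne: "z - cnj w \<noteq> 0"
  proof
    assume "z - cnj w = 0" hence "Im (z - cnj w) = 0" by simp
    thus False using z w by simp
  qed
  have "(norm (z - w))\<^sup>2 < (norm (z - cnj w))\<^sup>2" unfolding norm_diff_cnj_square using z w by simp
  hence lt: "norm (z - w) < norm (z - cnj w)" by (rule power_less_imp_less_base) simp
  have \<zeta>1: "norm \<zeta> < 1" unfolding \<zeta>_def norm_divide using lt by (simp add: divide_simps)
  have ne1: "1 - \<zeta> \<noteq> 0" using \<zeta>1 by auto
  have wne: "w - cnj w \<noteq> 0" using w by (auto simp: complex_eq_iff)
  have e1: "1 - \<zeta> = (w - cnj w) / (z - cnj w)" unfolding \<zeta>_def using zne by (simp add: divide_simps)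
  have e2: "w - cnj w * \<zeta> = z * (w - cnj w) / (z - cnj w)" unfolding \<zeta>_def using zne
    by (simp add: divide_simps algebra_simps)
  have "c \<zeta> = z" unfolding c_def e1 e2 using zne wne by simp
  hence "norm (\<psi> (g z)) \<le> norm \<zeta>"
    using Schwarz_Lemma(1)[OF holh h0 hlt \<zeta>1] by (simp add: h_def)
  hence "norm (g z - g w) * norm (z - cnj w) \<le> norm (z - w) * norm (g z - cnj (g w))"
    unfolding \<psi>_def \<zeta>_def norm_divide using den[OF pos[OF z]] zne by (simp add: divide_simps mult_ac)
  hence "(norm (g z - g w) * norm (z - cnj w))\<^sup>2 \<le> (norm (z - w) * norm (g z - cnj (g w)))\<^sup>2"
    by (intro power_mono) auto
  hence "(norm (g z - g w))\<^sup>2 * ((norm (z - w))\<^sup>2 + 4 * Im z * Im w)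
     \<le> (norm (z - w))\<^sup>2 * ((norm (g z - g w))\<^sup>2 + 4 * Im (g z) * Im (g w))"
    unfolding power_mult_distrib norm_diff_cnj_square .
  thus ?thesis by (simp add: algebra_simps)
qed

text \<open>Adding \<open>\<i> \<epsilon>\<close> to \<open>g\<close> makes the imaginary part strictly positive; then \<open>\<epsilon> \<rightarrow> 0\<close>. A vanishing
  imaginary part forces \<open>g\<close> to be constant, a case that is used below.\<close>

lemma schwarz_pick:
  assumes hol: "g holomorphic_on upper_half_plane"
    and pos: "\<And>z. 0 < Im z \<Longrightarrow> 0 \<le> Im (g z)"
    and z: "0 < Im z" and w: "0 < Im w"
  shows "(norm (g z - g w))\<^sup>2 * (Im z * Im w) \<le> Im (g z) * Im (g w) * (norm (z - w))\<^sup>2"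
proof -
  have "(norm (g z - g w))\<^sup>2 * (Im z * Im w)
     \<le> (Im (g z) + e) * (Im (g w) + e) * (norm (z - w))\<^sup>2" if "0 < e" for e
  proof -
    have "(\<lambda>z. g z + \<i> * of_real e) holomorphic_on upper_half_plane" by (intro holomorphic_intros hol)
    from schwarz_pick_strict[OF this _ z w] show ?thesis using pos that by (simp add: add_nonneg_pos)
  qed
  hence ev: "eventually (\<lambda>e. (norm (g z - g w))\<^sup>2 * (Im z * Im w)
     \<le> (Im (g z) + e) * (Im (g w) + e) * (norm (z - w))\<^sup>2) (at_right 0)"
    by (rule eventually_mono[OF eventually_at_right_less[of "0::real"]])
  have "((\<lambda>e. (Im (g z) + e) * (Im (g w) + e) * (norm (z - w))\<^sup>2) \<longlongrightarrow> (Im (g z) + 0) * (Im (g w) + 0) * (norm (z - w))\<^sup>2) (at_right 0)"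
    by (intro tendsto_intros)
  from tendsto_lowerbound[OF this ev] show ?thesis by simp
qed

lemma norm_diff_imaginary_axis:
  "((\<lambda>y. norm (z - \<i> * of_real y) / y) \<longlongrightarrow> 1) at_top"
proof -
  have "((\<lambda>y::real. norm (z / of_real y - \<i>)) \<longlongrightarrow> norm (0 - \<i>)) at_top"
    by (intro tendsto_intros tendsto_divide_0[OF tendsto_const] filterlim_of_real_at_infinity)
  moreover have "eventually (\<lambda>y. norm (z / of_real y - \<i>) = norm (z - \<i> * of_real y) / y) at_top"
    using eventually_gt_at_top[of 0]
  proof eventually_elim
    case (elim y)
    have "z / of_real y - \<i> = (z - \<i> * of_real y) / of_real y" using elim by (simp add: divide_simps)
    thus ?case using elim by (simp add: norm_divide)
  qed
  ultimately show ?thesis using Lim_transform_eventually by fastforce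
qed

text \<open>A form of Julia's lemma at infinity. In the Schwarz-Pick inequality with \<open>w = \<i> y\<close>, divided by \<open>y\<^sup>2\<close>,
  the limit \<open>y \<rightarrow> \<infinity>\<close> gives \<open>|g z|\<^sup>2 Im z \<le> Im L * Im (g z)\<close>, and \<open>Im (g z) \<le> |g z|\<close>.\<close>

lemma pick_bound:
  assumes hol: "g holomorphic_on upper_half_plane"
    and pos: "\<And>z. 0 < Im z \<Longrightarrow> 0 \<le> Im (g z)"
    and lim: "((\<lambda>y. of_real y * g (\<i> * of_real y)) \<longlongrightarrow> L) at_top"
    and z: "0 < Im z"
  shows "norm (g z) \<le> Im L / Im z"
proof -
  define v where "v = Im L"
  have "((\<lambda>y. Im (of_real y * g (\<i> * of_real y))) \<longlongrightarrow> v) at_top"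
    unfolding v_def by (intro tendsto_intros lim)
  hence L1: "((\<lambda>y. y * Im (g (\<i> * of_real y))) \<longlongrightarrow> v) at_top" by simp
  have "eventually (\<lambda>y. 0 \<le> y * Im (g (\<i> * of_real y))) at_top"
    using eventually_gt_at_top[of 0] by eventually_elim (use pos in auto)
  hence v0: "0 \<le> v" by (intro tendsto_lowerbound[OF L1]) auto
  have "((\<lambda>y. of_real y * g (\<i> * of_real y) * of_real (inverse y)) \<longlongrightarrow> L * of_real 0) at_top"
    by (intro tendsto_intros lim tendsto_inverse_0_at_top filterlim_ident)
  moreover have "eventually (\<lambda>y. of_real y * g (\<i> * of_real y) * of_real (inverse y) = g (\<i> * of_real y)) at_top"
    using eventually_gt_at_top[of 0] by eventually_elim (simp add: field_simps)
  ultimately have L2: "((\<lambda>y. g (\<i> * of_real y)) \<longlongrightarrow> 0) at_top"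
    using Lim_transform_eventually by fastforce
  have "((\<lambda>y. (norm (g z - g (\<i> * of_real y)))\<^sup>2 * Im z) \<longlongrightarrow> (norm (g z - 0))\<^sup>2 * Im z) at_top"
    by (intro tendsto_intros L2)
  moreover have "((\<lambda>y. Im (g z) * (y * Im (g (\<i> * of_real y))) * (norm (z - \<i> * of_real y) / y)\<^sup>2) \<longlongrightarrow> Im (g z) * v * 1\<^sup>2) at_top"
    by (intro tendsto_intros L1 norm_diff_imaginary_axis)
  moreover have "eventually (\<lambda>y. (norm (g z - g (\<i> * of_real y)))\<^sup>2 * Im z \<le> Im (g z) * (y * Im (g (\<i> * of_real y))) * (norm (z - \<i> * of_real y) / y)\<^sup>2) at_top"
    using eventually_gt_at_top[of 0]
  proof eventually_elim
    case (elim y)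
    show ?case using schwarz_pick[OF hol pos z, of "\<i> * of_real y"] elim
      by (simp add: field_simps power2_eq_square)
  qed
  ultimately have "(norm (g z - 0))\<^sup>2 * Im z \<le> Im (g z) * v * 1\<^sup>2"
    by (intro tendsto_le[OF trivial_limit_at_top_linorder])
  hence sq: "(norm (g z))\<^sup>2 * Im z \<le> Im (g z) * v" by simp
  have "norm (g z) * (norm (g z) * Im z) \<le> norm (g z) * v"
  proof -
    have "Im (g z) * v \<le> norm (g z) * v" using abs_Im_le_cmod[of "g z"] v0 by (intro mult_right_mono) auto
    thus ?thesis using sq by (simp add: power2_eq_square mult_ac)
  qed
  hence "norm (g z) * Im z \<le> v" using v0 z by (cases "g z = 0") (auto simp: mult_le_cancel_left)
  thus ?thesis using z by (simp add: v_def field_simps)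
qed

section \<open>Hydrodynamic normalisation at infinity\<close>

text \<open>The expansion \<open>k(z) = z - v/z + o(1/z)\<close> along the imaginary axis. For the reciprocal Cauchy
  transform of a centred measure \<open>v\<close> is the variance.\<close>

definition hydrodynamic :: "real \<Rightarrow> (complex \<Rightarrow> complex) \<Rightarrow> bool" where
  "hydrodynamic v k \<longleftrightarrow> k holomorphic_on upper_half_plane \<and> (\<forall>z. 0 < Im z \<longrightarrow> Im z \<le> Im (k z)) \<and>
     ((\<lambda>y. of_real y * (k (\<i> * of_real y) - \<i> * of_real y)) \<longlongrightarrow> \<i> * of_real v) at_top"

text \<open>Only positivity of \<open>Im (k z)\<close> has to be checked: Schwarz-Pick with the second point at infinity, where
  \<open>k\<close> is asymptotic to the identity, improves it to \<open>Im z \<le> Im (k z)\<close>.\<close>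

lemma hydrodynamicI:
  assumes hol: "k holomorphic_on upper_half_plane"
    and pos: "\<And>z. 0 < Im z \<Longrightarrow> 0 < Im (k z)"
    and lim: "((\<lambda>y. of_real y * (k (\<i> * of_real y) - \<i> * of_real y)) \<longlongrightarrow> \<i> * of_real v) at_top"
  shows "hydrodynamic v k"
proof -
  have "((\<lambda>y. of_real y * (k (\<i> * of_real y) - \<i> * of_real y) * of_real (inverse y) * of_real (inverse y) + \<i>) \<longlongrightarrow> \<i> * of_real v * of_real 0 * of_real 0 + \<i>) at_top"
    by (intro tendsto_intros lim tendsto_inverse_0_at_top filterlim_ident)
  moreover have "eventually (\<lambda>y. of_real y * (k (\<i> * of_real y) - \<i> * of_real y) * of_real (inverse y) * of_real (inverse y) + \<i> = k (\<i> * of_real y) / of_real y) at_top"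
    using eventually_gt_at_top[of 0] by eventually_elim (simp add: field_simps)
  ultimately have L2: "((\<lambda>y. k (\<i> * of_real y) / of_real y) \<longlongrightarrow> \<i>) at_top" using Lim_transform_eventually by fastforce
  have L3: "((\<lambda>y. k z / of_real y) \<longlongrightarrow> 0) at_top" for z
    by (intro tendsto_divide_0[OF tendsto_const] filterlim_of_real_at_infinity)
  have "Im z \<le> Im (k z)" if z: "0 < Im z" for z
  proof -
    have "((\<lambda>y. (norm (k z / of_real y - k (\<i> * of_real y) / of_real y))\<^sup>2 * Im z) \<longlongrightarrow> (norm (0 - \<i>))\<^sup>2 * Im z) at_top"
      by (intro tendsto_intros L2 L3)
    moreover have "((\<lambda>y. Im (k z) * Im (k (\<i> * of_real y) / of_real y) * (norm (z - \<i> * of_real y) / y)\<^sup>2) \<longlongrightarrow> Im (k z) * Im \<i> * 1\<^sup>2) at_top"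
      by (intro tendsto_intros L2 norm_diff_imaginary_axis)
    moreover have "eventually (\<lambda>y. (norm (k z / of_real y - k (\<i> * of_real y) / of_real y))\<^sup>2 * Im z \<le> Im (k z) * Im (k (\<i> * of_real y) / of_real y) * (norm (z - \<i> * of_real y) / y)\<^sup>2) at_top"
      using eventually_gt_at_top[of 0]
    proof eventually_elim
      case (elim y)
      have "norm (k z / of_real y - k (\<i> * of_real y) / of_real y) = norm (k z - k (\<i> * of_real y)) / y"
        using elim by (simp add: diff_divide_distrib[symmetric] norm_divide)
      thus ?case using schwarz_pick[OF hol less_imp_le[OF pos] z, of "\<i> * of_real y"] elim
        unfolding Im_divide_of_real by (simp only:) (simp add: field_simps power2_eq_square)
    qed
    ultimately show ?thesis
      by (auto dest: tendsto_le[OF trivial_limit_at_top_linorder])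
  qed
  thus ?thesis using hol lim by (auto simp: hydrodynamic_def)
qed

lemma hydrodynamic_nonneg: assumes "hydrodynamic v k" shows "0 \<le> v"
proof -
  have "((\<lambda>y. Im (of_real y * (k (\<i> * of_real y) - \<i> * of_real y))) \<longlongrightarrow> Im (\<i> * of_real v)) at_top"
    using assms unfolding hydrodynamic_def by (intro tendsto_Im) auto
  moreover have "eventually (\<lambda>y. 0 \<le> Im (of_real y * (k (\<i> * of_real y) - \<i> * of_real y))) at_top"
    using eventually_gt_at_top[of 0]
  proof eventually_elim
    case (elim y) thus ?case using assms unfolding hydrodynamic_def
      by (auto intro!: mult_nonneg_nonneg dest: spec[of _ "\<i> * of_real y"])
  qed
  ultimately show ?thesis using tendsto_lowerbound by fastforce
qed

lemma hydrodynamic_bound: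
  assumes "hydrodynamic v k" "0 < Im z"
  shows "norm (k z - z) \<le> v / Im z"
proof -
  have "norm (k z - z) \<le> Im (\<i> * of_real v) / Im z"
    using assms unfolding hydrodynamic_def
    by (intro pick_bound[where g="\<lambda>z. k z - z"]) (auto intro!: holomorphic_intros)
  thus ?thesis by simp
qed

text \<open>Schwarz-Pick bounds the difference by the imaginary parts of \<open>k - id\<close>, and \<open>hydrodynamic_bound\<close>
  bounds those.\<close>

lemma hydrodynamic_lipschitz:
  assumes k: "hydrodynamic v k" and z: "0 < Im z" and w: "0 < Im w"
  shows "norm ((k z - z) - (k w - w)) \<le> v * norm (z - w) / (Im z * Im w)"
proof -
  have v: "0 \<le> v" using hydrodynamic_nonneg[OF k] .
  have Im: "Im (k z - z) \<le> v / Im z" "0 \<le> Im (k z - z)" if "0 < Im z" for z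
    using hydrodynamic_bound[OF k that] abs_Im_le_cmod[of "k z - z"] k that by (auto simp: hydrodynamic_def)
  have "(norm ((k z - z) - (k w - w)))\<^sup>2 * (Im z * Im w) \<le> Im (k z - z) * Im (k w - w) * (norm (z - w))\<^sup>2"
    using k z w unfolding hydrodynamic_def
    by (intro schwarz_pick[where g="\<lambda>z. k z - z"]) (auto intro!: holomorphic_intros)
  also have "\<dots> \<le> (v / Im z) * (v / Im w) * (norm (z - w))\<^sup>2"
    using Im z w v by (intro mult_right_mono mult_mono) auto
  finally have "(norm ((k z - z) - (k w - w)))\<^sup>2 \<le> (v * norm (z - w) / (Im z * Im w))\<^sup>2"
    using z w by (simp add: field_simps power2_eq_square)
  thus ?thesis using v z w by (rule_tac power2_le_imp_le) auto
qed

lemma hydrodynamic_unique: "hydrodynamic v k \<Longrightarrow> hydrodynamic v' k \<Longrightarrow> v = v'"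
proof -
  assume "hydrodynamic v k" "hydrodynamic v' k"
  hence "\<i> * complex_of_real v = \<i> * complex_of_real v'" unfolding hydrodynamic_def
    by (intro tendsto_unique[OF trivial_limit_at_top_linorder]) auto
  thus ?thesis by simp
qed

lemma hydrodynamic_id: "(\<And>z. 0 < Im z \<Longrightarrow> k z = z) \<Longrightarrow> hydrodynamic 0 k"
  unfolding hydrodynamic_def
proof (intro conjI)
  assume a: "\<And>z. 0 < Im z \<Longrightarrow> k z = z"
  show "k holomorphic_on upper_half_plane" by (rule holomorphic_transform[where f="\<lambda>z. z"]) (auto simp: a intro: holomorphic_intros)
  have "eventually (\<lambda>y. 0 = of_real y * (k (\<i> * of_real y) - \<i> * of_real y)) at_top"
    using eventually_gt_at_top[of 0] by eventually_elim (simp add: a)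
  from Lim_transform_eventually[OF tendsto_const this]
  show "((\<lambda>y. of_real y * (k (\<i> * of_real y) - \<i> * of_real y)) \<longlongrightarrow> \<i> * of_real 0) at_top" by simp
qed auto

lemma hydrodynamic_approach:
  assumes "hydrodynamic v k" "0 < e"
  obtains y where "0 < y" "v - e < norm (of_real y * (k (\<i> * of_real y) - \<i> * of_real y))"
proof -
  have "((\<lambda>y. norm (of_real y * (k (\<i> * of_real y) - \<i> * of_real y))) \<longlongrightarrow> norm (\<i> * complex_of_real v)) at_top"
    using assms(1) unfolding hydrodynamic_def by (intro tendsto_norm) auto
  hence "eventually (\<lambda>y. v - e < norm (of_real y * (k (\<i> * of_real y) - \<i> * of_real y))) at_top"
    using assms(2) by (intro order_tendstoD(1)) (auto simp: norm_mult)
  from eventually_happens[OF eventually_conj[OF this eventually_gt_at_top[of 0]]] that show ?thesis by auto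
qed

text \<open>By \<open>hydrodynamic_bound\<close> and the expansion, \<open>v\<close> is the supremum over \<open>y\<close> of \<open>y |k(iy) - iy|\<close>, and a
  supremum of continuous functionals is lower semicontinuous.\<close>

lemma hydrodynamic_lower_semicontinuous:
  fixes k :: "real \<Rightarrow> complex \<Rightarrow> complex"
  assumes ev: "eventually (\<lambda>u. hydrodynamic (v u) (k u)) F" and h: "hydrodynamic v0 k0"
    and lim: "\<And>z. 0 < Im z \<Longrightarrow> ((\<lambda>u. k u z) \<longlongrightarrow> k0 z) F" and e: "0 < e"
  shows "eventually (\<lambda>u. v0 - e < v u) F"
proof -
  obtain y where y: "0 < y" "v0 - e < norm (of_real y * (k0 (\<i> * of_real y) - \<i> * of_real y))"
    using hydrodynamic_approach[OF h e] .
  have "((\<lambda>u. norm (of_real y * (k u (\<i> * of_real y) - \<i> * of_real y))) \<longlongrightarrow> norm (of_real y * (k0 (\<i> * of_real y) - \<i> * of_real y))) F"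
    by (intro tendsto_intros lim) (use y in auto)
  from order_tendstoD(1)[OF this y(2)] ev show ?thesis
  proof eventually_elim
    case (elim u)
    have "norm (of_real y * (k u (\<i> * of_real y) - \<i> * of_real y)) \<le> y * (v u / y)"
      unfolding norm_mult using hydrodynamic_bound[OF elim(2), of "\<i> * of_real y"] y(1) by (intro mult_mono) auto
    thus ?case using elim(1) y(1) by simp
  qed
qed

text \<open>With \<open>G\<close> the Cauchy transform, two uses of \<open>z/(z - x) = 1 + x/(z - x)\<close> and the vanishing mean give
  \<open>z (f z - z) (z G z) = - \<integral> x\<^sup>2 z/(z - x) \<mu>(dx)\<close>. On the imaginary axis \<open>|z/(z - x)| \<le> 1\<close>, so dominated
  convergence shows that the right-hand side tends to minus the second moment and \<open>z G z\<close> to 1.\<close>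

lemma P20_hydrodynamic:
  assumes "f \<in> P20" and hol: "f holomorphic_on upper_half_plane"
  obtains v where "hydrodynamic v f"
proof -
  obtain \<mu> where \<mu>: "real_distribution \<mu>" and sq: "integrable \<mu> (\<lambda>x. x\<^sup>2)" and mean: "(\<integral>x. x \<partial>\<mu>) = 0"
    and f: "\<And>z. 0 < Im z \<Longrightarrow> f z = recip_cauchy_transform \<mu> z"
    using assms(1) by (auto simp: P20_def)
  interpret real_distribution \<mu> by fact
  define G where "G = cauchy_transform \<mu>"
  have xmeas: "(\<lambda>x. x) \<in> borel_measurable \<mu>" by simp
  have int1: "integrable \<mu> (\<lambda>x::real. x)"
    using sq by (rule square_integrable_imp_integrable[OF xmeas])
  have ne: "z - of_real x \<noteq> 0" if "0 < Im z" for z x using that by (auto simp: complex_eq_iff)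
  have nb: "norm (1 / (z - of_real x)) \<le> 1 / Im z" if "0 < Im z" for z x
    using abs_Im_le_cmod[of "z - of_real x"] that by (simp add: norm_divide frac_le)
  have intG: "integrable \<mu> (\<lambda>x. 1 / (z - of_real x))" if "0 < Im z" for z
    by (rule integrable_const_bound[where B="1 / Im z"]) (use nb[OF that] in auto)
  have int2: "integrable \<mu> (\<lambda>x. of_real (x\<^sup>2) * (1 / (z - of_real x)))" if "0 < Im z" for z
  proof (rule Bochner_Integration.integrable_bound)
    show "integrable \<mu> (\<lambda>x. x\<^sup>2 * (1 / Im z))" using sq by (intro integrable_mult_left) auto
    show "AE x in \<mu>. norm (complex_of_real (x\<^sup>2) * (1 / (z - of_real x))) \<le> norm (x\<^sup>2 * (1 / Im z))"
    proof (intro AE_I2)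
      fix x
      have "norm (complex_of_real (x\<^sup>2) * (1 / (z - of_real x))) = x\<^sup>2 * norm (1 / (z - of_real x))"
        unfolding norm_mult by (simp add: norm_power)
      also have "\<dots> \<le> x\<^sup>2 * (1 / Im z)" by (intro mult_left_mono nb that) auto
      finally show "norm (complex_of_real (x\<^sup>2) * (1 / (z - of_real x))) \<le> norm (x\<^sup>2 * (1 / Im z))" using that by simp
    qed
  qed measurable
  have ImG: "Im (G z) < 0" if z: "0 < Im z" for z
  proof -
    have im: "Im (1 / (z - of_real x)) = - (Im z / (norm (z - of_real x))\<^sup>2)" for x
      by (simp add: Im_divide cmod_power2)
    have "Im (G z) = (\<integral>x. Im (1 / (z - of_real x)) \<partial>\<mu>)"
      unfolding G_def cauchy_transform_def using integral_Im[OF intG[OF z]] by simp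
    moreover have "(\<integral>x. - Im (1 / (z - of_real x)) \<partial>\<mu>) > 0"
    proof -
      have i: "integrable \<mu> (\<lambda>x. - Im (1 / (z - of_real x)))" using intG[OF z] by (intro integrable_minus integrable_Im)
      have "(\<integral>x. - Im (1 / (z - of_real x)) \<partial>\<mu>) \<ge> 0"
        by (intro Bochner_Integration.integral_nonneg) (use z in \<open>auto simp: im\<close>)
      moreover have "(\<integral>x. - Im (1 / (z - of_real x)) \<partial>\<mu>) \<noteq> 0"
      proof
        assume "(\<integral>x. - Im (1 / (z - of_real x)) \<partial>\<mu>) = 0"
        hence "AE x in \<mu>. - Im (1 / (z - of_real x)) = 0"
          by (subst (asm) integral_nonneg_eq_0_iff_AE[OF i]) (use z in \<open>auto simp: im\<close>)
        hence "AE x in \<mu>. False" by (rule AE_mp) (use z ne[OF z] in \<open>auto simp: im\<close>)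
        thus False by (simp add: AE_False)
      qed
      ultimately show ?thesis by linarith
    qed
    ultimately show ?thesis using integral_minus[of \<mu> "\<lambda>x. Im (1 / (z - of_real x))"] by simp
  qed
  have Gne: "G z \<noteq> 0" if "0 < Im z" for z using ImG[OF that] by auto
  have pos: "0 < Im (f z)" if z: "0 < Im z" for z
    using ImG[OF z] f[OF z] by (simp add: recip_cauchy_transform_def G_def[symmetric] Im_divide sum_power2_gt_zero_iff divide_neg_pos)
  define v where "v = (\<integral>x. x\<^sup>2 \<partial>\<mu>)"
  have main: "z * (f z - z) * (z * G z) = - (\<integral>x. of_real (x\<^sup>2) * (z / (z - of_real x)) \<partial>\<mu>)" if z: "0 < Im z" for z
  proof -
    have e: "1 - z * (1 / (z - of_real x)) = - (of_real x * (1 / (z - of_real x)))"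
        "z * (of_real x * (1 / (z - of_real x))) = of_real x + of_real (x\<^sup>2) * (1 / (z - of_real x))" for x
      using ne[OF z, of x] by (simp_all add: divide_simps power2_eq_square algebra_simps)
    have intx: "integrable \<mu> (\<lambda>x. of_real x * (1 / (z - of_real x)))"
    proof -
      have "integrable \<mu> (\<lambda>x. (of_real x + of_real (x\<^sup>2) * (1 / (z - of_real x))) / z)"
        using int1 int2[OF z] by (intro integrable_divide Bochner_Integration.integrable_add) auto
      also have "(\<lambda>x. (of_real x + of_real (x\<^sup>2) * (1 / (z - of_real x))) / z) = (\<lambda>x::real. of_real x * (1 / (z - of_real x)))"
        unfolding e(2)[symmetric] using z by (auto simp: fun_eq_iff)
      finally show ?thesis .
    qed
    have i1: "integrable \<mu> (\<lambda>x. z * (1 / (z - of_real x)))" using intG[OF z] by (rule integrable_mult_right)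
    have "(\<integral>x. 1 - z * (1 / (z - of_real x)) \<partial>\<mu>) = (\<integral>x. 1 \<partial>\<mu>) - (\<integral>x. z * (1 / (z - of_real x)) \<partial>\<mu>)"
      by (rule Bochner_Integration.integral_diff[OF _ i1]) simp
    also have "(\<integral>x. 1 \<partial>\<mu>) = (1 :: complex)" using prob_space by simp
    also have "(\<integral>x. z * (1 / (z - of_real x)) \<partial>\<mu>) = z * G z"
      unfolding G_def cauchy_transform_def by (rule integral_mult_right_zero)
    finally have "1 - z * G z = (\<integral>x. 1 - z * (1 / (z - of_real x)) \<partial>\<mu>)" ..
    also have "\<dots> = - (\<integral>x. of_real x * (1 / (z - of_real x)) \<partial>\<mu>)" unfolding e(1) by simp
    finally have "z * (1 - z * G z) = z * - (\<integral>x. of_real x * (1 / (z - of_real x)) \<partial>\<mu>)" by (rule arg_cong)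
    also have "\<dots> = - (\<integral>x. z * (of_real x * (1 / (z - of_real x))) \<partial>\<mu>)"
      unfolding integral_mult_right_zero by simp
    also have "\<dots> = - (\<integral>x. of_real (x\<^sup>2) * (1 / (z - of_real x)) \<partial>\<mu>)"
      unfolding e(2) using int1 int2[OF z] mean by (subst Bochner_Integration.integral_add) (auto simp del: of_real_power)
    finally have "z * (1 - z * G z) = - (\<integral>x. of_real (x\<^sup>2) * (1 / (z - of_real x)) \<partial>\<mu>)" .
    moreover have "f z - z = (1 - z * G z) / G z" using f[OF z] Gne[OF z]
      by (simp add: recip_cauchy_transform_def G_def[symmetric] divide_simps left_diff_distrib)
    ultimately have "z * (f z - z) * (z * G z) = z * - (\<integral>x. of_real (x\<^sup>2) * (1 / (z - of_real x)) \<partial>\<mu>)"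
      using Gne[OF z] by simp
    also have "\<dots> = - (\<integral>x. z * (of_real (x\<^sup>2) * (1 / (z - of_real x))) \<partial>\<mu>)"
      unfolding integral_mult_right_zero by simp
    finally show ?thesis by (simp add: mult_ac)
  qed
  have lim0: "((\<lambda>y. \<i> * of_real y / (\<i> * of_real y - of_real x)) \<longlongrightarrow> 1) at_top" for x :: real
  proof -
    have "((\<lambda>y. \<i> / (\<i> - of_real x * of_real (inverse y))) \<longlongrightarrow> \<i> / (\<i> - of_real x * of_real 0)) at_top"
      by (intro tendsto_intros tendsto_inverse_0_at_top filterlim_ident) auto
    moreover have "eventually (\<lambda>y. \<i> / (\<i> - of_real x * of_real (inverse y)) = \<i> * of_real y / (\<i> * of_real y - of_real x)) at_top"
      using eventually_gt_at_top[of 0]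
    proof eventually_elim
      case (elim y)
      have "\<i> * of_real y - of_real x = of_real y * (\<i> - of_real x * of_real (inverse y))" using elim by (simp add: field_simps)
      thus ?case using elim by simp
    qed
    ultimately show ?thesis using Lim_transform_eventually by fastforce
  qed
  have nb1: "norm (\<i> * of_real y / (\<i> * of_real y - of_real x)) \<le> 1" if "0 < y" for x y :: real
    using nb[of "\<i> * of_real y" x] that by (simp add: norm_divide norm_mult field_simps)
  have limG: "((\<lambda>y. \<i> * of_real y * G (\<i> * of_real y)) \<longlongrightarrow> 1) at_top"
  proof -
    have "((\<lambda>y. \<integral>x. \<i> * of_real y / (\<i> * of_real y - of_real x) \<partial>\<mu>) \<longlongrightarrow> (\<integral>x. 1 \<partial>\<mu>)) at_top"
    proof (rule integral_dominated_convergence_at_top[where w="\<lambda>_. 1"])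
      show "eventually (\<lambda>y. AE x in \<mu>. norm (\<i> * of_real y / (\<i> * of_real y - of_real x)) \<le> 1) at_top"
        using eventually_gt_at_top[of 0] by eventually_elim (use nb1 in auto)
    qed (use lim0 in auto)
    moreover have "eventually (\<lambda>y. (\<integral>x. \<i> * of_real y / (\<i> * of_real y - of_real x) \<partial>\<mu>) = \<i> * of_real y * G (\<i> * of_real y)) at_top"
      using eventually_gt_at_top[of 0]
    proof eventually_elim
      case (elim y)
      have "(\<integral>x. \<i> * of_real y * (1 / (\<i> * of_real y - of_real x)) \<partial>\<mu>) = \<i> * of_real y * G (\<i> * of_real y)"
        unfolding G_def cauchy_transform_def by (rule integral_mult_right_zero)
      thus ?case by simp
    qed
    ultimately have "((\<lambda>y. \<i> * of_real y * G (\<i> * of_real y)) \<longlongrightarrow> (\<integral>x. 1 \<partial>\<mu>)) at_top"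
      by (rule Lim_transform_eventually)
    thus ?thesis using prob_space by simp
  qed
  have lim2: "((\<lambda>y. \<integral>x. of_real (x\<^sup>2) * (\<i> * of_real y / (\<i> * of_real y - of_real x)) \<partial>\<mu>) \<longlongrightarrow> (\<integral>x. of_real (x\<^sup>2) * 1 \<partial>\<mu>)) at_top"
  proof (rule integral_dominated_convergence_at_top[where w="\<lambda>x. x\<^sup>2"])
    show "eventually (\<lambda>y. AE x in \<mu>. norm (complex_of_real (x\<^sup>2) * (\<i> * of_real y / (\<i> * of_real y - of_real x))) \<le> x\<^sup>2) at_top"
      using eventually_gt_at_top[of 0]
    proof eventually_elim
      case (elim y)
      have "norm (complex_of_real (x\<^sup>2) * (\<i> * of_real y / (\<i> * of_real y - of_real x))) \<le> x\<^sup>2 * 1" for x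
        unfolding norm_mult[of "complex_of_real (x\<^sup>2)"] norm_of_real using nb1[OF elim, of x]
        by (intro mult_mono) auto
      thus ?case by simp
    qed
    show "AE x in \<mu>. ((\<lambda>y. complex_of_real (x\<^sup>2) * (\<i> * of_real y / (\<i> * of_real y - of_real x))) \<longlongrightarrow> complex_of_real (x\<^sup>2) * 1) at_top"
      by (intro AE_I2 tendsto_intros lim0)
  qed (use sq in auto)
  have "((\<lambda>y. - (- (\<integral>x. of_real (x\<^sup>2) * (\<i> * of_real y / (\<i> * of_real y - of_real x)) \<partial>\<mu>)) / (\<i> * of_real y * G (\<i> * of_real y)) * \<i>) \<longlongrightarrow> - (- (\<integral>x. of_real (x\<^sup>2) * 1 \<partial>\<mu>)) / 1 * \<i>) at_top"
    by (intro tendsto_intros lim2 limG) auto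
  moreover have "eventually (\<lambda>y. - (- (\<integral>x. of_real (x\<^sup>2) * (\<i> * of_real y / (\<i> * of_real y - of_real x)) \<partial>\<mu>)) / (\<i> * of_real y * G (\<i> * of_real y)) * \<i>
      = of_real y * (f (\<i> * of_real y) - \<i> * of_real y)) at_top"
    using eventually_gt_at_top[of 0]
  proof eventually_elim
    case (elim y)
    have im: "0 < Im (\<i> * of_real y)" using elim by simp
    have ne: "\<i> * of_real y * G (\<i> * of_real y) \<noteq> 0" using Gne[OF im] elim by simp
    show ?case unfolding main[OF im, symmetric] minus_mult_left nonzero_mult_div_cancel_right[OF ne]
      by (simp add: complex_eq_iff)
  qed
  ultimately have "((\<lambda>y. of_real y * (f (\<i> * of_real y) - \<i> * of_real y)) \<longlongrightarrow> - (- (\<integral>x. of_real (x\<^sup>2) * 1 \<partial>\<mu>)) / 1 * \<i>) at_top"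
    by (rule Lim_transform_eventually)
  moreover have "- (- (\<integral>x. of_real (x\<^sup>2) * 1 \<partial>\<mu>)) / 1 * \<i> = \<i> * of_real v" unfolding v_def by (simp del: of_real_power)
  ultimately have "((\<lambda>y. of_real y * (f (\<i> * of_real y) - \<i> * of_real y)) \<longlongrightarrow> \<i> * of_real v) at_top"
    by (simp only:)
  from hydrodynamicI[OF hol pos this] that show ?thesis by blast
qed

section \<open>Stieltjes transforms of finite measures\<close>

text \<open>The sign is opposite to that of \<open>cauchy_transform\<close>, so that imaginary parts are nonnegative.\<close>

definition stieltjes :: "real measure \<Rightarrow> complex \<Rightarrow> complex" where
  "stieltjes \<rho> z = (\<integral>x. 1 / (of_real x - z) \<partial>\<rho>)"

lemma of_real_minus_ne: "0 < Im z \<Longrightarrow> of_real x - z \<noteq> 0"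
  by (auto simp: complex_eq_iff)

lemma norm_resolvent_le:
  assumes "0 < d" "d \<le> Im z"
  shows "norm (1 / (of_real x - z)) \<le> 1 / d"
  using abs_Im_le_cmod[of "of_real x - z"] assms by (auto simp: norm_divide intro!: frac_le)

lemma Im_resolvent: "Im (1 / (of_real x - z)) = Im z / ((x - Re z)\<^sup>2 + (Im z)\<^sup>2)"
  by (simp add: Im_divide)

locale finite_real_measure = finite_measure \<rho> for \<rho> :: "real measure" +
  assumes sets_eq [measurable_cong]: "sets \<rho> = sets borel"
begin

lemma space_UNIV [simp]: "space \<rho> = UNIV"
  using sets_eq_imp_space_eq[OF sets_eq] by simp

lemma integrable_resolvent: "0 < Im z \<Longrightarrow> integrable \<rho> (\<lambda>x. 1 / (of_real x - z))"
  by (rule integrable_const_bound[where B="1 / Im z"]) (use norm_resolvent_le[of "Im z" z] in auto)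

lemma Im_stieltjes: "0 < Im z \<Longrightarrow> Im (stieltjes \<rho> z) = (\<integral>x. Im z / ((x - Re z)\<^sup>2 + (Im z)\<^sup>2) \<partial>\<rho>)"
  unfolding stieltjes_def Im_resolvent[symmetric]
  using integral_Im[OF integrable_resolvent] by simp

lemma Im_stieltjes_nonneg: "0 < Im z \<Longrightarrow> 0 \<le> Im (stieltjes \<rho> z)"
  unfolding Im_stieltjes by (intro Bochner_Integration.integral_nonneg) auto

lemma norm_stieltjes_le:
  assumes "0 < Im z" shows "norm (stieltjes \<rho> z) \<le> measure \<rho> UNIV / Im z"
proof -
  have "norm (stieltjes \<rho> z) \<le> (\<integral>x. 1 / Im z \<partial>\<rho>)"
    unfolding stieltjes_def
    by (rule Bochner_Integration.integral_norm_bound_integral[OF integrable_resolvent[OF assms]]) (use assms norm_resolvent_le[of "Im z" z] in auto)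
  thus ?thesis by (simp add: divide_inverse)
qed

lemma stieltjes_asymptotics:
  "((\<lambda>y. of_real y * stieltjes \<rho> (\<i> * of_real y)) \<longlongrightarrow> \<i> * of_real (measure \<rho> UNIV)) at_top"
proof -
  have lim0: "((\<lambda>y. of_real y * (1 / (of_real x - \<i> * of_real y))) \<longlongrightarrow> \<i>) at_top" for x :: real
  proof -
    have "((\<lambda>y. 1 / (of_real x * of_real (inverse y) - \<i>)) \<longlongrightarrow> 1 / (of_real x * of_real 0 - \<i>)) at_top"
      by (intro tendsto_intros tendsto_inverse_0_at_top filterlim_ident) auto
    moreover have "eventually (\<lambda>y. 1 / (of_real x * of_real (inverse y) - \<i>) = of_real y * (1 / (of_real x - \<i> * of_real y))) at_top"
      using eventually_gt_at_top[of 0]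
    proof eventually_elim
      case (elim y)
      have "of_real x - \<i> * of_real y = of_real y * (of_real x * of_real (inverse y) - \<i>)" using elim by (simp add: field_simps)
      thus ?case using elim by simp
    qed
    ultimately have "((\<lambda>y. of_real y * (1 / (of_real x - \<i> * of_real y))) \<longlongrightarrow> 1 / (of_real x * of_real 0 - \<i>)) at_top"
      by (rule Lim_transform_eventually)
    thus ?thesis by (simp add: divide_inverse)
  qed
  have "((\<lambda>y. \<integral>x. of_real y * (1 / (of_real x - \<i> * of_real y)) \<partial>\<rho>) \<longlongrightarrow> (\<integral>x. \<i> \<partial>\<rho>)) at_top"
  proof (rule integral_dominated_convergence_at_top[where w="\<lambda>_. 1"])
    show "eventually (\<lambda>y. AE x in \<rho>. norm (of_real y * (1 / (of_real x - \<i> * of_real y))) \<le> 1) at_top"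
      using eventually_gt_at_top[of 0]
    proof eventually_elim
      case (elim y)
      have "norm (of_real y * (1 / (of_real x - \<i> * of_real y))) \<le> y * (1 / y)" for x
        unfolding norm_mult using norm_resolvent_le[of y "\<i> * of_real y" x] elim by (intro mult_mono) auto
      thus ?case using elim by auto
    qed
  qed (use lim0 in auto)
  thus ?thesis unfolding stieltjes_def integral_mult_right_zero by (simp add: scaleR_conv_of_real mult.commute)
qed

text \<open>Differentiation under the integral: the difference quotient of the resolvent \<open>r\<^sub>w(x) = 1/(x - w)\<close>
  differs from its derivative \<open>r\<^sub>z\<^sup>2\<close> by \<open>(w - z) r\<^sub>w r\<^sub>z\<^sup>2\<close>.\<close>

lemma holomorphic_stieltjes: "stieltjes \<rho> holomorphic_on upper_half_plane"
  unfolding holomorphic_on_open[OF open_uhp] uhp_iff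
proof (intro allI impI ballI)
  fix z assume "z \<in> upper_half_plane" hence z: "0 < Im z" by simp
  define y where "y = Im z / 2"
  have y: "0 < y" "y \<le> Im z" using z by (auto simp: y_def)
  let ?D = "\<integral>x. (1 / (of_real x - z))\<^sup>2 \<partial>\<rho>"
  have iD: "integrable \<rho> (\<lambda>x. (1 / (of_real x - z))\<^sup>2)"
  proof (rule integrable_const_bound[where B="(1 / Im z)\<^sup>2"])
    show "AE x in \<rho>. norm ((1 / (complex_of_real x - z))\<^sup>2) \<le> (1 / Im z)\<^sup>2"
      unfolding norm_power using norm_resolvent_le[of "Im z" z] z by (intro AE_I2 power_mono) auto
  qed measurable
  have "((\<lambda>w. (stieltjes \<rho> w - stieltjes \<rho> z) / (w - z) - ?D) \<longlongrightarrow> 0) (at z)"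
  proof (rule Lim_null_comparison)
    have "((\<lambda>w. norm (w - z) * (measure \<rho> UNIV / y^3)) \<longlongrightarrow> norm (z - z) * (measure \<rho> UNIV / y^3)) (at z)"
      by (intro tendsto_intros)
    thus "((\<lambda>w. norm (w - z) * (measure \<rho> UNIV / y^3)) \<longlongrightarrow> 0) (at z)" by simp
    have "eventually (\<lambda>w. w \<in> ball z y - {z}) (at z)" using y by (intro eventually_at_in_open) auto
    thus "eventually (\<lambda>w. norm ((stieltjes \<rho> w - stieltjes \<rho> z) / (w - z) - ?D) \<le> norm (w - z) * (measure \<rho> UNIV / y^3)) (at z)"
    proof eventually_elim
      case (elim w)
      have wy: "y \<le> Im w" using elim abs_Im_le_cmod[of "z - w"] by (auto simp: y_def dist_norm)
      hence w: "0 < Im w" using y by simp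
      have ne: "w \<noteq> z" using elim by auto
      let ?r = "\<lambda>w x. 1 / (complex_of_real x - w)"
      have id: "(?r w x - ?r z x) / (w - z) - (?r z x)\<^sup>2 = (w - z) * (?r w x * (?r z x)\<^sup>2)" for x
        using of_real_minus_ne[OF w, of x] of_real_minus_ne[OF z, of x] ne
        by (simp add: divide_simps) (simp add: power2_eq_square algebra_simps)
      have "(stieltjes \<rho> w - stieltjes \<rho> z) / (w - z) - ?D = (\<integral>x. (?r w x - ?r z x) / (w - z) - (?r z x)\<^sup>2 \<partial>\<rho>)"
        unfolding stieltjes_def using iD integrable_resolvent[OF z] integrable_resolvent[OF w]
        by (simp add: Bochner_Integration.integral_diff integral_divide_zero)
      also have "\<dots> = (w - z) * (\<integral>x. ?r w x * (?r z x)\<^sup>2 \<partial>\<rho>)"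
        unfolding id by (rule integral_mult_right_zero)
      also have "norm \<dots> \<le> norm (w - z) * (measure \<rho> UNIV / y^3)"
        unfolding norm_mult
      proof (rule mult_left_mono)
        have b: "norm (?r w x * (?r z x)\<^sup>2) \<le> 1 / y^3" for x
        proof -
          have "norm (?r w x * (?r z x)\<^sup>2) \<le> 1 / y * (1 / y)\<^sup>2"
            unfolding norm_mult norm_power using norm_resolvent_le[OF y(1) wy, of x] norm_resolvent_le[OF y, of x] y(1)
            by (intro mult_mono power_mono) auto
          thus ?thesis by (simp add: power_divide power3_eq_cube power2_eq_square)
        qed
        have "norm (\<integral>x. ?r w x * (?r z x)\<^sup>2 \<partial>\<rho>) \<le> (\<integral>x. 1 / y^3 \<partial>\<rho>)"
          by (rule Bochner_Integration.integral_norm_bound_integral integrable_const_bound[where B="1/y^3"] | use b in \<open>auto\<close>)+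
        thus "norm (\<integral>x. ?r w x * (?r z x)\<^sup>2 \<partial>\<rho>) \<le> measure \<rho> UNIV / y^3" by (simp add: divide_inverse)
      qed simp
      finally show ?case .
    qed
  qed
  hence "(stieltjes \<rho> has_field_derivative ?D) (at z)"
    unfolding has_field_derivative_iff using Lim_null by blast
  thus "\<exists>f'. (stieltjes \<rho> has_field_derivative f') (at z)" by blast
qed

text \<open>Stieltjes inversion for points: \<open>y\<^sup>2 / ((x - a)\<^sup>2 + y\<^sup>2)\<close> tends to the indicator of \<open>a\<close> as \<open>y \<rightarrow> 0\<close>.\<close>

lemma stieltjes_atom:
  "(\<lambda>n. inverse (real (Suc n)) * Im (stieltjes \<rho> (Complex a (inverse (real (Suc n)))))) \<longlonglongrightarrow> measure \<rho> {a}"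
proof -
  let ?y = "\<lambda>n. inverse (real (Suc n))"
  let ?f = "\<lambda>n x. ?y n * (?y n / ((x - a)\<^sup>2 + (?y n)\<^sup>2))"
  have ylim: "?y \<longlonglongrightarrow> 0" by (rule LIMSEQ_inverse_real_of_nat)
  have "(\<lambda>n. \<integral>x. ?f n x \<partial>\<rho>) \<longlonglongrightarrow> (\<integral>x. indicator {a} x \<partial>\<rho>)"
  proof (rule integral_dominated_convergence[where w="\<lambda>_. 1"])
    have "norm (?f n x) \<le> 1" for n x
    proof -
      have "0 < ?y n" by simp
      hence "0 < (x - a)\<^sup>2 + (?y n)\<^sup>2" by (intro add_nonneg_pos) auto
      thus ?thesis by (simp add: divide_simps power2_eq_square del: of_nat_Suc)
    qed
    thus "AE x in \<rho>. norm (?f n x) \<le> 1" for n by auto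
    have "(\<lambda>n. ?f n x) \<longlonglongrightarrow> indicator {a} x" for x
    proof (cases "x = a")
      case True
      have "?f n x = 1" for n using True by (simp add: power2_eq_square del: of_nat_Suc)
      thus ?thesis using True by simp
    next
      case False
      have "(\<lambda>n. ?f n x) \<longlonglongrightarrow> 0 * (0 / ((x - a)\<^sup>2 + 0\<^sup>2))"
        using False by (intro tendsto_intros ylim) auto
      thus ?thesis using False by simp
    qed
    thus "AE x in \<rho>. (\<lambda>n. ?f n x) \<longlonglongrightarrow> indicator {a} x" by auto
  qed auto
  thus ?thesis unfolding integral_mult_right_zero by (simp add: Im_stieltjes del: of_nat_Suc)
qed

text \<open>First step of Stieltjes inversion for intervals: by Tonelli the Poisson kernel may be integrated over
  \<open>[a,b]\<close> first. The imaginary part is integrated as a nonnegative function, so that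
  measures can be added later without integrability side conditions.\<close>

lemma stieltjes_interval:
  assumes ab: "a < b" and y: "0 < y"
  shows "(\<integral>\<^sup>+t. ennreal (Im (stieltjes \<rho> (Complex t y))) * indicator {a..b} t \<partial>lborel) =
    ennreal (\<integral>x. arctan ((b - x) / y) - arctan ((a - x) / y) \<partial>\<rho>)"
    and "0 \<le> (\<integral>x. arctan ((b - x) / y) - arctan ((a - x) / y) \<partial>\<rho>)"
    and "(\<lambda>t. ennreal (Im (stieltjes \<rho> (Complex t y))) * indicator {a..b} t) \<in> borel_measurable lborel"
proof -
  interpret L: sigma_finite_measure "lborel :: real measure" by (rule lborel.sigma_finite_measure_axioms)
  interpret pair_sigma_finite \<rho> "lborel :: real measure" ..
  let ?p = "\<lambda>x t. y / ((x - t)\<^sup>2 + y\<^sup>2)"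
  have pos: "0 < (x - t)\<^sup>2 + y\<^sup>2" for x t using y by (intro add_nonneg_pos) auto
  have 1: "ennreal (Im (stieltjes \<rho> (Complex t y))) = (\<integral>\<^sup>+x. ennreal (?p x t) \<partial>\<rho>)" for t
  proof -
    have i: "integrable \<rho> (\<lambda>x. ?p x t)"
      using integrable_Im[OF integrable_resolvent[of "Complex t y"]] y unfolding Im_resolvent by simp
    show ?thesis using y by (subst nn_integral_eq_integral[OF i]) (auto simp: Im_stieltjes)
  qed
  have 2: "(\<integral>\<^sup>+t. ennreal (?p x t) * indicator {a..b} t \<partial>lborel) = ennreal (arctan ((b - x) / y) - arctan ((a - x) / y))" for x
  proof (rule nn_integral_FTC_Icc)
    fix t
    have "((\<lambda>t. arctan ((t - x) / y)) has_real_derivative (inverse (1 + ((t - x) / y)\<^sup>2) * (1 / y))) (at t)"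
      using y by (auto intro!: derivative_eq_intros)
    also have "inverse (1 + ((t - x) / y)\<^sup>2) * (1 / y) = ?p x t"
    proof -
      have "y * (1 + ((t - x) / y)\<^sup>2) = ((x - t)\<^sup>2 + y\<^sup>2) / y"
        using y by (simp add: power_divide power2_eq_square field_simps)
      hence "inverse (y * (1 + ((t - x) / y)\<^sup>2)) = y / ((x - t)\<^sup>2 + y\<^sup>2)" by (simp add: inverse_eq_divide)
      thus ?thesis by (simp add: divide_inverse mult.commute)
    qed
    finally show "((\<lambda>t. arctan ((t - x) / y)) has_real_derivative ?p x t) (at t)" .
  qed (use ab y pos in \<open>auto intro!: divide_nonneg_nonneg\<close>)
  have "(\<integral>\<^sup>+t. ennreal (Im (stieltjes \<rho> (Complex t y))) * indicator {a..b} t \<partial>lborel)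
     = (\<integral>\<^sup>+t. \<integral>\<^sup>+x. ennreal (?p x t) * indicator {a..b} t \<partial>\<rho> \<partial>lborel)"
    unfolding 1 by (intro nn_integral_cong nn_integral_multc[symmetric]) measurable
  also have "\<dots> = (\<integral>\<^sup>+x. \<integral>\<^sup>+t. ennreal (?p x t) * indicator {a..b} t \<partial>lborel \<partial>\<rho>)"
    by (rule Fubini'[of "\<lambda>x t. ennreal (?p x t) * indicator {a..b} t"]) measurable
  also have "\<dots> = (\<integral>\<^sup>+x. ennreal (arctan ((b - x) / y) - arctan ((a - x) / y)) \<partial>\<rho>)" unfolding 2 ..
  finally have e: "(\<integral>\<^sup>+t. ennreal (Im (stieltjes \<rho> (Complex t y))) * indicator {a..b} t \<partial>lborel) = \<dots>" .
  have mono: "arctan ((a - x) / y) \<le> arctan ((b - x) / y)" for x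
    using ab y by (auto intro!: divide_right_mono simp: arctan_le_iff)
  show "0 \<le> (\<integral>x. arctan ((b - x) / y) - arctan ((a - x) / y) \<partial>\<rho>)"
    using mono by (intro Bochner_Integration.integral_nonneg) auto
  have "norm (arctan u - arctan v) \<le> pi" for u v
    using arctan_bounded[of u] arctan_bounded[of v] by (auto simp: abs_if)
  hence "integrable \<rho> (\<lambda>x. arctan ((b - x) / y) - arctan ((a - x) / y))"
    by (intro integrable_const_bound[where B=pi]) auto
  thus "(\<integral>\<^sup>+t. ennreal (Im (stieltjes \<rho> (Complex t y))) * indicator {a..b} t \<partial>lborel) =
    ennreal (\<integral>x. arctan ((b - x) / y) - arctan ((a - x) / y) \<partial>\<rho>)"
    unfolding e using mono by (intro nn_integral_eq_integral) auto
  show "(\<lambda>t. ennreal (Im (stieltjes \<rho> (Complex t y))) * indicator {a..b} t) \<in> borel_measurable lborel"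
    unfolding 1 by measurable
qed

text \<open>Second step: the differences of arctangents tend to \<open>\<pi>\<close> inside the interval, to \<open>\<pi>/2\<close> at its end points
  and to 0 outside.\<close>

lemma stieltjes_interval_limit:
  assumes ab: "a < b"
  shows "(\<lambda>n. \<integral>x. arctan ((b - x) / inverse (real (Suc n))) - arctan ((a - x) / inverse (real (Suc n))) \<partial>\<rho>) \<longlonglongrightarrow>
     pi * measure \<rho> {a<..b} + pi / 2 * measure \<rho> {a} - pi / 2 * measure \<rho> {b}"
proof -
  let ?s = "\<lambda>u::real. sgn u * (pi / 2)"
  have lim: "(\<lambda>n. arctan (u / inverse (real (Suc n)))) \<longlonglongrightarrow> ?s u" for u
  proof -
    have at: "filterlim (\<lambda>n. real (Suc n)) at_top sequentially"
      using filterlim_compose[OF filterlim_real_sequentially filterlim_Suc] by simp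
    have e: "u / inverse (real (Suc n)) = u * real (Suc n)" for n by (simp add: divide_inverse)
    consider "u > 0" | "u = 0" | "u < 0" by linarith
    thus ?thesis
    proof cases
      case 1
      have "filterlim (\<lambda>n. u * real (Suc n)) at_top sequentially"
        by (rule filterlim_tendsto_pos_mult_at_top[OF tendsto_const 1 at])
      from filterlim_compose[OF tendsto_arctan_at_top this] show ?thesis using 1 unfolding e by simp
    next
      case 3
      have "filterlim (\<lambda>n. u * real (Suc n)) at_bot sequentially"
        by (rule filterlim_tendsto_neg_mult_at_bot[OF tendsto_const 3 at])
      from filterlim_compose[OF tendsto_arctan_at_bot this] show ?thesis using 3 unfolding e by simp
    qed simp
  qed
  have "(\<lambda>n. \<integral>x. arctan ((b - x) / inverse (real (Suc n))) - arctan ((a - x) / inverse (real (Suc n))) \<partial>\<rho>) \<longlonglongrightarrow> (\<integral>x. ?s (b - x) - ?s (a - x) \<partial>\<rho>)"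
  proof (rule integral_dominated_convergence[where w="\<lambda>_. pi"])
    have "norm (arctan u - arctan v) \<le> pi" for u v
      using arctan_bounded[of u] arctan_bounded[of v] by (auto simp: abs_if)
    thus "AE x in \<rho>. norm (arctan ((b - x) / inverse (real (Suc n))) - arctan ((a - x) / inverse (real (Suc n)))) \<le> pi" for n
      by auto
    show "AE x in \<rho>. (\<lambda>n. arctan ((b - x) / inverse (real (Suc n))) - arctan ((a - x) / inverse (real (Suc n)))) \<longlonglongrightarrow> ?s (b - x) - ?s (a - x)"
      by (intro AE_I2 tendsto_diff lim)
  qed auto
  moreover have "(\<integral>x. ?s (b - x) - ?s (a - x) \<partial>\<rho>) = pi * measure \<rho> {a<..b} + pi / 2 * measure \<rho> {a} - pi / 2 * measure \<rho> {b}"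
  proof -
    have "?s (b - x) - ?s (a - x) = pi * indicator {a<..b} x + pi / 2 * indicator {a} x - pi / 2 * indicator {b} x" for x
      using ab by (auto simp: indicator_def sgn_real_def)
    hence "(\<integral>x. ?s (b - x) - ?s (a - x) \<partial>\<rho>) = (\<integral>x. pi * indicator {a<..b} x + pi / 2 * indicator {a} x - pi / 2 * indicator {b} x \<partial>\<rho>)"
      by simp
    also have "\<dots> = pi * measure \<rho> {a<..b} + pi / 2 * measure \<rho> {a} - pi / 2 * measure \<rho> {b}"
      by (subst Bochner_Integration.integral_diff Bochner_Integration.integral_add | force intro!: Bochner_Integration.integrable_add simp: emeasure_eq_measure)+
    finally show ?thesis .
  qed
  ultimately show ?thesis by simp
qed

end

text \<open>Inversion expresses the masses of points and of intervals linearly through the transform, so additivity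
  of transforms passes to half-open intervals and from there to all Borel sets.\<close>

theorem measure_add_if_stieltjes_add:
  assumes "finite_real_measure \<kappa>" "finite_real_measure \<mu>" "finite_real_measure \<nu>"
    and eq: "\<And>z. 0 < Im z \<Longrightarrow> stieltjes \<kappa> z = stieltjes \<mu> z + stieltjes \<nu> z"
    and A: "A \<in> sets borel"
  shows "measure \<kappa> A = measure \<mu> A + measure \<nu> A"
proof -
  interpret \<kappa>: finite_real_measure \<kappa> by fact
  interpret \<mu>: finite_real_measure \<mu> by fact
  interpret \<nu>: finite_real_measure \<nu> by fact
  have atom: "measure \<kappa> {a} = measure \<mu> {a} + measure \<nu> {a}" for a
  proof (rule LIMSEQ_unique[OF \<kappa>.stieltjes_atom])
    show "(\<lambda>n. inverse (real (Suc n)) * Im (stieltjes \<kappa> (Complex a (inverse (real (Suc n)))))) \<longlonglongrightarrow> measure \<mu> {a} + measure \<nu> {a}"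
      using tendsto_add[OF \<mu>.stieltjes_atom[of a] \<nu>.stieltjes_atom[of a]] by (simp add: eq distrib_left del: of_nat_Suc)
  qed
  have ioc: "measure \<kappa> {a<..b} = measure \<mu> {a<..b} + measure \<nu> {a<..b}" if ab: "a < b" for a b
  proof -
    let ?K = "\<lambda>\<rho> y. \<integral>x. arctan ((b - x) / y) - arctan ((a - x) / y) \<partial>\<rho>"
    have add: "?K \<kappa> y = ?K \<mu> y + ?K \<nu> y" if y: "0 < y" for y
    proof -
      have "ennreal (?K \<kappa> y) = (\<integral>\<^sup>+t. ennreal (Im (stieltjes \<mu> (Complex t y))) * indicator {a..b} t
            + ennreal (Im (stieltjes \<nu> (Complex t y))) * indicator {a..b} t \<partial>lborel)"
        unfolding \<kappa>.stieltjes_interval(1)[OF ab y, symmetric] using y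
        by (intro nn_integral_cong) (simp add: eq \<mu>.Im_stieltjes_nonneg \<nu>.Im_stieltjes_nonneg ennreal_plus[symmetric] distrib_right[symmetric] del: ennreal_plus)
      also have "\<dots> = ennreal (?K \<mu> y) + ennreal (?K \<nu> y)"
        unfolding \<mu>.stieltjes_interval(1)[OF ab y, symmetric] \<nu>.stieltjes_interval(1)[OF ab y, symmetric]
        by (rule nn_integral_add[OF \<mu>.stieltjes_interval(3)[OF ab y] \<nu>.stieltjes_interval(3)[OF ab y]])
      finally show ?thesis using \<kappa>.stieltjes_interval(2)[OF ab y] \<mu>.stieltjes_interval(2)[OF ab y] \<nu>.stieltjes_interval(2)[OF ab y]
        by (simp add: ennreal_plus[symmetric] del: ennreal_plus)
    qed
    let ?L = "\<lambda>\<rho>. pi * measure \<rho> {a<..b} + pi / 2 * measure \<rho> {a} - pi / 2 * measure \<rho> {b}"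
    have "?L \<kappa> = ?L \<mu> + ?L \<nu>"
    proof (rule LIMSEQ_unique[OF \<kappa>.stieltjes_interval_limit[OF ab]])
      have y: "0 < inverse (real (Suc n))" for n by simp
      show "(\<lambda>n. ?K \<kappa> (inverse (real (Suc n)))) \<longlonglongrightarrow> ?L \<mu> + ?L \<nu>"
        unfolding add[OF y] by (rule tendsto_add[OF \<mu>.stieltjes_interval_limit[OF ab] \<nu>.stieltjes_interval_limit[OF ab]])
    qed
    hence "pi * measure \<kappa> {a<..b} = pi * (measure \<mu> {a<..b} + measure \<nu> {a<..b})" by (simp add: atom algebra_simps)
    thus ?thesis by simp
  qed
  define S where "S = measure_of UNIV (sets borel) (\<lambda>A. emeasure \<mu> A + emeasure \<nu> A)"
  have emS: "emeasure S A = emeasure \<mu> A + emeasure \<nu> A" if "A \<in> sets borel" for A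
    unfolding S_def
  proof (rule emeasure_measure_of_sigma[OF _ _ _ that])
    show "sigma_algebra UNIV (sets (borel :: real measure))" using sets.sigma_algebra_axioms[of "borel :: real measure"] by simp
    show "countably_additive (sets borel) (\<lambda>A. emeasure \<mu> A + emeasure \<nu> A)"
    proof (rule countably_additiveI)
      fix A :: "nat \<Rightarrow> real set" assume "range A \<subseteq> sets borel" "disjoint_family A"
      thus "(\<Sum>i. emeasure \<mu> (A i) + emeasure \<nu> (A i)) = emeasure \<mu> (\<Union>i. A i) + emeasure \<nu> (\<Union>i. A i)"
        by (simp add: suminf_add[symmetric] suminf_emeasure \<mu>.sets_eq \<nu>.sets_eq)
    qed
  qed (simp add: positive_def)
  have setsS: "sets S = sets borel" using sets.sigma_sets_eq[of "borel :: real measure"] by (simp add: S_def sets_measure_of)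
  have "\<kappa> = S"
  proof (rule measure_eqI_generator_eq[where \<Omega>=UNIV])
    fix X assume "X \<in> range (\<lambda>(a, b). {a<..b::real})"
    then obtain a b where Xeq: "X = {a<..b}" by auto
    then show "emeasure \<kappa> X = emeasure S X"
      using ioc[of a b] by (cases "a < b") (auto simp: emS \<kappa>.emeasure_eq_measure \<mu>.emeasure_eq_measure \<nu>.emeasure_eq_measure)
  next
    show "(\<Union>i. {- real (i::nat)<..real i}) = UNIV"
      by (rule UN_Ioc_eq_UNIV)
  qed (auto simp: \<kappa>.sets_eq setsS \<kappa>.emeasure_eq_measure borel_sigma_sets_Ioc Int_stable_def)
  hence "emeasure \<kappa> A = emeasure \<mu> A + emeasure \<nu> A" using emS[OF A] by simp
  thus ?thesis by (simp add: \<kappa>.emeasure_eq_measure \<mu>.emeasure_eq_measure \<nu>.emeasure_eq_measure ennreal_plus[symmetric] del: ennreal_plus)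
qed

text \<open>The additive statement with the null measure as one summand.\<close>

corollary stieltjes_unique:
  assumes "finite_real_measure \<mu>" "finite_real_measure \<nu>"
    and eq: "\<And>z. 0 < Im z \<Longrightarrow> stieltjes \<mu> z = stieltjes \<nu> z"
  shows "\<mu> = \<nu>"
proof -
  interpret \<mu>: finite_real_measure \<mu> by fact
  interpret \<nu>: finite_real_measure \<nu> by fact
  have n: "finite_real_measure (null_measure borel)"
    by (intro finite_real_measure.intro finite_real_measure_axioms.intro finite_measureI) auto
  interpret n: finite_real_measure "null_measure borel" by (rule n)
  have n0: "stieltjes (null_measure borel) z = 0" if "0 < Im z" for z
    using n.norm_stieltjes_le[OF that] by (simp add: measure_def)
  show ?thesis
  proof (rule measure_eqI)
    show "sets \<mu> = sets \<nu>" by (simp add: \<mu>.sets_eq \<nu>.sets_eq)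
    fix A assume "A \<in> sets \<mu>"
    hence A: "A \<in> sets borel" by (simp add: \<mu>.sets_eq)
    have "measure \<mu> A = measure \<nu> A + measure (null_measure borel) A"
      by (rule measure_add_if_stieltjes_add[OF assms(1,2) n _ A]) (simp add: eq n0)
    moreover have "measure (null_measure borel) A = 0" by (simp add: measure_def)
    ultimately show "emeasure \<mu> A = emeasure \<nu> A" by (simp add: \<mu>.emeasure_eq_measure \<nu>.emeasure_eq_measure)
  qed
qed

section \<open>The Herglotz representation\<close>

text \<open>Poisson's formula for the half-plane. The kernel \<open>1/((w - z)(w - cnj z))\<close> combines the Cauchy kernels
  at \<open>z\<close> and at the mirror point; it decays quadratically, so for bounded \<open>G\<close> the three upper sides
  of a square over \<open>[-r,r]\<close> contribute only \<open>O(1/r)\<close> to Cauchy's formula.\<close>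

lemma poisson_limit:
  fixes G :: "complex \<Rightarrow> complex"
  assumes e: "0 < e" and hol: "G holomorphic_on {w. - e < Im w}"
    and bd: "\<And>w. 0 \<le> Im w \<Longrightarrow> norm (G w) \<le> M" and z: "0 < Im z"
  shows "(\<lambda>n. integral {- real n..real n} (\<lambda>t. G (of_real t) / (of_real t - cnj z) / (of_real t - z)))
           \<longlonglongrightarrow> of_real pi * G z / of_real (Im z)"
proof -
  define d where "d = min e (Im z)"
  define S where "S = {w. - d < Im w}"
  define F where "F = (\<lambda>w. G w / (w - cnj z))"
  define h where "h = (\<lambda>w. F w / (w - z))"
  have d: "0 < d" "d \<le> e" "d \<le> Im z" using e z by (auto simp: d_def)
  have M: "0 \<le> M" using order_trans[OF norm_ge_zero bd[of 0]] by simp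
  have S: "convex S" "open S" unfolding S_def by (auto intro: convex_halfspace_Im_gt open_halfspace_Im_gt)
  have holF: "F holomorphic_on S" unfolding F_def
  proof (intro holomorphic_intros holomorphic_on_subset[OF hol])
    show "S \<subseteq> {w. - e < Im w}" using d by (auto simp: S_def)
    fix w assume "w \<in> S" hence "Im (w - cnj z) > 0" using d by (auto simp: S_def)
    thus "w - cnj z \<noteq> 0" by auto
  qed
  \<comment> \<open>Cauchy's formula yields \<open>2 \<pi> \<i> F z\<close>, which the extra factor of the kernel turns into this value.\<close>
  have Fz: "2 * of_real pi * \<i> * F z = of_real pi * G z / of_real (Im z)"
  proof -
    have zz: "z - cnj z = 2 * \<i> * of_real (Im z)" by (simp add: complex_eq_iff)
    show ?thesis unfolding F_def zz using z by simp
  qed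
  have main: "norm (integral {- real n..real n} (\<lambda>t. h (of_real t)) - of_real pi * G z / of_real (Im z)) \<le> 16 * M / real n"
    if n: "real n > 2 * norm z + 1" for n
  proof -
    define r where "r = real n"
    have r: "0 < r" "2 * norm z < r" using n norm_ge_zero[of z] unfolding r_def by linarith+
    define a1 a2 a3 a4 where "a1 = Complex (-r) 0" and "a2 = Complex r 0" and "a3 = Complex r r" and "a4 = Complex (-r) r"
    have zr: "norm z < r" using r norm_ge_zero[of z] by linarith
    have zbox: "z \<in> box a1 a3" using zr z abs_Re_le_cmod[of z] abs_Im_le_cmod[of z]
      by (auto simp: in_box_complex_iff a1_def a3_def)
    have rp: "rectpath a1 a3 = linepath a1 a2 +++ linepath a2 a3 +++ linepath a3 a4 +++ linepath a4 a1"
      by (simp add: rectpath_def Let_def a1_def a2_def a3_def a4_def)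
    have img: "path_image (rectpath a1 a3) = cbox a1 a3 - box a1 a3"
      using r by (intro path_image_rectpath_cbox_minus_box) (auto simp: a1_def a3_def)
    have sub: "path_image (rectpath a1 a3) \<subseteq> S - {z}" unfolding img using zbox d
      by (auto simp: in_cbox_complex_iff S_def a1_def a3_def)
    have zS: "z \<in> interior S" using interior_open[OF S(2)] z d by (simp add: S_def)
    have "(h has_contour_integral (2 * of_real pi * \<i> * winding_number (rectpath a1 a3) z * F z)) (rectpath a1 a3)"
      using Cauchy_integral_formula_convex_simple[OF S(1) holF zS valid_path_rectpath sub] by (simp add: h_def)
    hence ci: "(h has_contour_integral (of_real pi * G z / of_real (Im z))) (rectpath a1 a3)"
      unfolding winding_number_rectpath[OF zbox] mult_1_right Fz .
    have cint: "h contour_integrable_on (rectpath a1 a3)" using ci by (auto simp: contour_integrable_on_def)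
    hence pieces: "h contour_integrable_on linepath a1 a2" "h contour_integrable_on linepath a2 a3"
        "h contour_integrable_on linepath a3 a4" "h contour_integrable_on linepath a4 a1"
      unfolding rp by simp_all
    have sum: "contour_integral (linepath a1 a2) h - of_real pi * G z / of_real (Im z)
       = - (contour_integral (linepath a2 a3) h + contour_integral (linepath a3 a4) h + contour_integral (linepath a4 a1) h)"
      using contour_integral_unique[OF ci] pieces unfolding rp by (simp add: algebra_simps)
    have hb: "norm (h w) \<le> 4 * M / r\<^sup>2" if w: "w \<in> cbox a1 a3" "r \<le> norm w" for w
    proof -
      have Im: "0 \<le> Im w" using w by (auto simp: in_cbox_complex_iff a1_def)
      have "r / 2 \<le> norm (w - z)" "r / 2 \<le> norm (w - cnj z)"
        using norm_triangle_ineq2[of w z] norm_triangle_ineq2[of w "cnj z"] w(2) r by auto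
      hence "norm (h w) \<le> M / (r / 2) / (r / 2)" unfolding h_def F_def norm_divide
        using bd[OF Im] r M by (intro frac_le divide_nonneg_nonneg) auto
      thus ?thesis by (simp add: power2_eq_square field_simps)
    qed
    have seg: "w \<in> cbox a1 a3 \<and> r \<le> norm w"
      if "w \<in> closed_segment a2 a3 \<union> closed_segment a3 a4 \<union> closed_segment a4 a1" for w
    proof -
      have "w \<in> cbox a1 a3 \<and> (\<bar>Re w\<bar> = r \<or> \<bar>Im w\<bar> = r)" using that r
        by (auto simp: a1_def a2_def a3_def a4_def closed_segment_same_Re closed_segment_same_Im closed_segment_eq_real_ivl in_cbox_complex_iff split: if_splits)
      thus ?thesis using abs_Re_le_cmod[of w] abs_Im_le_cmod[of w] by auto
    qed
    have lens: "norm (a3 - a2) \<le> r" "norm (a4 - a3) \<le> 2 * r" "norm (a1 - a4) \<le> r"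
      using r cmod_le[of "a3 - a2"] cmod_le[of "a4 - a3"] cmod_le[of "a1 - a4"]
      by (simp_all add: a1_def a2_def a3_def a4_def)
    have nn: "0 \<le> 4 * M / r\<^sup>2" using M by simp
    have b: "norm (contour_integral (linepath a2 a3) h) \<le> 4 * M / r\<^sup>2 * r"
        "norm (contour_integral (linepath a3 a4) h) \<le> 4 * M / r\<^sup>2 * (2 * r)"
        "norm (contour_integral (linepath a4 a1) h) \<le> 4 * M / r\<^sup>2 * r"
      using contour_integral_bound_linepath[OF pieces(2) nn] contour_integral_bound_linepath[OF pieces(3) nn]
        contour_integral_bound_linepath[OF pieces(4) nn] hb seg lens nn
      by (smt (verit, best) UnCI mult_left_mono)+
    have "norm (contour_integral (linepath a1 a2) h - of_real pi * G z / of_real (Im z)) \<le> 4 * M / r\<^sup>2 * r + 4 * M / r\<^sup>2 * (2 * r) + 4 * M / r\<^sup>2 * r"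
      unfolding sum norm_minus_cancel using b by (intro norm_triangle_le add_mono) auto
    also have "\<dots> = 16 * M / r" using r by (simp add: power2_eq_square field_simps)
    also have "contour_integral (linepath a1 a2) h = integral {-r..r} (\<lambda>t. h (of_real t))"
      using r by (subst contour_integral_linepath_Reals_eq) (auto simp: a1_def a2_def complex_is_Real_iff)
    finally show ?thesis by (simp add: r_def)
  qed
  have "(\<lambda>n. integral {- real n..real n} (\<lambda>t. h (of_real t)) - of_real pi * G z / of_real (Im z)) \<longlonglongrightarrow> 0"
  proof (rule Lim_null_comparison)
    show "eventually (\<lambda>n. norm (integral {- real n..real n} (\<lambda>t. h (of_real t)) - of_real pi * G z / of_real (Im z)) \<le> 16 * M / real n) sequentially"
      using eventually_compose_filterlim[OF eventually_gt_at_top filterlim_real_sequentially, of "2 * norm z + 1"]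
      by eventually_elim (rule main)
    show "(\<lambda>n. 16 * M / real n) \<longlonglongrightarrow> 0" by (rule lim_const_over_n)
  qed
  thus ?thesis unfolding h_def F_def using Lim_null by blast
qed

text \<open>For \<open>g\<close> moved down by \<open>\<i> e\<close> the boundary values are smooth and bounded, and the measure has density
  \<open>Im g(t + \<i> e) / \<pi>\<close>. Poisson's formula shows that \<open>g(z + \<i> e)\<close> and the Stieltjes transform have the same
  imaginary part; their difference is constant, and it vanishes at infinity.\<close>

lemma shifted_representation:
  assumes hol: "g holomorphic_on upper_half_plane"
    and pos: "\<And>z. 0 < Im z \<Longrightarrow> 0 \<le> Im (g z)"
    and bd: "\<And>z. 0 < Im z \<Longrightarrow> norm (g z) \<le> C / Im z"
    and e: "0 < e"
  obtains \<rho> where "finite_real_measure \<rho>" "measure \<rho> UNIV \<le> C" "\<And>z. 0 < Im z \<Longrightarrow> g (z + \<i> * of_real e) = stieltjes \<rho> z"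
proof -
  define G where "G = (\<lambda>w. g (w + \<i> * of_real e))"
  have holG: "G holomorphic_on {w. - e < Im w}" unfolding G_def
    by (rule holomorphic_on_compose_gen[where f="\<lambda>w. w + \<i> * of_real e", unfolded o_def, OF _ hol]) (auto intro!: holomorphic_intros)
  have C: "0 \<le> C" using order_trans[OF norm_ge_zero bd[of \<i>]] by simp
  have bdG: "norm (G w) \<le> C / e" if "0 \<le> Im w" for w
  proof -
    have "norm (G w) \<le> C / (Im w + e)" unfolding G_def using bd[of "w + \<i> * of_real e"] that e by simp
    also have "\<dots> \<le> C / e" using C e that by (intro divide_left_mono) auto
    finally show ?thesis .
  qed
  have posG: "0 \<le> Im (G w)" if "- e < Im w" for w unfolding G_def using that by (intro pos) simp
  define h where "h = (\<lambda>t::real. Im (G (of_real t)))"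
  have h0: "0 \<le> h t" for t unfolding h_def using e by (intro posG) simp
  have hcont: "continuous_on UNIV h" unfolding h_def
    by (intro continuous_intros continuous_on_compose2[OF holomorphic_on_imp_continuous_on[OF holG]]) (use e in auto)
  have hmeas [measurable]: "h \<in> borel_measurable borel" by (rule borel_measurable_continuous_onI[OF hcont])
  define \<rho> where "\<rho> = density lborel (\<lambda>t. ennreal (h t / pi))"
  have sets: "sets \<rho> = sets borel" by (simp add: \<rho>_def)
  have P: "(\<integral>\<^sup>+t. ennreal (Im z / ((t - Re z)\<^sup>2 + (Im z)\<^sup>2)) \<partial>\<rho>) = ennreal (Im (G z))" if z: "0 < Im z" for z
  proof -
    let ?q = "\<lambda>t. (t - Re z)\<^sup>2 + (Im z)\<^sup>2"
    have q: "0 < ?q t" for t using z by (intro add_nonneg_pos) auto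
    let ?k = "\<lambda>t. G (of_real t) / (of_real t - cnj z) / (of_real t - z)"
    have k: "?k t = G (of_real t) / of_real (?q t)" for t
    proof -
      have "(of_real t - cnj z) * (of_real t - z) = of_real (?q t)"
        by (simp add: complex_eq_iff power2_eq_square algebra_simps)
      thus ?thesis by (simp add: divide_divide_eq_left)
    qed
    have Imk: "Im (?k t) = h t / ?q t" for t unfolding k Im_divide_of_real h_def ..
    have qne: "complex_of_real (?q t) \<noteq> 0" for t using q[of t] by (simp only: of_real_eq_0_iff)
    have cont: "continuous_on A ?k" for A unfolding k
    proof (rule continuous_on_divide)
      show "continuous_on A (\<lambda>t. G (of_real t))"
        by (rule continuous_on_compose2[OF holomorphic_on_imp_continuous_on[OF holG]])
          (use e in \<open>auto intro!: continuous_intros\<close>)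
      show "continuous_on A (\<lambda>t. complex_of_real (?q t))" by (intro continuous_intros)
    qed (use qne in blast)
    have kint: "?k integrable_on {a..b}" for a b by (intro integrable_continuous_real cont)
    have hi: "((\<lambda>t. h t / ?q t) has_integral Im (integral {a..b} ?k)) {a..b}" for a b
      using has_integral_Im[OF integrable_integral[OF kint]] unfolding Imk .
    have nn: "(\<integral>\<^sup>+t. ennreal (indicator {- real n..real n} t * (h t / ?q t)) \<partial>lborel) = ennreal (Im (integral {- real n..real n} ?k))" for n
      by (rule nn_integral_has_integral_lebesgue[OF _ hi]) (use h0 q less_imp_le[OF q] in auto)
    have "(\<lambda>n. \<integral>\<^sup>+t. ennreal (indicator {- real n..real n} t * (h t / ?q t)) \<partial>lborel) \<longlonglongrightarrow> (\<integral>\<^sup>+t. ennreal (h t / ?q t) \<partial>lborel)"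
    proof (rule nn_integral_LIMSEQ)
      show "incseq (\<lambda>n t. ennreal (indicator {- real n..real n} t * (h t / ?q t)))"
        unfolding incseq_def le_fun_def using h0 q by (auto intro!: ennreal_leI mult_right_mono divide_nonneg_pos split: split_indicator)
      fix t
      obtain N where N: "\<bar>t\<bar> < real N" using reals_Archimedean2 by blast
      have "eventually (\<lambda>n. ennreal (h t / ?q t) = ennreal (indicator {- real n..real n} t * (h t / ?q t))) sequentially"
        using eventually_ge_at_top[of N]
      proof eventually_elim
        case (elim n)
        have "t \<in> {- real n..real n}" using N elim by auto
        thus ?case by simp
      qed
      from Lim_transform_eventually[OF tendsto_const this]
      show "(\<lambda>n. ennreal (indicator {- real n..real n} t * (h t / ?q t))) \<longlonglongrightarrow> ennreal (h t / ?q t)" .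
    qed measurable
    moreover have "(\<lambda>n. ennreal (Im (integral {- real n..real n} ?k))) \<longlonglongrightarrow> ennreal (Im (of_real pi * G z / of_real (Im z)))"
      by (intro tendsto_ennrealI tendsto_Im poisson_limit[OF e holG bdG z])
    ultimately have v: "(\<integral>\<^sup>+t. ennreal (h t / ?q t) \<partial>lborel) = ennreal (pi * Im (G z) / Im z)"
      unfolding nn using LIMSEQ_unique by fastforce
    have "(\<integral>\<^sup>+t. ennreal (Im z / ?q t) \<partial>\<rho>) = (\<integral>\<^sup>+t. ennreal (h t / pi) * ennreal (Im z / ?q t) \<partial>lborel)"
      unfolding \<rho>_def by (rule nn_integral_density) measurable
    also have "\<dots> = (\<integral>\<^sup>+t. ennreal (Im z / pi) * ennreal (h t / ?q t) \<partial>lborel)"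
      using h0 q z less_imp_le[OF q] by (intro nn_integral_cong) (auto simp: ennreal_mult'[symmetric] field_simps)
    also have "\<dots> = ennreal (Im z / pi) * ennreal (pi * Im (G z) / Im z)" unfolding v[symmetric]
      by (rule nn_integral_cmult) measurable
    also have "\<dots> = ennreal (Im (G z))" using z posG[of z] e by (subst ennreal_mult'[symmetric]) auto
    finally show ?thesis .
  qed
  \<comment> \<open>The mass is the limit of \<open>y Im g(iy + \<i> e)\<close>, by monotone convergence of \<open>y\<^sup>2/(t\<^sup>2 + y\<^sup>2)\<close> to 1.\<close>
  have mass: "emeasure \<rho> UNIV \<le> ennreal C"
  proof -
    let ?w = "\<lambda>n t::real. real n * (real n / (t\<^sup>2 + (real n)\<^sup>2))"
    have "(\<lambda>n. \<integral>\<^sup>+t. ennreal (?w n t) \<partial>\<rho>) \<longlonglongrightarrow> (\<integral>\<^sup>+t. 1 \<partial>\<rho>)"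
    proof (rule nn_integral_LIMSEQ)
      show "incseq (\<lambda>n t. ennreal (?w n t))" unfolding incseq_def le_fun_def
      proof (intro allI impI ennreal_leI)
        fix m n :: nat and t :: real assume mn: "m \<le> n"
        show "?w m t \<le> ?w n t"
        proof (cases "m = 0")
          case False
          hence m0: "0 < real m" "0 < real n" using mn by auto
          have pos: "0 < t\<^sup>2 + (real m)\<^sup>2" "0 < t\<^sup>2 + (real n)\<^sup>2" using m0 by (auto intro!: add_nonneg_pos)
          have "(real m)\<^sup>2 * t\<^sup>2 \<le> (real n)\<^sup>2 * t\<^sup>2" using mn by (intro mult_right_mono power_mono) auto
          thus ?thesis using pos by (simp add: divide_simps power2_eq_square algebra_simps)
        qed simp
      qed
      fix t :: real
      have "(\<lambda>n. 1 / ((t / real n)\<^sup>2 + 1)) \<longlonglongrightarrow> 1 / (0\<^sup>2 + 1)" by (intro tendsto_intros lim_const_over_n) auto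
      moreover have "eventually (\<lambda>n. 1 / ((t / real n)\<^sup>2 + 1) = ?w n t) sequentially"
        using eventually_gt_at_top[of 0]
      proof eventually_elim
        case (elim n)
        have "t\<^sup>2 + (real n)\<^sup>2 = (real n)\<^sup>2 * ((t / real n)\<^sup>2 + 1)" using elim by (simp add: field_simps)
        thus ?case using elim by (simp add: power2_eq_square)
      qed
      ultimately have "(\<lambda>n. ?w n t) \<longlonglongrightarrow> 1 / (0\<^sup>2 + 1)" by (rule Lim_transform_eventually)
      thus "(\<lambda>n. ennreal (?w n t)) \<longlonglongrightarrow> 1" using tendsto_ennrealI by fastforce
    qed (auto simp: \<rho>_def)
    hence l: "(\<lambda>n. \<integral>\<^sup>+t. ennreal (?w n t) \<partial>\<rho>) \<longlonglongrightarrow> emeasure \<rho> UNIV" by (simp add: \<rho>_def)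
    have "(\<integral>\<^sup>+t. ennreal (?w n t) \<partial>\<rho>) \<le> ennreal C" if n: "0 < n" for n
    proof -
      let ?z = "\<i> * complex_of_real (real n)"
      have "(\<integral>\<^sup>+t. ennreal (?w n t) \<partial>\<rho>) = (\<integral>\<^sup>+t. ennreal (real n) * ennreal (Im ?z / ((t - Re ?z)\<^sup>2 + (Im ?z)\<^sup>2)) \<partial>\<rho>)"
        by (intro nn_integral_cong) (auto simp: ennreal_mult'[symmetric])
      also have "\<dots> = ennreal (real n) * ennreal (Im (G ?z))"
        by (subst nn_integral_cmult) (use n P[of ?z] in \<open>auto simp: \<rho>_def\<close>)
      also have "\<dots> = ennreal (real n * Im (G ?z))" by (simp add: ennreal_mult'[symmetric])
      also have "real n * Im (G ?z) \<le> C"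
      proof -
        have "Im (G ?z) \<le> C / (real n + e)" using abs_Im_le_cmod[of "G ?z"] bd[of "?z + \<i> * of_real e"] n e by (auto simp: G_def)
        also have "\<dots> \<le> C / real n" using n e C by (intro divide_left_mono) auto
        finally show ?thesis using n by (simp add: field_simps)
      qed
      finally show ?thesis by (simp add: ennreal_leI)
    qed
    hence "eventually (\<lambda>n. (\<integral>\<^sup>+t. ennreal (?w n t) \<partial>\<rho>) \<le> ennreal C) sequentially"
      using eventually_gt_at_top[of 0] by (rule eventually_mono[rotated])
    thus ?thesis by (rule tendsto_upperbound[OF l]) simp
  qed
  have fin: "finite_real_measure \<rho>"
  proof (intro finite_real_measure.intro finite_real_measure_axioms.intro finite_measureI sets)
    have "space \<rho> = UNIV" by (simp add: \<rho>_def)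
    thus "emeasure \<rho> (space \<rho>) \<noteq> \<infinity>" using mass by (auto simp: top_unique)
  qed
  interpret finite_real_measure \<rho> by fact
  have meas: "measure \<rho> UNIV \<le> C" using mass C by (simp add: emeasure_eq_measure)
  have Im: "Im (stieltjes \<rho> z) = Im (G z)" if z: "0 < Im z" for z
  proof -
    have "Im (stieltjes \<rho> z) = enn2real (\<integral>\<^sup>+t. ennreal (Im z / ((t - Re z)\<^sup>2 + (Im z)\<^sup>2)) \<partial>\<rho>)"
      unfolding Im_stieltjes[OF z] using z by (intro integral_eq_nn_integral) auto
    thus ?thesis unfolding P[OF z] using posG[of z] z e by simp
  qed
  define D where "D = (\<lambda>z. G z - stieltjes \<rho> z)"
  have holD: "D holomorphic_on upper_half_plane" unfolding D_def
    by (intro holomorphic_intros holomorphic_stieltjes holomorphic_on_subset[OF holG]) (use e in auto)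
  \<comment> \<open>Schwarz-Pick with vanishing imaginary part.\<close>
  have const: "D z = D w" if "0 < Im z" "0 < Im w" for z w
    using schwarz_pick[OF holD _ that] that by (auto simp: D_def Im mult_le_0_iff)
  have D0: "D z = 0" if z: "0 < Im z" for z
  proof -
    have "norm (D z) \<le> 2 * C / y" if y: "0 < y" for y
    proof -
      have "norm (D z) = norm (D (\<i> * of_real y))" using const[of z "\<i> * of_real y"] z y by simp
      also have "\<dots> \<le> norm (G (\<i> * of_real y)) + norm (stieltjes \<rho> (\<i> * of_real y))" unfolding D_def by (rule norm_triangle_ineq4)
      also have "norm (G (\<i> * of_real y)) \<le> C / (y + e)" using bd[of "\<i> * of_real y + \<i> * of_real e"] y e by (simp add: G_def)
      also have "C / (y + e) \<le> C / y" using y e C by (intro divide_left_mono) auto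
      also have "norm (stieltjes \<rho> (\<i> * of_real y)) \<le> measure \<rho> UNIV / y" using norm_stieltjes_le[of "\<i> * of_real y"] y by simp
      also have "measure \<rho> UNIV / y \<le> C / y" using meas y by (intro divide_right_mono) auto
      finally show ?thesis by simp
    qed
    hence "eventually (\<lambda>y. norm (D z) \<le> 2 * C / y) at_top" using eventually_gt_at_top[of 0] by (rule eventually_mono[rotated])
    moreover have "((\<lambda>y::real. 2 * C / y) \<longlongrightarrow> 0) at_top" by (intro tendsto_divide_0[OF tendsto_const] filterlim_at_top_imp_at_infinity filterlim_ident)
    ultimately have "norm (D z) \<le> 0" by (intro tendsto_lowerbound) auto
    thus ?thesis by simp
  qed
  show ?thesis by (rule that[OF fin meas]) (use D0 in \<open>simp add: D_def G_def\<close>)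
qed

lemma stieltjes_density_const:
  assumes "sets \<rho> = sets borel" "0 \<le> c"
  shows "stieltjes (density \<rho> (\<lambda>_. ennreal c)) z = of_real c * stieltjes \<rho> z"
proof -
  have [measurable_cong]: "sets \<rho> = sets borel" by fact
  have "stieltjes (density \<rho> (\<lambda>_. ennreal c)) z = (\<integral>x. c *\<^sub>R (1 / (of_real x - z)) \<partial>\<rho>)"
    unfolding stieltjes_def by (rule integral_density) (use assms(2) in auto)
  also have "\<dots> = of_real c * stieltjes \<rho> z"
    unfolding stieltjes_def scaleR_conv_of_real by (rule integral_mult_right_zero)
  finally show ?thesis .
qed

text \<open>Weak limit of the representing measures of \<open>g(z + \<i> \<epsilon>)\<close> as \<open>\<epsilon> \<rightarrow> 0\<close>. All of them have the same mass
  \<open>m\<close>, since the mass is read off from \<open>y g(iy)\<close> as \<open>y \<rightarrow> \<infinity>\<close>, where the shift is invisible. For the same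
  reason no mass escapes, which gives tightness, and Helly's selection theorem applies to the measures divided by \<open>m\<close>.\<close>

theorem herglotz_representation:
  assumes hol: "g holomorphic_on upper_half_plane"
    and pos: "\<And>z. 0 < Im z \<Longrightarrow> 0 \<le> Im (g z)"
    and bd: "\<And>z. 0 < Im z \<Longrightarrow> norm (g z) \<le> C / Im z"
  obtains \<rho> where "finite_real_measure \<rho>" "measure \<rho> UNIV \<le> C" "\<And>z. 0 < Im z \<Longrightarrow> g z = stieltjes \<rho> z"
proof -
  define \<epsilon> where "\<epsilon> = (\<lambda>n. inverse (real (Suc n)))"
  have \<epsilon>: "0 < \<epsilon> n" "\<epsilon> n \<le> 1" for n by (auto simp: \<epsilon>_def divide_simps)
  have \<epsilon>0: "\<epsilon> \<longlonglongrightarrow> 0" unfolding \<epsilon>_def by (rule LIMSEQ_inverse_real_of_nat)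
  have "\<exists>\<rho>. finite_real_measure \<rho> \<and> measure \<rho> UNIV \<le> C \<and> (\<forall>z. 0 < Im z \<longrightarrow> g (z + \<i> * of_real (\<epsilon> n)) = stieltjes \<rho> z)" for n
    using shifted_representation[OF hol pos bd \<epsilon>(1)] by metis
  then obtain \<rho> where fin: "\<And>n. finite_real_measure (\<rho> n)" and mC: "\<And>n. measure (\<rho> n) UNIV \<le> C"
    and rep: "\<And>n z. 0 < Im z \<Longrightarrow> g (z + \<i> * of_real (\<epsilon> n)) = stieltjes (\<rho> n) z" by metis
  have lim: "((\<lambda>y. of_real y * g (\<i> * of_real y)) \<longlongrightarrow> \<i> * of_real (measure (\<rho> n) UNIV)) at_top" for n
  proof -
    interpret finite_real_measure "\<rho> n" by (rule fin)
    have "filterlim (\<lambda>y. - \<epsilon> n + y) at_top at_top"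
      by (rule filterlim_tendsto_add_at_top[OF tendsto_const filterlim_ident])
    hence sh: "filterlim (\<lambda>y. y - \<epsilon> n) at_top at_top" by simp
    have "((\<lambda>y. of_real (y - \<epsilon> n) * stieltjes (\<rho> n) (\<i> * of_real (y - \<epsilon> n)) * of_real (1 + \<epsilon> n / (y - \<epsilon> n))) \<longlongrightarrow> \<i> * of_real (measure (\<rho> n) UNIV) * of_real (1 + 0)) at_top"
      by (intro tendsto_intros filterlim_compose[OF stieltjes_asymptotics sh] tendsto_divide_0[OF tendsto_const] filterlim_at_top_imp_at_infinity sh)
    moreover have "eventually (\<lambda>y. of_real (y - \<epsilon> n) * stieltjes (\<rho> n) (\<i> * of_real (y - \<epsilon> n)) * of_real (1 + \<epsilon> n / (y - \<epsilon> n)) = of_real y * g (\<i> * of_real y)) at_top"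
      using eventually_gt_at_top[of "\<epsilon> n"]
    proof eventually_elim
      case (elim y)
      have "stieltjes (\<rho> n) (\<i> * of_real (y - \<epsilon> n)) = g (\<i> * of_real y)"
        using rep[of "\<i> * of_real (y - \<epsilon> n)" n] elim by (simp add: algebra_simps)
      moreover have "complex_of_real (y - \<epsilon> n) * of_real (1 + \<epsilon> n / (y - \<epsilon> n)) = of_real y"
        unfolding of_real_mult[symmetric] using elim by (simp add: field_simps)
      ultimately show ?case by (metis mult.commute mult.assoc)
    qed
    ultimately have "((\<lambda>y. of_real y * g (\<i> * of_real y)) \<longlongrightarrow> \<i> * of_real (measure (\<rho> n) UNIV) * of_real (1 + 0)) at_top"
      by (rule Lim_transform_eventually)
    thus ?thesis by simp
  qed
  define m where "m = measure (\<rho> 0) UNIV"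
  have m: "measure (\<rho> n) UNIV = m" for n
    using tendsto_unique[OF trivial_limit_at_top_linorder lim[of n] lim[of 0]] by (simp add: m_def)
  have glim: "(\<lambda>n. g (z + \<i> * of_real (\<epsilon> (r n)))) \<longlonglongrightarrow> g z" if z: "0 < Im z" and r: "strict_mono r" for z r
  proof -
    have "isCont g z" using holomorphic_on_imp_continuous_on[OF hol] open_uhp z by (simp add: continuous_on_eq_continuous_at)
    moreover have "(\<lambda>n. z + \<i> * of_real (\<epsilon> (r n))) \<longlonglongrightarrow> z + \<i> * of_real 0"
      using LIMSEQ_subseq_LIMSEQ[OF \<epsilon>0 r] by (intro tendsto_intros) (simp add: o_def)
    ultimately show ?thesis using isCont_tendsto_compose[of z g] by simp
  qed
  show ?thesis
  proof (cases "m = 0")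
    case True
    have "g z = stieltjes (\<rho> 0) z" if z: "0 < Im z" for z
    proof -
      have s0: "stieltjes (\<rho> n) z = 0" for n
        using finite_real_measure.norm_stieltjes_le[OF fin z, of n] by (simp add: m True)
      have "(\<lambda>n. g (z + \<i> * of_real (\<epsilon> n))) \<longlonglongrightarrow> g z" using glim[OF z strict_mono_id] by simp
      hence "g z = 0" unfolding rep[OF z] s0 using LIMSEQ_unique tendsto_const by blast
      thus ?thesis by (simp add: s0)
    qed
    thus ?thesis using that[OF fin mC] by blast
  next
    case False
    hence m0: "0 < m" by (simp add: m_def less_le)
    define N where "N = (\<lambda>n. density (\<rho> n) (\<lambda>_. ennreal (1 / m)))"
    have setsN: "sets (N n) = sets borel" for n using finite_real_measure.sets_eq[OF fin] by (simp add: N_def)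
    have emN: "measure (N n) A = measure (\<rho> n) A / m" if A: "A \<in> sets borel" for n A
    proof -
      interpret finite_real_measure "\<rho> n" by (rule fin)
      have "emeasure (N n) A = ennreal (1 / m) * emeasure (\<rho> n) A" unfolding N_def
        using A sets_eq by (subst emeasure_density_const) auto
      also have "\<dots> = ennreal (measure (\<rho> n) A / m)" unfolding emeasure_eq_measure using m0 by (simp add: ennreal_mult'[symmetric])
      finally show ?thesis using m0 by (simp add: measure_def)
    qed
    have rd: "real_distribution (N n)" for n
    proof -
      interpret finite_real_measure "\<rho> n" by (rule fin)
      have "emeasure (N n) (space (N n)) = ennreal (1 / m) * emeasure (\<rho> n) UNIV" unfolding N_def
        using sets_eq by (subst emeasure_density_const) (auto simp: sets_eq)
      also have "\<dots> = 1" unfolding emeasure_eq_measure m using m0 by (simp add: ennreal_mult'[symmetric])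
      finally have "prob_space (N n)" by (rule prob_spaceI)
      thus ?thesis unfolding real_distribution_def real_distribution_axioms_def using setsN by simp
    qed
    \<comment> \<open>The mass outside \<open>[-y,y]\<close> is at most twice \<open>m - \<integral> y\<^sup>2/(t\<^sup>2 + y\<^sup>2) \<rho>\<^sub>n(dt)\<close>, which is small for
      large \<open>y\<close>, uniformly in \<open>n\<close>.\<close>
    have tight: "tight N" unfolding tight_def
    proof (intro conjI allI impI rd)
      fix e :: real assume e: "0 < e"
      define \<delta> where "\<delta> = min (e * m / 8) m"
      have \<delta>: "0 < \<delta>" "\<delta> \<le> m" "4 * \<delta> / m < e" using e m0 by (auto simp: \<delta>_def field_simps min_def)
      have "((\<lambda>y. Im (of_real y * g (\<i> * of_real y))) \<longlongrightarrow> Im (\<i> * of_real m)) at_top"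
        using lim[of 0] unfolding m by (rule tendsto_Im)
      hence "eventually (\<lambda>y. m - \<delta> < y * Im (g (\<i> * of_real y))) at_top"
        using \<delta> by (intro order_tendstoD) auto
      then obtain Y where Y: "\<And>y. Y \<le> y \<Longrightarrow> m - \<delta> < y * Im (g (\<i> * of_real y))" by (auto simp: eventually_at_top_linorder)
      define y where "y = max 1 (max Y (m / \<delta>))"
      have y: "1 \<le> y" "Y \<le> y" "m / \<delta> \<le> y" by (auto simp: y_def)
      have "1 - e < measure (N n) {- y<..y}" for n
      proof -
        interpret finite_real_measure "\<rho> n" by (rule fin)
        let ?z = "\<i> * complex_of_real y"
        have i1: "integrable (\<rho> n) (\<lambda>t. y / (t\<^sup>2 + y\<^sup>2))"
          using integrable_Im[OF integrable_resolvent[of ?z]] y unfolding Im_resolvent by simp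
        have "m - \<delta> < (y + \<epsilon> n) * Im (g (\<i> * of_real (y + \<epsilon> n)))" using y \<epsilon>(1)[of n] by (intro Y) auto
        also have "g (\<i> * of_real (y + \<epsilon> n)) = stieltjes (\<rho> n) ?z"
          using rep[of ?z n] y by (simp add: algebra_simps)
        also have "Im \<dots> = (\<integral>t. y / (t\<^sup>2 + y\<^sup>2) \<partial>\<rho> n)" using Im_stieltjes[of ?z] y by simp
        finally have a: "m - \<delta> < (y + \<epsilon> n) * (\<integral>t. y / (t\<^sup>2 + y\<^sup>2) \<partial>\<rho> n)" .
        let ?J = "\<integral>t. y / (t\<^sup>2 + y\<^sup>2) \<partial>\<rho> n"
        have J0: "0 \<le> ?J" using y by (intro Bochner_Integration.integral_nonneg) auto
        have "(y + \<epsilon> n) * ?J \<le> (y + 1) * ?J" using J0 \<epsilon>(2)[of n] by (intro mult_right_mono) auto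
        hence "m - \<delta> < (y + 1) * ?J" using a by linarith
        moreover have "?J \<le> m / y"
        proof -
          have "?J \<le> (\<integral>t. 1 / y \<partial>\<rho> n)"
          proof (rule integral_mono[OF i1])
            fix t :: real
            have "0 < t\<^sup>2 + y\<^sup>2" using y by (intro add_nonneg_pos) auto
            thus "y / (t\<^sup>2 + y\<^sup>2) \<le> 1 / y" using y by (simp add: divide_simps power2_eq_square)
          qed simp
          thus ?thesis by (simp add: m)
        qed
        moreover have "m / y \<le> \<delta>" using y \<delta> by (simp add: field_simps)
        ultimately have b: "m - 2 * \<delta> < y * ?J" by (simp add: algebra_simps)
        have "y * ?J = (\<integral>t. y * (y / (t\<^sup>2 + y\<^sup>2)) \<partial>\<rho> n)" by (rule integral_mult_right_zero[symmetric])
        also have "\<dots> \<le> (\<integral>t. 1 / 2 + 1 / 2 * indicator {- y<..y} t \<partial>\<rho> n)"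
        proof (rule integral_mono)
          show "integrable (\<rho> n) (\<lambda>t. y * (y / (t\<^sup>2 + y\<^sup>2)))" by (rule integrable_mult_right[OF i1])
          show "integrable (\<rho> n) (\<lambda>t. 1 / 2 + 1 / 2 * indicat_real {- y<..y} t)"
            by (intro Bochner_Integration.integrable_add integrable_mult_right) (auto simp: emeasure_eq_measure)
          fix t
          have p: "0 < t\<^sup>2 + y\<^sup>2" using y by (intro add_nonneg_pos) auto
          show "y * (y / (t\<^sup>2 + y\<^sup>2)) \<le> 1 / 2 + 1 / 2 * indicat_real {- y<..y} t"
          proof (cases "t \<in> {- y<..y}")
            case True thus ?thesis using p by (simp add: divide_simps power2_eq_square)
          next
            case False
            hence "\<bar>y\<bar> \<le> \<bar>t\<bar>" using y by auto
            hence "y\<^sup>2 \<le> t\<^sup>2" by (simp add: abs_le_square_iff)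
            thus ?thesis using False p by (simp add: divide_simps power2_eq_square)
          qed
        qed
        also have "\<dots> = m / 2 + measure (\<rho> n) {- y<..y} / 2"
          by (subst Bochner_Integration.integral_add) (auto simp: m emeasure_eq_measure)
        finally have "m - 4 * \<delta> < measure (\<rho> n) {- y<..y}" using b by simp
        hence "(m - 4 * \<delta>) / m < measure (\<rho> n) {- y<..y} / m" using m0 by (intro divide_strict_right_mono)
        thus ?thesis using \<delta>(3) m0 by (simp add: emN diff_divide_distrib)
      qed
      thus "\<exists>a b. a < b \<and> (\<forall>n. 1 - e < measure (N n) {a<..b})" using y by (intro exI[of _ "- y"] exI[of _ y]) auto
    qed
    obtain r M where r: "strict_mono r" and M: "real_distribution M" and wc: "weak_conv_m (N \<circ> id \<circ> r) M"
      using tight_imp_convergent_subsubsequence[OF tight strict_mono_id] by blast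
    interpret M: real_distribution M by fact
    have gM: "g z = of_real m * stieltjes M z" if z: "0 < Im z" for z
    proof -
      have "(\<lambda>n. integral\<^sup>L ((N \<circ> id \<circ> r) n) (\<lambda>x. 1 / (of_real x - z))) \<longlonglongrightarrow> integral\<^sup>L M (\<lambda>x. 1 / (of_real x - z))"
      proof (rule weak_conv_imp_integral_bdd_continuous_conv[OF _ M wc])
        show "real_distribution ((N \<circ> id \<circ> r) n)" for n using rd by simp
        show "isCont (\<lambda>x. 1 / (complex_of_real x - z)) x" for x
          using of_real_minus_ne[OF z, of x] by (intro continuous_intros) auto
        show "norm (1 / (complex_of_real x - z)) \<le> 1 / Im z" for x by (rule norm_resolvent_le) (use z in auto)
      qed
      moreover have "integral\<^sup>L ((N \<circ> id \<circ> r) n) (\<lambda>x. 1 / (of_real x - z)) = of_real (1 / m) * g (z + \<i> * of_real (\<epsilon> (r n)))" for n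
        using stieltjes_density_const[OF finite_real_measure.sets_eq[OF fin], of "1 / m" "r n" z] m0
        unfolding rep[OF z] by (simp add: N_def stieltjes_def)
      ultimately have "(\<lambda>n. of_real (1 / m) * g (z + \<i> * of_real (\<epsilon> (r n)))) \<longlonglongrightarrow> stieltjes M z" by (simp add: stieltjes_def)
      moreover have "(\<lambda>n. of_real (1 / m) * g (z + \<i> * of_real (\<epsilon> (r n)))) \<longlonglongrightarrow> of_real (1 / m) * g z"
        by (intro tendsto_intros glim[OF z r])
      ultimately have "stieltjes M z = of_real (1 / m) * g z" by (rule LIMSEQ_unique)
      thus ?thesis using m0 by simp
    qed
    define R where "R = density M (\<lambda>_. ennreal m)"
    have em: "emeasure R UNIV = ennreal m" unfolding R_def using M.emeasure_space_1
      by (subst emeasure_density_const) auto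
    have "finite_real_measure R"
      by (intro finite_real_measure.intro finite_real_measure_axioms.intro finite_measureI) (use em in \<open>auto simp: R_def\<close>)
    moreover have "measure R UNIV \<le> C" using em m0 mC[of 0] by (simp add: measure_def m_def)
    moreover have "g z = stieltjes R z" if "0 < Im z" for z
      unfolding R_def using gM[OF that] m0 by (subst stieltjes_density_const) auto
    ultimately show ?thesis by (rule that)
  qed
qed

section \<open>A clock and the sewing lemma\<close>

text \<open>Telescoping over a fine partition: the increments of \<open>D\<close> sum to at most \<open>e (K T - K s)\<close> for every \<open>e\<close>.
  Typically \<open>K\<close> is a distribution function that controls \<open>D\<close> up to a factor small with the mesh.\<close>

lemma constant_if_small_increments:
  fixes D :: "real \<Rightarrow> 'a::real_normed_vector" and K :: "real \<Rightarrow> real"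
  assumes sT: "s \<le> T"
    and small: "\<And>e. 0 < e \<Longrightarrow> \<exists>d>0. \<forall>u v. s \<le> u \<and> u \<le> v \<and> v \<le> T \<and> v - u < d \<longrightarrow> norm (D v - D u) \<le> e * (K v - K u)"
  shows "D T = D s"
proof -
  define L where "L = T - s"
  have L: "0 \<le> L" using sT by (simp add: L_def)
  have bound: "norm (D T - D s) \<le> e * (K T - K s)" if e: "0 < e" for e
  proof -
    obtain d where d: "0 < d" "\<And>u v. s \<le> u \<Longrightarrow> u \<le> v \<Longrightarrow> v \<le> T \<Longrightarrow> v - u < d \<Longrightarrow> norm (D v - D u) \<le> e * (K v - K u)"
      using small[OF e] by blast
    obtain n where n: "L / d < real n" using reals_Archimedean2 by blast
    hence n0: "0 < real n" using L d by (meson divide_nonneg_pos le_less_trans)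
    define p where "p = (\<lambda>i. s + L * real i / real n)"
    have ends: "p 0 = s" "p n = T" using n0 by (simp_all add: p_def L_def)
    have step: "norm (D (p (Suc i)) - D (p i)) \<le> e * (K (p (Suc i)) - K (p i))" if "i < n" for i
    proof (rule d(2))
      show "s \<le> p i" "p i \<le> p (Suc i)" using L n0 by (auto simp: p_def divide_right_mono mult_left_mono)
      have "real (Suc i) \<le> real n" using that by simp
      hence "L * real (Suc i) / real n \<le> L" using L n0 mult_left_mono[of "real (Suc i)" "real n" L] by (simp add: divide_le_eq del: of_nat_Suc)
      thus "p (Suc i) \<le> T" by (simp add: p_def L_def del: of_nat_Suc)
      have "p (Suc i) - p i = L / real n" by (simp add: p_def diff_divide_distrib[symmetric] algebra_simps)
      also have "\<dots> < d" using n n0 d by (simp add: field_simps)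
      finally show "p (Suc i) - p i < d" .
    qed
    have "D T - D s = (\<Sum>i<n. D (p (Suc i)) - D (p i))" unfolding sum_lessThan_telescope[of "\<lambda>i. D (p i)"] ends ..
    also have "norm \<dots> \<le> (\<Sum>i<n. e * (K (p (Suc i)) - K (p i)))" using step by (intro sum_norm_le) auto
    also have "\<dots> = e * (K T - K s)" unfolding sum_distrib_left[symmetric] sum_lessThan_telescope[of "\<lambda>i. K (p i)"] ends ..
    finally show ?thesis .
  qed
  have "norm (D T - D s) \<le> 0"
  proof (rule tendsto_lowerbound)
    have "((\<lambda>e. e * (K T - K s)) \<longlongrightarrow> 0 * (K T - K s)) (at_right 0)" by (intro tendsto_intros)
    thus "((\<lambda>e. e * (K T - K s)) \<longlongrightarrow> 0) (at_right 0)" by simp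
    show "eventually (\<lambda>e. norm (D T - D s) \<le> e * (K T - K s)) (at_right 0)"
      by (rule eventually_mono[OF eventually_at_right_less[of "0::real"]]) (rule bound)
  qed simp
  thus ?thesis by simp
qed

lemma sum_pairs:
  fixes b :: "nat \<Rightarrow> 'a::comm_monoid_add"
  shows "(\<Sum>i=0..<2 * N. b i) = (\<Sum>i=0..<N. b (2 * i) + b (2 * i + 1))"
  by (induction N) (simp_all add: ac_simps)

text \<open>A continuous nondecreasing function of time. It may be constant on intervals, so it is not
  a reparametrisation of time.\<close>

locale clock =
  fixes I :: "real set" and V :: "real \<Rightarrow> real"
  assumes zero_in: "0 \<in> I" and nonneg: "t \<in> I \<Longrightarrow> 0 \<le> t"
    and down: "t \<in> I \<Longrightarrow> 0 \<le> s \<Longrightarrow> s \<le> t \<Longrightarrow> s \<in> I"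
    and V_zero: "V 0 = 0" and V_mono: "s \<in> I \<Longrightarrow> t \<in> I \<Longrightarrow> s \<le> t \<Longrightarrow> V s \<le> V t"
    and V_continuous: "continuous_on I V" and I_borel: "I \<in> sets borel"
begin

lemma V_nonneg: "t \<in> I \<Longrightarrow> 0 \<le> V t"
  using V_mono[OF zero_in, of t] nonneg V_zero by simp

lemma subset_I: "t \<in> I \<Longrightarrow> {0..t} \<subseteq> I"
  using down by auto

text \<open>Any time with clock value \<open>v\<close>; where the clock stands still the choice is immaterial.\<close>

definition hitting_time :: "real \<Rightarrow> real" where
  "hitting_time v = (SOME t. t \<in> I \<and> V t = v)"

lemma hitting_time:
  assumes "t \<in> I" "0 \<le> v" "v \<le> V t"
  shows "hitting_time v \<in> I" "V (hitting_time v) = v"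
proof -
  have "\<exists>s\<ge>0. s \<le> t \<and> V s = v"
    using assms nonneg V_zero by (intro IVT' continuous_on_subset[OF V_continuous] subset_I) auto
  hence "\<exists>s. s \<in> I \<and> V s = v" using down[OF assms(1)] by blast
  from someI_ex[OF this] show "hitting_time v \<in> I" "V (hitting_time v) = v"
    unfolding hitting_time_def by auto
qed

lemma less_if_V_less: "s \<in> I \<Longrightarrow> t \<in> I \<Longrightarrow> V s < V t \<Longrightarrow> s < t"
  using V_mono[of t s] by (meson leD leI)

text \<open>Dyadic in the clock, not in time: each cell has the same clock increment, so errors of second order
  decay geometrically with the level \<open>n\<close>.\<close>

definition grid :: "nat \<Rightarrow> nat \<Rightarrow> real" where
  "grid n i = hitting_time (real i / 2 ^ n)"

definition cells :: "nat \<Rightarrow> real \<Rightarrow> nat" where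
  "cells n t = nat \<lfloor>2 ^ n * V t\<rfloor>"

lemma cells_le: "t \<in> I \<Longrightarrow> real (cells n t) / 2 ^ n \<le> V t"
  and cells_gt: "t \<in> I \<Longrightarrow> V t < real (cells n t) / 2 ^ n + 1 / 2 ^ n"
proof -
  assume t: "t \<in> I"
  have "0 \<le> 2 ^ n * V t" using V_nonneg[OF t] by simp
  hence e: "real (cells n t) = of_int \<lfloor>2 ^ n * V t\<rfloor>" by (simp add: cells_def)
  have "real (cells n t) \<le> 2 ^ n * V t" "2 ^ n * V t < real (cells n t) + 1" unfolding e by linarith+
  thus "real (cells n t) / 2 ^ n \<le> V t" "V t < real (cells n t) / 2 ^ n + 1 / 2 ^ n"
    by (simp_all add: field_simps)
qed

lemma grid:
  assumes "t \<in> I" "i \<le> cells n t"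
  shows "grid n i \<in> I" "V (grid n i) = real i / 2 ^ n"
proof -
  have "real i / 2 ^ n \<le> real (cells n t) / 2 ^ n" using assms(2) by (simp add: divide_right_mono)
  hence "real i / 2 ^ n \<le> V t" using cells_le[OF assms(1), of n] by linarith
  thus "grid n i \<in> I" "V (grid n i) = real i / 2 ^ n"
    using hitting_time[OF assms(1), of "real i / 2 ^ n"] by (auto simp: grid_def)
qed

lemma grid_mono:
  assumes "t \<in> I" "i < j" "j \<le> cells n t"
  shows "grid n i \<le> grid n j"
proof -
  have "V (grid n i) < V (grid n j)" using assms grid[OF assms(1), of i n] grid[OF assms(1), of j n]
    by (simp add: divide_strict_right_mono)
  moreover have "grid n i \<in> I" "grid n j \<in> I" using assms(2,3) by (auto intro!: grid(1)[OF assms(1)])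
  ultimately show ?thesis using less_if_V_less by (metis less_imp_le)
qed

lemma grid_diff:
  assumes "t \<in> I" "Suc i \<le> cells n t"
  shows "V (grid n (Suc i)) - V (grid n i) = 1 / 2 ^ n"
  using grid(2)[OF assms] grid(2)[OF assms(1), of i n] assms(2)
  by (simp add: diff_divide_distrib[symmetric])

lemma grid_refine: "grid (Suc n) (2 * i) = grid n i"
  by (simp add: grid_def)

lemma cells_limit: "t \<in> I \<Longrightarrow> (\<lambda>n. real (cells n t) / 2 ^ n) \<longlonglongrightarrow> V t"
proof (rule tendsto_sandwich)
  assume t: "t \<in> I"
  show "eventually (\<lambda>n. V t - 1 / 2 ^ n \<le> real (cells n t) / 2 ^ n) sequentially"
  proof (intro always_eventually allI)
    show "V t - 1 / 2 ^ n \<le> real (cells n t) / 2 ^ n" for n using cells_gt[OF t, of n] by linarith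
  qed
  show "eventually (\<lambda>n. real (cells n t) / 2 ^ n \<le> V t) sequentially"
    by (intro always_eventually allI cells_le t)
  have "(\<lambda>n. V t - (1 / 2) ^ n) \<longlonglongrightarrow> V t - 0" by (intro tendsto_intros) auto
  thus "(\<lambda>n. V t - 1 / 2 ^ n) \<longlonglongrightarrow> V t" by (simp add: power_one_over)
qed simp

lemma cells_mono: "V s \<le> V t \<Longrightarrow> cells n s \<le> cells n t"
  unfolding cells_def by (intro nat_mono floor_mono mult_left_mono) auto

text \<open>Only the cells completed before \<open>t\<close> count; the incomplete one is negligible in the limit.\<close>

definition dyadic_sum :: "(real \<Rightarrow> real \<Rightarrow> complex) \<Rightarrow> nat \<Rightarrow> real \<Rightarrow> complex" where
  "dyadic_sum a n t = (\<Sum>i=0..<cells n t. a (grid n i) (grid n (Suc i)))"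

definition sewn :: "(real \<Rightarrow> real \<Rightarrow> complex) \<Rightarrow> real \<Rightarrow> complex" where
  "sewn a t = lim (\<lambda>n. dyadic_sum a n t)"

context
  fixes a :: "real \<Rightarrow> real \<Rightarrow> complex" and C c :: real
  assumes a_bound: "\<And>s t. s \<in> I \<Longrightarrow> t \<in> I \<Longrightarrow> s \<le> t \<Longrightarrow> norm (a s t) \<le> C * (V t - V s)"
    and a_defect: "\<And>s t u. s \<in> I \<Longrightarrow> t \<in> I \<Longrightarrow> u \<in> I \<Longrightarrow> s \<le> t \<Longrightarrow> t \<le> u \<Longrightarrow>
      norm (a s u - a s t - a t u) \<le> c * ((V t - V s) * (V u - V t))"
    and C0: "0 \<le> C" and c0: "0 \<le> c"
begin

text \<open>One point is added at a time: splitting off the last piece costs at most \<open>c\<close> times the product of the two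
  increments, and these products add up to at most the square of the whole increment.\<close>

lemma refinement_defect:
  assumes p: "\<And>i. j \<le> i \<Longrightarrow> i \<le> k \<Longrightarrow> p i \<in> I"
    "\<And>i. j \<le> i \<Longrightarrow> i < k \<Longrightarrow> p i \<le> p (Suc i)" and jk: "j \<le> k"
  shows "norm (a (p j) (p k) - (\<Sum>i=j..<k. a (p i) (p (Suc i)))) \<le> c * (V (p k) - V (p j))\<^sup>2"
  using jk p
proof (induction k rule: dec_induct)
  case base
  have "p j \<in> I" by (rule base(1)) simp_all
  hence "norm (a (p j) (p j)) \<le> 0" using a_bound[of "p j" "p j"] by simp
  thus ?case by simp
next
  case (step k)
  have IH: "norm (a (p j) (p k) - (\<Sum>i=j..<k. a (p i) (p (Suc i)))) \<le> c * (V (p k) - V (p j))\<^sup>2"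
  proof (rule step.IH)
    show "p i \<in> I" if "j \<le> i" "i \<le> k" for i using that by (intro step.prems(1)) auto
    show "p i \<le> p (Suc i)" if "j \<le> i" "i < k" for i using that by (intro step.prems(2)) auto
  qed
  have inI: "p j \<in> I" "p k \<in> I" "p (Suc k) \<in> I"
    using step.hyps by (auto intro: step.prems(1))
  have jk: "p j \<le> p k" using step(1)
  proof (rule dec_induct)
    fix n assume n: "j \<le> n" "n < k" "p j \<le> p n"
    have "p n \<le> p (Suc n)" using n by (intro step.prems(2)) auto
    thus "p j \<le> p (Suc n)" using n(3) by (rule order_trans[rotated])
  qed simp
  have kk: "p k \<le> p (Suc k)" using step.hyps by (intro step.prems(2)) auto
  let ?x = "V (p k) - V (p j)" and ?y = "V (p (Suc k)) - V (p k)"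
  have xy: "0 \<le> ?x" "0 \<le> ?y" using V_mono inI jk kk by auto
  have "a (p j) (p (Suc k)) - (\<Sum>i=j..<Suc k. a (p i) (p (Suc i)))
     = (a (p j) (p (Suc k)) - a (p j) (p k) - a (p k) (p (Suc k))) + (a (p j) (p k) - (\<Sum>i=j..<k. a (p i) (p (Suc i))))"
    using step(1) by simp
  also have "norm \<dots> \<le> c * (?x * ?y) + c * ?x\<^sup>2"
    by (rule norm_triangle_le[OF add_mono[OF a_defect[OF inI jk kk] IH]])
  also have "\<dots> \<le> c * (?x + ?y)\<^sup>2"
  proof -
    have "?x * ?y + ?x\<^sup>2 \<le> (?x + ?y)\<^sup>2" using mult_nonneg_nonneg[OF xy] zero_le_power2[of ?y]
      unfolding power2_sum by linarith
    from mult_left_mono[OF this c0] show ?thesis by (simp add: distrib_left)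
  qed
  finally show ?case by simp
qed

text \<open>Each of the at most \<open>2\<^sup>n V t\<close> cells is halved, at a cost of \<open>c / 4\<^sup>n\<^sup>+\<^sup>1\<close>; at most one cell of the finer
  grid is new, of size \<open>C / 2\<^sup>n\<^sup>+\<^sup>1\<close>.\<close>

lemma dyadic_step:
  assumes t: "t \<in> I"
  shows "norm (dyadic_sum a (Suc n) t - dyadic_sum a n t) \<le> (c * V t / 4 + C / 2) * (1 / 2) ^ n"
proof -
  define N where "N = cells n t"
  define M where "M = cells (Suc n) t"
  let ?g = "grid (Suc n)"
  let ?b = "\<lambda>i. a (?g i) (?g (Suc i))"
  have NM: "2 * N \<le> M" "M \<le> 2 * N + 1"
  proof -
    have "real N / 2 ^ n < real M / 2 ^ Suc n + 1 / 2 ^ Suc n" "real M / 2 ^ Suc n < real N / 2 ^ n + 1 / 2 ^ n"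
      using cells_le[OF t, of n] cells_gt[OF t, of n] cells_le[OF t, of "Suc n"] cells_gt[OF t, of "Suc n"]
      unfolding N_def M_def by linarith+
    hence "real (2 * N) < real (M + 1)" "real M < real (2 * N + 2)" by (simp_all add: field_simps)
    thus "2 * N \<le> M" "M \<le> 2 * N + 1" by (simp_all only: of_nat_less_iff)
  qed
  have split: "dyadic_sum a (Suc n) t = (\<Sum>i=0..<N. ?b (2 * i) + ?b (2 * i + 1)) + (\<Sum>i=2*N..<M. ?b i)"
  proof -
    have "(\<Sum>i=0..<2*N. ?b i) = (\<Sum>i=0..<N. ?b (2 * i) + ?b (2 * i + 1))"
      using sum_pairs[of ?b N] by (simp only: Suc_eq_plus1)
    moreover have "dyadic_sum a (Suc n) t = (\<Sum>i=0..<2*N. ?b i) + (\<Sum>i=2*N..<M. ?b i)"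
      unfolding dyadic_sum_def M_def[symmetric] using NM by (intro sum.atLeastLessThan_concat[symmetric]) auto
    ultimately show ?thesis by simp
  qed
  have cell: "norm (?b (2 * i) + ?b (2 * i + 1) - a (grid n i) (grid n (Suc i))) \<le> c * (1 / 2 ^ Suc n)\<^sup>2" if "i < N" for i
  proof -
    have le: "2 * i + 2 \<le> M" using that NM by simp
    have "norm (a (?g (2 * i)) (?g (2 * i + 2)) - a (?g (2 * i)) (?g (2 * i + 1)) - a (?g (2 * i + 1)) (?g (2 * i + 2)))
      \<le> c * ((V (?g (2 * i + 1)) - V (?g (2 * i))) * (V (?g (2 * i + 2)) - V (?g (2 * i + 1))))"
      using le t unfolding M_def by (intro a_defect grid(1)[OF t] grid_mono[OF t]) auto
    also have "V (?g (2 * i + 1)) - V (?g (2 * i)) = 1 / 2 ^ Suc n"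
      using le grid_diff[OF t, of "2 * i" "Suc n"] unfolding M_def by simp
    also have "V (?g (2 * i + 2)) - V (?g (2 * i + 1)) = 1 / 2 ^ Suc n"
      using le grid_diff[OF t, of "2 * i + 1" "Suc n"] unfolding M_def by simp
    finally have "norm (a (?g (2 * i)) (?g (2 * i + 2)) - a (?g (2 * i)) (?g (2 * i + 1)) - a (?g (2 * i + 1)) (?g (2 * i + 2)))
      \<le> c * (1 / 2 ^ Suc n)\<^sup>2" by (simp only: power2_eq_square)
    moreover have g: "?g (2 * i) = grid n i" by (rule grid_refine)
    moreover have g': "?g (2 * i + 2) = grid n (Suc i)" using grid_refine[of n "Suc i"] by simp
    moreover have alg: "norm (q + r - p) = norm (p - q - r)" for p q r :: complex
      by (metis diff_diff_eq norm_minus_commute)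
    moreover have "Suc (2 * i + 1) = 2 * i + 2" "Suc (2 * i) = 2 * i + 1" by simp_all
    ultimately show ?thesis by (simp only:)
  qed
  have extra: "norm (\<Sum>i=2*N..<M. ?b i) \<le> C * (1 / 2 ^ Suc n)"
  proof (cases "M = 2 * N")
    case True thus ?thesis using C0 by simp
  next
    case False
    hence M: "M = Suc (2 * N)" using NM by simp
    have "norm (?b (2 * N)) \<le> C * (V (?g (Suc (2 * N))) - V (?g (2 * N)))"
      using M t unfolding M_def by (intro a_bound grid(1)[OF t] grid_mono[OF t]) auto
    also have "V (?g (Suc (2 * N))) - V (?g (2 * N)) = 1 / 2 ^ Suc n"
      using M grid_diff[OF t, of "2 * N" "Suc n"] unfolding M_def by simp
    finally show ?thesis unfolding M by simp
  qed
  have NV: "real N \<le> 2 ^ n * V t" using cells_le[OF t, of n] by (simp add: N_def field_simps)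
  let ?S = "\<Sum>i=0..<N. ?b (2 * i) + ?b (2 * i + 1) - a (grid n i) (grid n (Suc i))"
  let ?E = "\<Sum>i=2*N..<M. ?b i"
  have eq: "dyadic_sum a (Suc n) t - dyadic_sum a n t = ?S + ?E"
  proof -
    have alg: "x + e - y = x - y + e" for x e y :: complex by simp
    show ?thesis unfolding split dyadic_sum_def[of a n] N_def[symmetric] sum_subtractf by (rule alg)
  qed
  have "norm ?S \<le> (\<Sum>i=0..<N. c * (1 / 2 ^ Suc n)\<^sup>2)"
  proof (rule sum_norm_le)
    fix i assume "i \<in> {0..<N}"
    hence "i < N" by simp
    thus "norm (?b (2 * i) + ?b (2 * i + 1) - a (grid n i) (grid n (Suc i))) \<le> c * (1 / 2 ^ Suc n)\<^sup>2" by (rule cell)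
  qed
  hence "norm ?S \<le> real N * (c * (1 / 2 ^ Suc n)\<^sup>2)"
    by (simp only: sum_constant card_atLeastLessThan diff_zero)
  moreover have "real N * (c * (1 / 2 ^ Suc n)\<^sup>2) \<le> (2 ^ n * V t) * (c * (1 / 2 ^ Suc n)\<^sup>2)"
    by (rule mult_right_mono[OF NV]) (simp add: c0)
  ultimately have "norm ?S \<le> (2 ^ n * V t) * (c * (1 / 2 ^ Suc n)\<^sup>2)" by (rule order_trans)
  hence "norm (?S + ?E) \<le> (2 ^ n * V t) * (c * (1 / 2 ^ Suc n)\<^sup>2) + C * (1 / 2 ^ Suc n)"
    by (rule norm_triangle_le[OF add_mono[OF _ extra]])
  moreover have "(2 ^ n * V t) * (c * (1 / 2 ^ Suc n)\<^sup>2) + C * (1 / 2 ^ Suc n) = (c * V t / 4 + C / 2) * (1 / 2) ^ n"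
  proof -
    have id: "(q * v) * (c * (1 / (2 * q))\<^sup>2) + C * (1 / (2 * q)) = (c * v / 4 + C / 2) * (1 / q)" if "0 < q" for q v :: real
      using that by (simp add: field_simps power2_eq_square)
    have "(1 / 2) ^ n = 1 / (2::real) ^ n" by (rule power_one_over)
    moreover have "(2::real) ^ Suc n = 2 * 2 ^ n" by (rule power_Suc)
    ultimately show ?thesis using id[of "2 ^ n" "V t"] by (simp only: zero_less_power zero_less_numeral)
  qed
  ultimately show ?thesis unfolding eq by (simp only:)
qed

lemma dyadic_sum_bound:
  assumes t: "t \<in> I"
  shows "norm (sewn a t - dyadic_sum a n t) \<le> (c * V t / 2 + C) * (1 / 2) ^ n"
    and "(\<lambda>n. dyadic_sum a n t) \<longlonglongrightarrow> sewn a t"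
proof -
  define K where "K = c * V t / 4 + C / 2"
  have K0: "0 \<le> K" unfolding K_def using c0 C0 V_nonneg[OF t] by simp
  have st: "norm (dyadic_sum a (Suc n) t - dyadic_sum a n t) \<le> K * (1 / 2) ^ n" for n
    using dyadic_step[OF t] by (simp add: K_def)
  have diff: "norm (dyadic_sum a (n + k) t - dyadic_sum a n t) \<le> 2 * K * (1 / 2) ^ n - 2 * K * (1 / 2) ^ (n + k)" for n k
  proof (induction k)
    case (Suc k)
    have "norm (dyadic_sum a (n + Suc k) t - dyadic_sum a n t) \<le> norm (dyadic_sum a (Suc (n + k)) t - dyadic_sum a (n + k) t) + norm (dyadic_sum a (n + k) t - dyadic_sum a n t)"
      using norm_triangle_ineq[of "dyadic_sum a (Suc (n + k)) t - dyadic_sum a (n + k) t" "dyadic_sum a (n + k) t - dyadic_sum a n t"] by simp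
    also have "\<dots> \<le> K * (1 / 2) ^ (n + k) + (2 * K * (1 / 2) ^ n - 2 * K * (1 / 2) ^ (n + k))"
      by (rule add_mono[OF st Suc])
    finally show ?case by simp
  qed simp
  have diff': "norm (dyadic_sum a m t - dyadic_sum a n t) \<le> 2 * K * (1 / 2) ^ n" if "n \<le> m" for m n
  proof -
    have "0 \<le> 2 * K * (1 / 2) ^ m" using K0 by simp
    thus ?thesis using diff[of n "m - n"] that by simp
  qed
  have "summable (\<lambda>n. dyadic_sum a (Suc n) t - dyadic_sum a n t)"
    by (rule summable_comparison_test'[of "\<lambda>n. K * (1 / 2) ^ n" 0]) (use st in \<open>auto intro!: summable_mult summable_geometric\<close>)
  hence "convergent (\<lambda>n. \<Sum>i<n. dyadic_sum a (Suc i) t - dyadic_sum a i t)" by (simp add: summable_iff_convergent)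
  hence "convergent (\<lambda>n. dyadic_sum a n t - dyadic_sum a 0 t)" unfolding sum_lessThan_telescope[of "\<lambda>n. dyadic_sum a n t"] .
  hence "convergent (\<lambda>n. dyadic_sum a n t)" by (simp add: convergent_diff_const_right_iff)
  thus L: "(\<lambda>n. dyadic_sum a n t) \<longlonglongrightarrow> sewn a t" unfolding sewn_def by (simp add: convergent_LIMSEQ_iff)
  have "norm (sewn a t - dyadic_sum a n t) \<le> 2 * K * (1 / 2) ^ n"
  proof (rule tendsto_upperbound)
    show "(\<lambda>m. norm (dyadic_sum a m t - dyadic_sum a n t)) \<longlonglongrightarrow> norm (sewn a t - dyadic_sum a n t)" by (intro tendsto_intros L)
    show "eventually (\<lambda>m. norm (dyadic_sum a m t - dyadic_sum a n t) \<le> 2 * K * (1 / 2) ^ n) sequentially"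
      using eventually_ge_at_top[of n] by eventually_elim (rule diff')
  qed simp
  thus "norm (sewn a t - dyadic_sum a n t) \<le> (c * V t / 2 + C) * (1 / 2) ^ n" by (simp add: K_def algebra_simps)
qed

text \<open>Moving one end point changes \<open>a\<close> by a piece and a defect, both controlled by the clock. The condition
  that both left end points precede \<open>q\<close> lets the two ends be moved one after the other.\<close>

lemma increment_stable:
  assumes I: "p \<in> I" "q \<in> I" "s \<in> I" "t \<in> I" and less: "p < q" "s < q" "s \<le> t"
    and L: "V p \<le> L" "V q \<le> L" "V s \<le> L" "V t \<le> L"
  shows "norm (a p q - a s t) \<le> (C + c * L) * (\<bar>V p - V s\<bar> + \<bar>V q - V t\<bar>)"
proof -
  have left: "norm (a x z - a y z) \<le> (C + c * L) * \<bar>V x - V y\<bar>" if "x \<in> I" "y \<in> I" "z \<in> I" "x \<le> y" "y \<le> z" "V z \<le> L" for x y z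
  proof -
    have V: "0 \<le> V x" "V x \<le> V y" "V y \<le> V z" using that V_mono V_nonneg by auto
    have "norm (a x z - a y z) \<le> norm (a x z - a x y - a y z) + norm (a x y)"
      using norm_triangle_ineq[of "a x z - a x y - a y z" "a x y"] by simp
    also have "\<dots> \<le> c * ((V y - V x) * (V z - V y)) + C * (V y - V x)" using that by (intro add_mono a_defect a_bound) auto
    also have "\<dots> \<le> c * ((V y - V x) * L) + C * (V y - V x)" using V that(6) c0 by (intro add_right_mono mult_left_mono) auto
    finally show ?thesis using V by (simp add: algebra_simps)
  qed
  have right: "norm (a x y - a x z) \<le> (C + c * L) * \<bar>V y - V z\<bar>" if "x \<in> I" "y \<in> I" "z \<in> I" "x \<le> y" "y \<le> z" "V z \<le> L" for x y z
  proof -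
    have V: "0 \<le> V x" "V x \<le> V y" "V y \<le> V z" using that V_mono V_nonneg by auto
    have "norm (a x y - a x z) \<le> norm (a x z - a x y - a y z) + norm (a y z)"
      using norm_triangle_ineq[of "a x z - a x y - a y z" "a y z"] by (simp add: norm_minus_commute)
    also have "\<dots> \<le> c * ((V y - V x) * (V z - V y)) + C * (V z - V y)" using that by (intro add_mono a_defect a_bound) auto
    also have "\<dots> \<le> c * (L * (V z - V y)) + C * (V z - V y)" using V that(6) c0 by (intro add_right_mono mult_left_mono mult_right_mono) auto
    finally show ?thesis using V by (simp add: algebra_simps)
  qed
  have "norm (a p q - a s q) \<le> (C + c * L) * \<bar>V p - V s\<bar>"
  proof (cases "p \<le> s")
    case True show ?thesis by (rule left) (use True I less L in simp_all)
  next
    case False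
    have "norm (a s q - a p q) \<le> (C + c * L) * \<bar>V s - V p\<bar>" by (rule left) (use False I less L in simp_all)
    thus ?thesis by (simp only: norm_minus_commute abs_minus_commute)
  qed
  moreover have "norm (a s q - a s t) \<le> (C + c * L) * \<bar>V q - V t\<bar>"
  proof (cases "q \<le> t")
    case True show ?thesis by (rule right) (use True I less L in simp_all)
  next
    case False
    have "norm (a s t - a s q) \<le> (C + c * L) * \<bar>V t - V q\<bar>" by (rule right) (use False I less L in simp_all)
    thus ?thesis by (simp only: norm_minus_commute abs_minus_commute)
  qed
  ultimately show ?thesis using norm_triangle_ineq[of "a p q - a s q" "a s q - a s t"] by (simp add: distrib_left)
qed

lemma dyadic_sum_diff:
  assumes "V s \<le> V t"
  shows "dyadic_sum a n t - dyadic_sum a n s = (\<Sum>i=cells n s..<cells n t. a (grid n i) (grid n (Suc i)))"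
  unfolding dyadic_sum_def
  using sum.atLeastLessThan_concat[of 0 "cells n s" "cells n t" "\<lambda>i. a (grid n i) (grid n (Suc i))"] cells_mono[OF assms, of n]
  by (simp add: algebra_simps)

lemma sewn_increment_norm:
  assumes st: "s \<in> I" "t \<in> I" "s \<le> t"
  shows "norm (sewn a t - sewn a s) \<le> C * (V t - V s)"
proof (rule tendsto_le[OF sequentially_bot])
  show "(\<lambda>n. norm (dyadic_sum a n t - dyadic_sum a n s)) \<longlonglongrightarrow> norm (sewn a t - sewn a s)"
    by (intro tendsto_intros dyadic_sum_bound st)
  show "(\<lambda>n. C * (real (cells n t) / 2 ^ n - real (cells n s) / 2 ^ n)) \<longlonglongrightarrow> C * (V t - V s)"
    by (intro tendsto_intros cells_limit st)
  show "eventually (\<lambda>n. norm (dyadic_sum a n t - dyadic_sum a n s) \<le> C * (real (cells n t) / 2 ^ n - real (cells n s) / 2 ^ n)) sequentially"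
  proof (intro always_eventually allI)
    fix n
    have le: "cells n s \<le> cells n t" by (rule cells_mono[OF V_mono[OF st]])
    have "norm (a (grid n i) (grid n (Suc i))) \<le> C * (1 / 2 ^ n)" if "i \<in> {cells n s..<cells n t}" for i
    proof -
      have i: "Suc i \<le> cells n t" using that by simp
      have "norm (a (grid n i) (grid n (Suc i))) \<le> C * (V (grid n (Suc i)) - V (grid n i))"
        using i by (intro a_bound grid(1)[OF st(2)] grid_mono[OF st(2)]) auto
      thus ?thesis unfolding grid_diff[OF st(2) i] .
    qed
    hence "norm (\<Sum>i=cells n s..<cells n t. a (grid n i) (grid n (Suc i))) \<le> (\<Sum>i=cells n s..<cells n t. C * (1 / 2 ^ n))"
      by (rule sum_norm_le)
    also have "\<dots> = C * (real (cells n t) / 2 ^ n - real (cells n s) / 2 ^ n)"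
      using le by (simp add: of_nat_diff diff_divide_distrib algebra_simps)
    finally show "norm (dyadic_sum a n t - dyadic_sum a n s) \<le> C * (real (cells n t) / 2 ^ n - real (cells n s) / 2 ^ n)"
      unfolding dyadic_sum_diff[OF V_mono[OF st]] .
  qed
qed

lemma sewn_Im_mono:
  assumes st: "s \<in> I" "t \<in> I" "s \<le> t"
    and pos: "\<And>s t. s \<in> I \<Longrightarrow> t \<in> I \<Longrightarrow> s \<le> t \<Longrightarrow> 0 \<le> Im (a s t)"
  shows "0 \<le> Im (sewn a t - sewn a s)"
proof (rule tendsto_lowerbound)
  show "(\<lambda>n. Im (dyadic_sum a n t - dyadic_sum a n s)) \<longlonglongrightarrow> Im (sewn a t - sewn a s)"
    by (intro tendsto_intros dyadic_sum_bound st)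
  show "eventually (\<lambda>n. 0 \<le> Im (dyadic_sum a n t - dyadic_sum a n s)) sequentially"
    unfolding dyadic_sum_diff[OF V_mono[OF st]] Im_sum
    by (intro always_eventually allI sum_nonneg pos grid(1)[OF st(2)] grid_mono[OF st(2)]) auto
qed simp

text \<open>The dyadic sum between \<open>s\<close> and \<open>t\<close> is a refinement of \<open>a\<close> over neighbouring grid points, and these tend to
  \<open>s\<close> and \<open>t\<close> in the clock.\<close>

theorem sewing:
  assumes st: "s \<in> I" "t \<in> I" "s \<le> t"
  shows "norm (sewn a t - sewn a s - a s t) \<le> c * (V t - V s)\<^sup>2"
proof (cases "V s = V t")
  case True
  have "dyadic_sum a n s = dyadic_sum a n t" for n using True by (simp add: dyadic_sum_def cells_def)
  hence "sewn a s = sewn a t" by (simp add: sewn_def)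
  moreover have "a s t = 0" using a_bound[OF st] True by simp
  ultimately show ?thesis using c0 by simp
next
  case False
  hence less: "V s < V t" using V_mono[OF st] by simp
  define v where "v = (\<lambda>n. real (cells n s) / 2 ^ n)"
  define w where "w = (\<lambda>n. real (cells n t) / 2 ^ n)"
  have vl: "v \<longlonglongrightarrow> V s" "w \<longlonglongrightarrow> V t" unfolding v_def w_def by (rule cells_limit[OF st(1)], rule cells_limit[OF st(2)])
  let ?e = "\<lambda>n. c * (w n - v n)\<^sup>2 + (C + c * V t) * (\<bar>v n - V s\<bar> + \<bar>w n - V t\<bar>)"
  have "eventually (\<lambda>n. norm (dyadic_sum a n t - dyadic_sum a n s - a s t) \<le> ?e n) sequentially"
    using order_tendstoD(1)[OF vl(2) less]
  proof eventually_elim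
    case (elim n)
    have le: "cells n s \<le> cells n t" using less by (auto simp: cells_def intro!: nat_mono floor_mono)
    let ?p = "grid n (cells n s)" and ?q = "grid n (cells n t)"
    have g: "?p \<in> I" "V ?p = v n" "?q \<in> I" "V ?q = w n"
      using grid[OF st(1), of "cells n s" n] grid[OF st(2), of "cells n t" n] by (auto simp: v_def w_def)
    have vV: "v n \<le> V s" "w n \<le> V t" using cells_le st by (auto simp: v_def w_def)
    have "dyadic_sum a n t - dyadic_sum a n s = (\<Sum>i=cells n s..<cells n t. a (grid n i) (grid n (Suc i)))"
      by (rule dyadic_sum_diff[OF V_mono[OF st]])
    moreover have "norm (a ?p ?q - (\<Sum>i=cells n s..<cells n t. a (grid n i) (grid n (Suc i)))) \<le> c * (V ?q - V ?p)\<^sup>2"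
      using le st by (intro refinement_defect grid(1)[OF st(2)] grid_mono[OF st(2)]) auto
    moreover have "norm (a ?p ?q - a s t) \<le> (C + c * V t) * (\<bar>V ?p - V s\<bar> + \<bar>V ?q - V t\<bar>)"
    proof (rule increment_stable)
      show "?p < ?q" by (rule less_if_V_less) (use g vV elim in auto)
      show "s < ?q" by (rule less_if_V_less) (use g st elim in auto)
    qed (use g st vV less in auto)
    ultimately show ?case unfolding g
      using norm_triangle_ineq[of "(dyadic_sum a n t - dyadic_sum a n s) - a ?p ?q" "a ?p ?q - a s t"]
      by (simp add: norm_minus_commute)
  qed
  moreover have "?e \<longlonglongrightarrow> c * (V t - V s)\<^sup>2 + (C + c * V t) * (\<bar>V s - V s\<bar> + \<bar>V t - V t\<bar>)"
    by (intro tendsto_intros vl)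
  moreover have "(\<lambda>n. norm (dyadic_sum a n t - dyadic_sum a n s - a s t)) \<longlonglongrightarrow> norm (sewn a t - sewn a s - a s t)"
    by (intro tendsto_intros dyadic_sum_bound st)
  ultimately have "norm (sewn a t - sewn a s - a s t) \<le> c * (V t - V s)\<^sup>2 + (C + c * V t) * (\<bar>V s - V s\<bar> + \<bar>V t - V t\<bar>)"
    by (intro tendsto_le[OF sequentially_bot]) 
  thus ?thesis by simp
qed

end
end

section \<open>Disintegrating an increasing family of measures over time\<close>

text \<open>The sum of the measures \<open>M n\<close> with weights that make the total mass at most 1.\<close>

lemma dominating_measure:
  fixes M :: "nat \<Rightarrow> 'a measure"
  assumes fin: "\<And>n. finite_measure (M n)" and sets: "\<And>n. sets (M n) = sets N"
  obtains \<eta> where "finite_measure \<eta>" "sets \<eta> = sets N" "\<And>n. absolutely_continuous \<eta> (M n)"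
proof -
  define c where "c = (\<lambda>n. (1 / 2) ^ Suc n / (1 + measure (M n) (space N)))"
  have c: "0 < c n" for n unfolding c_def by (intro divide_pos_pos add_pos_nonneg) auto
  define \<mu> where "\<mu> = (\<lambda>A. \<integral>\<^sup>+n. ennreal (c n) * emeasure (M n) A \<partial>count_space UNIV)"
  define \<eta> where "\<eta> = measure_of (space N) (sets N) \<mu>"
  have ca: "countably_additive (sets N) \<mu>"
  proof (rule countably_additiveI)
    fix A :: "nat \<Rightarrow> 'a set" assume A: "range A \<subseteq> sets N" "disjoint_family A"
    have "(\<Sum>i. \<mu> (A i)) = (\<integral>\<^sup>+n. (\<Sum>i. ennreal (c n) * emeasure (M n) (A i)) \<partial>count_space UNIV)"
      unfolding \<mu>_def by (intro nn_integral_suminf[symmetric]) simp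
    also have "\<dots> = \<mu> (\<Union>i. A i)" unfolding \<mu>_def
      using A sets by (intro nn_integral_cong) (simp add: suminf_emeasure)
    finally show "(\<Sum>i. \<mu> (A i)) = \<mu> (\<Union>i. A i)" .
  qed
  have em: "emeasure \<eta> A = \<mu> A" if "A \<in> sets N" for A
    unfolding \<eta>_def
    by (rule emeasure_measure_of_sigma[OF sets.sigma_algebra_axioms _ ca that]) (simp add: positive_def \<mu>_def)
  have sets\<eta>: "sets \<eta> = sets N" "space \<eta> = space N" by (simp_all add: \<eta>_def)
  have "\<mu> (space N) \<le> (\<integral>\<^sup>+n. ennreal ((1 / 2) ^ Suc n) \<partial>count_space UNIV)"
    unfolding \<mu>_def
  proof (rule nn_integral_mono)
    fix n
    interpret finite_measure "M n" by (rule fin)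
    have m: "0 \<le> measure (M n) (space N)" by simp
    have "c n * measure (M n) (space N) = (1 / 2) ^ Suc n * (measure (M n) (space N) / (1 + measure (M n) (space N)))"
      by (simp add: c_def)
    also have "\<dots> \<le> (1 / 2) ^ Suc n * 1" 
    proof (rule mult_left_mono)
      have "0 < 1 + measure (M n) (space N)" using m by linarith
      thus "measure (M n) (space N) / (1 + measure (M n) (space N)) \<le> 1" by (simp add: divide_le_eq_1_pos)
    qed simp
    finally have "c n * measure (M n) (space N) \<le> (1 / 2) ^ Suc n" by simp
    thus "ennreal (c n) * emeasure (M n) (space N) \<le> ennreal ((1 / 2) ^ Suc n)"
      unfolding emeasure_eq_measure using c[of n] by (simp add: ennreal_mult'[symmetric] ennreal_leI)
  qed
  also have "\<dots> = (\<Sum>n. ennreal ((1 / 2) ^ Suc n))" by (rule nn_integral_count_space_nat)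
  also have "\<dots> = ennreal (\<Sum>n. (1 / 2) ^ Suc n)"
    by (rule suminf_ennreal2) (auto intro: sums_summable[OF power_half_series])
  also have "\<dots> < \<infinity>" by simp
  finally have "\<mu> (space N) < \<infinity>" .
  hence f: "finite_measure \<eta>" by (intro finite_measureI) (simp add: em sets\<eta>)
  have "absolutely_continuous \<eta> (M n)" for n unfolding absolutely_continuous_def
  proof
    fix A assume A: "A \<in> null_sets \<eta>"
    hence A': "A \<in> sets N" using sets\<eta> by auto
    have "\<mu> A = 0" using A em[OF A'] by auto
    hence "ennreal (c n) * emeasure (M n) A = 0" unfolding \<mu>_def by (simp add: nn_integral_0_iff_AE AE_count_space)
    thus "A \<in> null_sets (M n)" using c[of n] A' sets[of n] by (auto simp: null_sets_def)
  qed
  thus ?thesis using that f sets\<eta>(1) by blast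
qed

lemma density_mono_AE:
  assumes \<eta>: "finite_measure \<eta>" and [measurable]: "f \<in> borel_measurable \<eta>" "g \<in> borel_measurable \<eta>"
    and fin: "emeasure (density \<eta> f) (space \<eta>) \<noteq> \<infinity>"
    and le: "\<And>A. A \<in> sets \<eta> \<Longrightarrow> emeasure (density \<eta> f) A \<le> emeasure (density \<eta> g) A"
  shows "AE x in \<eta>. f x \<le> g x"
proof -
  define S where "S = {x \<in> space \<eta>. g x < f x}"
  have S[measurable]: "S \<in> sets \<eta>" unfolding S_def by measurable
  have fS: "(\<integral>\<^sup>+x. f x * indicator S x \<partial>\<eta>) = emeasure (density \<eta> f) S" by (rule emeasure_density[symmetric]) measurable
  have gS: "(\<integral>\<^sup>+x. g x * indicator S x \<partial>\<eta>) = emeasure (density \<eta> g) S" by (rule emeasure_density[symmetric]) measurable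
  have gf: "(\<integral>\<^sup>+x. g x * indicator S x \<partial>\<eta>) \<le> (\<integral>\<^sup>+x. f x * indicator S x \<partial>\<eta>)"
    by (intro nn_integral_mono) (auto simp: S_def less_imp_le split: split_indicator)
  have ffin: "(\<integral>\<^sup>+x. f x * indicator S x \<partial>\<eta>) \<noteq> \<infinity>"
    unfolding fS using fin emeasure_space[of "density \<eta> f" S] by (auto simp: top_unique)
  have "(\<integral>\<^sup>+x. f x * indicator S x - g x * indicator S x \<partial>\<eta>) = (\<integral>\<^sup>+x. f x * indicator S x \<partial>\<eta>) - (\<integral>\<^sup>+x. g x * indicator S x \<partial>\<eta>)"
    by (rule nn_integral_diff) (use ffin gf in \<open>auto simp: S_def less_imp_le top_unique split: split_indicator\<close>)
  also have "\<dots> = 0" unfolding fS gS using le[OF S] ffin unfolding fS by (simp add: diff_eq_0_iff_ennreal top_unique less_top)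
  finally have "AE x in \<eta>. f x * indicator S x - g x * indicator S x = 0" by (subst (asm) nn_integral_0_iff_AE) auto
  thus ?thesis
  proof (rule AE_mp, intro AE_I2 impI)
    fix x assume x: "x \<in> space \<eta>" and z: "f x * indicator S x - g x * indicator S x = 0"
    show "f x \<le> g x"
    proof (rule ccontr)
      assume "\<not> f x \<le> g x"
      hence "x \<in> S" "g x < f x" using x by (auto simp: S_def)
      thus False using z by (auto simp: diff_eq_0_iff_ennreal)
    qed
  qed
qed

text \<open>Represents a density \<open>e\<close> as the length of a set of thresholds \<open>u\<close>, infinite values included.\<close>

lemma emeasure_lborel_positive_ray: "emeasure lborel {u::real. 0 < u \<and> ennreal u \<le> e} = e"
proof (cases e)
  case (real r)
  have "{u::real. 0 < u \<and> ennreal u \<le> e} = {0<..r}" using real by (auto simp: ennreal_le_iff)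
  thus ?thesis using real by simp
next
  case top
  have "{u::real. 0 < u \<and> ennreal u \<le> e} = {0<..}" using top by auto
  moreover have "emeasure lborel {0::real<..} = \<infinity>"
  proof (cases "emeasure lborel {0::real<..}")
    case (real r)
    obtain n where n: "r < real n" using reals_Archimedean2 by blast
    have "emeasure lborel {0<..real n} \<le> emeasure lborel {0::real<..}" by (intro emeasure_mono) auto
    thus ?thesis using n real by (simp add: ennreal_le_iff)
  qed simp
  ultimately show ?thesis using top by simp
qed

text \<open>The largest dyadic number of level \<open>k\<close> that is strictly below \<open>c\<close> increases with \<open>k\<close>.\<close>

lemma dyadic_from_below:
  assumes "0 < (c::real)"
  obtains r where "incseq r" "\<And>k. r k \<in> \<rat>" "\<And>k. 0 \<le> r k" "\<And>k. r k < c" "r \<longlonglongrightarrow> c"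
proof
  define r where "r = (\<lambda>k. real_of_int (\<lceil>c * 2 ^ k\<rceil> - 1) / 2 ^ k)"
  show "incseq r"
  proof (rule incseq_SucI)
    fix k
    have "of_int (2 * (\<lceil>c * 2 ^ k\<rceil> - 1)) < c * 2 ^ Suc k" by (simp add: algebra_simps) linarith
    hence "2 * (\<lceil>c * 2 ^ k\<rceil> - 1) \<le> \<lceil>c * 2 ^ Suc k\<rceil> - 1" by linarith
    hence "real_of_int (2 * (\<lceil>c * 2 ^ k\<rceil> - 1)) \<le> real_of_int (\<lceil>c * 2 ^ Suc k\<rceil> - 1)" by (simp only: of_int_le_iff)
    hence "real_of_int (2 * (\<lceil>c * 2 ^ k\<rceil> - 1)) / 2 ^ Suc k \<le> r (Suc k)"
      unfolding r_def by (intro divide_right_mono) auto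
    moreover have "real_of_int y / 2 ^ k = real_of_int (2 * y) / 2 ^ Suc k" for y by simp
    ultimately show "r k \<le> r (Suc k)" unfolding r_def by (simp only:)
  qed
  show "r k \<in> \<rat>" for k unfolding r_def by (intro Rats_divide Rats_of_int Rats_power) auto
  have c: "0 < c * 2 ^ k" for k using assms by simp
  show "0 \<le> r k" for k unfolding r_def using c[of k] by (intro divide_nonneg_nonneg) auto
  have lt: "r k < c" for k
  proof -
    have "of_int (\<lceil>c * 2 ^ k\<rceil> - 1) < c * 2 ^ k" by linarith
    thus ?thesis unfolding r_def by (simp add: field_simps)
  qed
  show "r k < c" for k by (rule lt)
  have ge: "c - (1 / 2) ^ k \<le> r k" for k
  proof -
    have "c * 2 ^ k - 1 \<le> of_int (\<lceil>c * 2 ^ k\<rceil> - 1)" by linarith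
    hence "(c * 2 ^ k - 1) / 2 ^ k \<le> r k" unfolding r_def by (intro divide_right_mono) auto
    thus ?thesis by (simp add: diff_divide_distrib power_one_over)
  qed
  show "r \<longlonglongrightarrow> c"
  proof (rule tendsto_sandwich)
    show "eventually (\<lambda>k. c - (1 / 2) ^ k \<le> r k) sequentially" by (intro always_eventually allI ge)
    show "eventually (\<lambda>k. r k \<le> c) sequentially" by (intro always_eventually allI less_imp_le lt)
    have "(\<lambda>k. c - (1 / 2) ^ k) \<longlonglongrightarrow> c - 0" by (intro tendsto_intros) auto
    thus "(\<lambda>k. c - (1 / 2) ^ k) \<longlonglongrightarrow> c" by simp
  qed simp
qed

context clock
begin

lemma interval_sets: "t \<in> I \<Longrightarrow> A \<in> sets borel \<Longrightarrow> J \<in> sets borel \<Longrightarrow> J \<subseteq> {0..t} \<Longrightarrow> A \<times> J \<in> sets (restrict_space borel ((UNIV::real set) \<times> I))"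
proof -
  assume a: "t \<in> I" "A \<in> sets borel" "J \<in> sets borel" "J \<subseteq> {0..t}"
  have "(UNIV::real set) \<times> I \<in> sets borel" using I_borel unfolding borel_prod[symmetric] by simp
  moreover have "A \<times> J \<in> sets borel" using a unfolding borel_prod[symmetric] by simp
  moreover have "J \<subseteq> I" using a subset_I by blast
  ultimately show ?thesis by (subst sets_restrict_space_iff) auto
qed

lemma slab_sets:
  assumes "t \<in> I" "A \<in> sets borel"
  shows "A \<times> {0..<t} \<in> sets (restrict_space borel ((UNIV::real set) \<times> I))"
    and "A \<times> {0..t} \<in> sets (restrict_space borel ((UNIV::real set) \<times> I))"
    and "A \<times> {t} \<in> sets (restrict_space borel ((UNIV::real set) \<times> I))"
proof -
  have "{0..<t} \<subseteq> {0..t}" "{t} \<subseteq> {0..t}" using nonneg[OF assms(1)] by auto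
  thus "A \<times> {0..<t} \<in> sets (restrict_space borel ((UNIV::real set) \<times> I))"
    "A \<times> {0..t} \<in> sets (restrict_space borel ((UNIV::real set) \<times> I))"
    "A \<times> {t} \<in> sets (restrict_space borel ((UNIV::real set) \<times> I))"
    using assms by (auto intro!: interval_sets)
qed

text \<open>A quantile construction. Let \<open>\<psi>\<^sub>q(x)\<close> be the density of \<open>\<theta> q\<close> for rational \<open>q\<close> with respect to one
  dominating measure \<open>\<eta>\<close>. For fixed \<open>x\<close> it increases with \<open>q\<close> like a distribution function in time, and a point
  \<open>(x,u)\<close> with \<open>0 < u\<close> is sent to \<open>(x, \<tau>)\<close>, where \<open>\<tau>\<close> is the first time at which \<open>\<psi>(x)\<close> reaches \<open>u\<close>. The
  image of \<open>\<eta>\<close> times Lebesgue measure is the required measure. Points whose level \<open>u\<close> is never reached are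
  discarded, so neither the interval nor the total mass has to be finite.\<close>

theorem spacetime_measure:
  fixes \<theta> :: "real \<Rightarrow> real measure"
  assumes fin: "\<And>t. t \<in> I \<Longrightarrow> finite_real_measure (\<theta> t)"
    and mono: "\<And>s t A. s \<in> I \<Longrightarrow> t \<in> I \<Longrightarrow> s \<le> t \<Longrightarrow> A \<in> sets borel \<Longrightarrow> measure (\<theta> s) A \<le> measure (\<theta> t) A"
    and inc: "\<And>s t A. s \<in> I \<Longrightarrow> t \<in> I \<Longrightarrow> s \<le> t \<Longrightarrow> A \<in> sets borel \<Longrightarrow> measure (\<theta> t) A \<le> measure (\<theta> s) A + (V t - V s)"
    and zero: "measure (\<theta> 0) UNIV = 0"
  obtains \<Theta> where "sets \<Theta> = sets (restrict_space borel (UNIV \<times> I))"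
    "\<And>t. t \<in> I \<Longrightarrow> emeasure \<Theta> (UNIV \<times> {t}) = 0"
    "\<And>t A. t \<in> I \<Longrightarrow> A \<in> sets borel \<Longrightarrow> emeasure \<Theta> (A \<times> {0..t}) = emeasure (\<theta> t) A"
proof -
  have sets\<theta>: "sets (\<theta> t) = sets borel" if "t \<in> I" for t using finite_real_measure.sets_eq[OF fin[OF that]] .
  have em\<theta>: "emeasure (\<theta> t) A = ennreal (measure (\<theta> t) A)" if "t \<in> I" for t A
  proof -
    interpret finite_real_measure "\<theta> t" by (rule fin[OF that])
    show ?thesis by (rule emeasure_eq_measure)
  qed
  define q where "q = from_nat_into (\<rat> \<inter> I)"
  have ne: "\<rat> \<inter> I \<noteq> {}" using zero_in by auto
  have "countable (\<rat> \<inter> I)" by (intro countable_Int1 countable_rat)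
  hence q: "range q = \<rat> \<inter> I" unfolding q_def by (rule range_from_nat_into[OF ne])
  have qI: "q n \<in> I" for n using q by blast
  obtain \<eta> where \<eta>: "finite_measure \<eta>" "sets \<eta> = sets borel" "\<And>n. absolutely_continuous \<eta> (\<theta> (q n))"
    using dominating_measure[of "\<lambda>n. \<theta> (q n)" borel] fin[OF qI] sets\<theta>[OF qI]
    by (auto simp: finite_real_measure_def)
  interpret \<eta>: finite_measure \<eta> by (rule \<eta>(1))
  note [measurable_cong] = \<eta>(2)
  have sp\<eta>: "space \<eta> = UNIV" using sets_eq_imp_space_eq[OF \<eta>(2)] by simp
  have "\<exists>f\<in>borel_measurable \<eta>. density \<eta> f = \<theta> (q n)" for n
    by (rule \<eta>.Radon_Nikodym[OF \<eta>(3)]) (simp add: sets\<theta> qI \<eta>(2))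
  then obtain \<phi> where \<phi>[measurable]: "\<And>n. \<phi> n \<in> borel_measurable \<eta>" and d\<phi>: "\<And>n. density \<eta> (\<phi> n) = \<theta> (q n)"
    by metis
  \<comment> \<open>The densities \<open>\<phi>\<close> increase in \<open>q\<close> only almost everywhere; passing to suprema repairs this without changing
    the measures.\<close>
  define \<psi> where "\<psi> = (\<lambda>n x. SUP m\<in>{m. q m \<le> q n}. \<phi> m x)"
  have \<psi>[measurable]: "\<psi> n \<in> borel_measurable \<eta>" for n
    unfolding \<psi>_def by (rule borel_measurable_SUP) auto
  have "AE x in \<eta>. \<phi> m x \<le> \<phi> n x" if "q m \<le> q n" for m n
  proof (rule density_mono_AE[OF \<eta>(1)])
    show "emeasure (density \<eta> (\<phi> m)) (space \<eta>) \<noteq> \<infinity>" unfolding d\<phi> em\<theta>[OF qI] by simp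
    show "emeasure (density \<eta> (\<phi> m)) A \<le> emeasure (density \<eta> (\<phi> n)) A" if "A \<in> sets \<eta>" for A
      unfolding d\<phi> em\<theta>[OF qI] using mono[OF qI qI \<open>q m \<le> q n\<close>] that \<eta>(2) by (intro ennreal_leI) auto
  qed measurable
  hence "AE x in \<eta>. \<forall>m. q m \<le> q n \<longrightarrow> \<phi> m x \<le> \<phi> n x" for n by (auto simp: AE_all_countable)
  hence AE\<psi>: "AE x in \<eta>. \<psi> n x = \<phi> n x" for n
  proof (rule AE_mp, intro AE_I2 impI)
    fix x assume "\<forall>m. q m \<le> q n \<longrightarrow> \<phi> m x \<le> \<phi> n x"
    thus "\<psi> n x = \<phi> n x" unfolding \<psi>_def by (intro antisym SUP_least SUP_upper) auto
  qed
  have d\<psi>: "density \<eta> (\<psi> n) = \<theta> (q n)" for n unfolding d\<phi>[symmetric]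
    by (rule density_cong) (use AE\<psi> in auto)
  have \<psi>mono: "\<psi> m x \<le> \<psi> n x" if "q m \<le> q n" for m n x
    unfolding \<psi>_def using that by (intro SUP_subset_mono) auto
  let ?P = "\<eta> \<Otimes>\<^sub>M (lborel :: real measure)"
  \<comment> \<open>The points over \<open>A\<close> whose level is reached by time \<open>q n\<close>.\<close>
  define W where "W = (\<lambda>n A. {w :: real \<times> real. fst w \<in> A \<and> 0 < snd w \<and> ennreal (snd w) \<le> \<psi> n (fst w)})"
  have spP: "space ?P = UNIV" by (simp add: space_pair_measure sp\<eta>)
  have WS: "W n A \<in> sets ?P" if A[measurable]: "A \<in> sets borel" for n A
  proof -
    have "W n A = {w \<in> space ?P. fst w \<in> A \<and> 0 < snd w \<and> ennreal (snd w) \<le> \<psi> n (fst w)}" by (simp add: W_def spP)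
    also have "\<dots> \<in> sets ?P" by measurable
    finally show ?thesis .
  qed
  have emW: "emeasure ?P (W n A) = emeasure (\<theta> (q n)) A" if A[measurable]: "A \<in> sets borel" for n A
  proof -
    have "emeasure ?P (W n A) = (\<integral>\<^sup>+x. emeasure lborel (Pair x -` W n A) \<partial>\<eta>)"
      by (rule lborel.emeasure_pair_measure_alt[OF WS[OF A]])
    also have "\<dots> = (\<integral>\<^sup>+x. \<psi> n x * indicator A x \<partial>\<eta>)"
    proof (rule nn_integral_cong)
      fix x
      have "Pair x -` W n A = (if x \<in> A then {u. 0 < u \<and> ennreal u \<le> \<psi> n x} else {})" by (auto simp: W_def)
      thus "emeasure lborel (Pair x -` W n A) = \<psi> n x * indicator A x" by (simp add: emeasure_lborel_positive_ray)
    qed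
    also have "\<dots> = emeasure (density \<eta> (\<psi> n)) A" by (rule emeasure_density[symmetric]) (use \<eta>(2) in auto)
    finally show ?thesis unfolding d\<psi> .
  qed
  have Wmono: "W m A \<subseteq> W n A" if "q m \<le> q n" for m n A
    unfolding W_def using \<psi>mono[OF that] order_trans by blast
  have below: "emeasure ?P (\<Union>n\<in>{n. q n < c}. W n A) = emeasure (\<theta> c) A" if c: "c \<in> I" and A: "A \<in> sets borel" for c A
  proof (cases "c = 0")
    case True
    have e: "{n. q n < c} = {}" using True nonneg[OF qI] by (auto simp: not_less)
    have "measure (\<theta> 0) A \<le> measure (\<theta> 0) UNIV"
    proof -
      interpret finite_real_measure "\<theta> 0" by (rule fin[OF zero_in])
      show ?thesis using finite_measure_mono[of A UNIV] by (simp add: sets_eq)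
    qed
    thus ?thesis unfolding e using True zero by (simp add: em\<theta>[OF zero_in] measure_le_0_iff)
  next
    case False
    hence c0: "0 < c" using nonneg[OF c] by simp
    obtain r where r: "incseq r" "\<And>k. r k \<in> \<rat>" "\<And>k. 0 \<le> r k" "\<And>k. r k < c" "r \<longlonglongrightarrow> c"
      using dyadic_from_below[OF c0] by metis
    have rI: "r k \<in> I" for k using down[OF c r(3)] r(4) less_imp_le by blast
    hence "\<exists>n. q n = r k" for k using r(2)[of k] q by (metis IntI imageE)
    then obtain m where m: "\<And>k. q (m k) = r k" by metis
    have eq: "(\<Union>n\<in>{n. q n < c}. W n A) = (\<Union>k. W (m k) A)"
    proof (intro equalityI UN_least)
      fix n assume "n \<in> {n. q n < c}"
      hence "q n < c" by simp
      from order_tendstoD(1)[OF r(5) this] obtain k where "q n < r k" by (auto simp: eventually_sequentially)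
      hence "W n A \<subseteq> W (m k) A" by (intro Wmono) (simp add: m)
      thus "W n A \<subseteq> (\<Union>k. W (m k) A)" by blast
    next
      fix k
      have "m k \<in> {n. q n < c}" using m[of k] r(4)[of k] by simp
      thus "W (m k) A \<subseteq> (\<Union>n\<in>{n. q n < c}. W n A)" by blast
    qed
    have inc': "incseq (\<lambda>k. W (m k) A)"
      using r(1) by (intro incseq_SucI Wmono) (simp add: m incseq_SucD)
    have "(\<lambda>k. emeasure ?P (W (m k) A)) \<longlonglongrightarrow> emeasure ?P (\<Union>k. W (m k) A)"
      by (rule Lim_emeasure_incseq[OF _ inc']) (use WS[OF A] in auto)
    moreover have "(\<lambda>k. emeasure ?P (W (m k) A)) \<longlonglongrightarrow> emeasure (\<theta> c) A"
    proof -
      have "(\<lambda>k. measure (\<theta> (r k)) A) \<longlonglongrightarrow> measure (\<theta> c) A"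
      proof (rule tendsto_sandwich)
        have "(\<lambda>k. V (r k)) \<longlonglongrightarrow> V c"
          using continuous_on_tendsto_compose[OF V_continuous r(5) c] rI by simp
        hence "(\<lambda>k. measure (\<theta> c) A - (V c - V (r k))) \<longlonglongrightarrow> measure (\<theta> c) A - (V c - V c)" by (intro tendsto_intros)
        thus "(\<lambda>k. measure (\<theta> c) A - (V c - V (r k))) \<longlonglongrightarrow> measure (\<theta> c) A" by simp
        show "eventually (\<lambda>k. measure (\<theta> c) A - (V c - V (r k)) \<le> measure (\<theta> (r k)) A) sequentially"
        proof (intro always_eventually allI)
          fix k show "measure (\<theta> c) A - (V c - V (r k)) \<le> measure (\<theta> (r k)) A"
            using inc[OF rI c less_imp_le[OF r(4)] A, of k] by linarith
        qed
        show "eventually (\<lambda>k. measure (\<theta> (r k)) A \<le> measure (\<theta> c) A) sequentially"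
          by (intro always_eventually allI mono rI c less_imp_le r(4) A)
      qed simp
      thus ?thesis unfolding emW[OF A] m em\<theta>[OF rI] em\<theta>[OF c] by (rule tendsto_ennrealI)
    qed
    ultimately show ?thesis unfolding eq by (rule LIMSEQ_unique)
  qed
  define Dom where "Dom = (\<Union>n. W n UNIV)"
  have DomS: "Dom \<in> sets ?P" unfolding Dom_def using WS[of UNIV] by auto
  define \<tau> where "\<tau> = (\<lambda>w. Inf {q n |n. w \<in> W n UNIV})"
  have \<tau>less: "\<tau> w < c \<longleftrightarrow> (\<exists>n. q n < c \<and> w \<in> W n UNIV)" if "w \<in> Dom" for w c
  proof -
    have "{q n |n. w \<in> W n UNIV} \<noteq> {}" using that by (auto simp: Dom_def)
    moreover have "bdd_below {q n |n. w \<in> W n UNIV}" by (intro bdd_belowI[of _ 0]) (use nonneg[OF qI] in auto)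
    ultimately show ?thesis unfolding \<tau>_def by (subst cInf_less_iff) auto
  qed
  have \<tau>I: "\<tau> w \<in> I" and \<tau>0: "0 \<le> \<tau> w" if w: "w \<in> Dom" for w
  proof -
    obtain n where n: "w \<in> W n UNIV" using w by (auto simp: Dom_def)
    show "0 \<le> \<tau> w" unfolding \<tau>_def using n nonneg[OF qI] by (intro cInf_greatest) auto
    moreover have "\<tau> w \<le> q n" unfolding \<tau>_def
      by (rule cInf_lower) (use n nonneg[OF qI] in \<open>auto intro!: bdd_belowI[of _ 0]\<close>)
    ultimately show "\<tau> w \<in> I" using down[OF qI] by blast
  qed
  let ?R = "restrict_space ?P Dom"
  have spR: "space ?R = Dom" by (simp add: space_restrict_space spP)
  have \<tau>m: "\<tau> \<in> borel_measurable ?R"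
  proof (rule borel_measurableI_less)
    fix c
    have "{w \<in> space ?R. \<tau> w < c} = (\<Union>n\<in>{n. q n < c}. W n UNIV)"
    proof (intro equalityI subsetI)
      fix w assume "w \<in> {w \<in> space ?R. \<tau> w < c}"
      hence "w \<in> Dom" "\<tau> w < c" by (auto simp: spR)
      thus "w \<in> (\<Union>n\<in>{n. q n < c}. W n UNIV)" using \<tau>less by blast
    next
      fix w assume "w \<in> (\<Union>n\<in>{n. q n < c}. W n UNIV)"
      then obtain n where n: "q n < c" "w \<in> W n UNIV" by blast
      hence "w \<in> Dom" unfolding Dom_def by blast
      thus "w \<in> {w \<in> space ?R. \<tau> w < c}" using n \<tau>less unfolding spR by blast
    qed
    moreover have "(\<Union>n\<in>{n. q n < c}. W n UNIV) \<in> sets ?R"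
      using WS[of UNIV] DomS by (subst sets_restrict_space_iff) (auto simp: spP Dom_def)
    ultimately show "{w \<in> space ?R. \<tau> w < c} \<in> sets ?R" by simp
  qed
  let ?B = "restrict_space borel ((UNIV::real set) \<times> I)"
  have fm: "(\<lambda>w. (fst w, \<tau> w)) \<in> measurable ?R ?B"
  proof (rule measurable_restrict_space2)
    show "(\<lambda>w. (fst w, \<tau> w)) \<in> space ?R \<rightarrow> UNIV \<times> I" unfolding spR using \<tau>I by auto
    have "fst \<in> measurable ?R \<eta>" by (rule measurable_restrict_space1) measurable
    hence "fst \<in> borel_measurable ?R" by (simp cong: measurable_cong_sets add: measurable_cong_sets[OF refl \<eta>(2)])
    thus "(\<lambda>w. (fst w, \<tau> w)) \<in> measurable ?R borel" unfolding borel_prod[symmetric] using \<tau>m by measurable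
  qed
  define \<Theta> where "\<Theta> = distr ?R ?B (\<lambda>w. (fst w, \<tau> w))"
  have sets\<Theta>: "sets \<Theta> = sets ?B" by (simp add: \<Theta>_def)
  have em\<Theta>: "emeasure \<Theta> X = emeasure ?P {w \<in> Dom. (fst w, \<tau> w) \<in> X}" if "X \<in> sets ?B" for X
  proof -
    have "emeasure \<Theta> X = emeasure ?R ((\<lambda>w. (fst w, \<tau> w)) -` X \<inter> space ?R)"
      unfolding \<Theta>_def by (rule emeasure_distr[OF fm that])
    also have "(\<lambda>w. (fst w, \<tau> w)) -` X \<inter> space ?R = {w \<in> Dom. (fst w, \<tau> w) \<in> X}" unfolding spR by auto
    also have "emeasure ?R \<dots> = emeasure ?P \<dots>"
      by (rule emeasure_restrict_space) (use DomS spP in auto)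
    finally show ?thesis .
  qed
  have open\<Theta>: "emeasure \<Theta> (A \<times> {0..<t}) = emeasure (\<theta> t) A" if t: "t \<in> I" and A: "A \<in> sets borel" for t A
  proof -
    have "{w \<in> Dom. (fst w, \<tau> w) \<in> A \<times> {0..<t}} = (\<Union>n\<in>{n. q n < t}. W n A)"
    proof (intro equalityI subsetI)
      fix w assume "w \<in> {w \<in> Dom. (fst w, \<tau> w) \<in> A \<times> {0..<t}}"
      hence w: "w \<in> Dom" "fst w \<in> A" "\<tau> w < t" by auto
      then obtain n where "q n < t" "w \<in> W n UNIV" using \<tau>less by blast
      thus "w \<in> (\<Union>n\<in>{n. q n < t}. W n A)" using w(2) by (auto simp: W_def)
    next
      fix w assume "w \<in> (\<Union>n\<in>{n. q n < t}. W n A)"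
      then obtain n where n: "q n < t" "w \<in> W n A" by blast
      hence "w \<in> W n UNIV" "fst w \<in> A" by (auto simp: W_def)
      moreover from this have "w \<in> Dom" by (auto simp: Dom_def)
      ultimately show "w \<in> {w \<in> Dom. (fst w, \<tau> w) \<in> A \<times> {0..<t}}" using \<tau>less[of w t] \<tau>0[of w] n(1) by auto
    qed
    moreover have "A \<times> {0..<t} \<in> sets ?B" by (rule slab_sets[OF t A])
    ultimately show ?thesis using em\<Theta> below[OF t A] by simp
  qed
  \<comment> \<open>Times slightly beyond \<open>t\<close> give the bound up to an arbitrarily small error. At the last time of \<open>I\<close> there are
    none, but then the slab is everything.\<close>
  have bound: "emeasure \<Theta> (UNIV \<times> {0..t}) \<le> emeasure (\<theta> t) UNIV" if t: "t \<in> I" for t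
  proof (cases "\<exists>T\<in>I. t < T")
    case True
    then obtain T where T: "T \<in> I" "t < T" by blast
    show ?thesis
    proof (rule ennreal_le_epsilon)
      fix e :: real assume e: "0 < e"
      have "(V \<longlongrightarrow> V t) (at t within I)" using V_continuous t by (auto simp: continuous_on_def)
      hence "eventually (\<lambda>s. V s < V t + e) (at t within I)" using e by (intro order_tendstoD) auto
      then obtain d where d: "0 < d" "\<And>s. s \<in> I \<Longrightarrow> s \<noteq> t \<Longrightarrow> dist s t < d \<Longrightarrow> V s < V t + e"
        unfolding eventually_at by blast
      define s where "s = min T (t + d / 2)"
      have s: "t < s" "s \<le> T" "dist s t < d" using d(1) T by (auto simp: s_def dist_real_def)
      have sI: "s \<in> I" using down[OF T(1)] s nonneg[OF t] by auto
      have "emeasure \<Theta> (UNIV \<times> {0..t}) \<le> emeasure \<Theta> (UNIV \<times> {0..<s})"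
        using s slab_sets[OF sI, of UNIV] by (intro emeasure_mono) (auto simp: sets\<Theta>)
      also have "\<dots> = ennreal (measure (\<theta> s) UNIV)" using open\<Theta>[OF sI] em\<theta>[OF sI] by simp
      also have "\<dots> \<le> ennreal (measure (\<theta> t) UNIV + e)"
        using inc[OF t sI less_imp_le[OF s(1)], of UNIV] d(2)[OF sI _ s(3)] s(1) by (intro ennreal_leI) auto
      also have "\<dots> = emeasure (\<theta> t) UNIV + ennreal e" using e by (simp add: em\<theta>[OF t] ennreal_plus)
      finally show "emeasure \<Theta> (UNIV \<times> {0..t}) \<le> emeasure (\<theta> t) UNIV + ennreal e" .
    qed
  next
    case False
    have "emeasure \<Theta> (UNIV \<times> {0..t}) \<le> emeasure ?P Dom"
      using em\<Theta>[OF slab_sets(2)[OF t, of UNIV]] DomS by (auto intro!: emeasure_mono)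
    also have "\<dots> \<le> emeasure (\<theta> t) UNIV"
    proof (cases "\<exists>n. q n = t")
      case True
      then obtain n where n: "q n = t" by blast
      have "q m \<le> q n" for m using False qI[of m] n by (auto simp: not_less)
      hence "Dom \<subseteq> W n UNIV" unfolding Dom_def using Wmono by blast
      hence "emeasure ?P Dom \<le> emeasure ?P (W n UNIV)" using WS[of UNIV] by (intro emeasure_mono) auto
      thus ?thesis using emW[of UNIV n] n by simp
    next
      case f: False
      have "q m < t" for m using False qI[of m] f by (metis linorder_neqE_linordered_idom)
      hence "Dom = (\<Union>n\<in>{n. q n < t}. W n UNIV)" unfolding Dom_def by auto
      thus ?thesis using below[OF t, of UNIV] by simp
    qed
    finally show ?thesis .
  qed
  \<comment> \<open>The open and the closed slab have the same finite mass.\<close>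
  have null: "emeasure \<Theta> (UNIV \<times> {t}) = 0" if t: "t \<in> I" for t
  proof -
    have "UNIV \<times> {0..t} = (UNIV \<times> {0..<t}) \<union> (UNIV :: real set) \<times> {t}" using nonneg[OF t] by auto
    moreover have "emeasure \<Theta> ((UNIV \<times> {0..<t}) \<union> (UNIV :: real set) \<times> {t}) = emeasure \<Theta> (UNIV \<times> {0..<t}) + emeasure \<Theta> (UNIV \<times> {t})"
      using slab_sets[OF t, of UNIV]
      by (intro plus_emeasure[symmetric]) (auto simp: sets\<Theta>)
    ultimately have "emeasure (\<theta> t) UNIV + emeasure \<Theta> (UNIV \<times> {t}) \<le> emeasure (\<theta> t) UNIV + 0"
      using bound[OF t] open\<Theta>[OF t, of UNIV] by simp
    thus ?thesis by (subst (asm) ennreal_add_left_cancel_le) (auto simp: em\<theta>[OF t])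
  qed
  have closed\<Theta>: "emeasure \<Theta> (A \<times> {0..t}) = emeasure (\<theta> t) A" if t: "t \<in> I" and A: "A \<in> sets borel" for t A
  proof -
    have "A \<times> {0..t} = (A \<times> {0..<t}) \<union> A \<times> {t}" using nonneg[OF t] by auto
    moreover have "emeasure \<Theta> ((A \<times> {0..<t}) \<union> A \<times> {t}) = emeasure \<Theta> (A \<times> {0..<t}) + emeasure \<Theta> (A \<times> {t})"
      using slab_sets[OF t A]
      by (intro plus_emeasure[symmetric]) (auto simp: sets\<Theta>)
    moreover have "emeasure \<Theta> (A \<times> {t}) \<le> emeasure \<Theta> (UNIV \<times> {t})"
      using slab_sets[OF t, of UNIV] by (intro emeasure_mono) (auto simp: sets\<Theta>)
    ultimately show ?thesis using null[OF t] open\<Theta>[OF t A] by simp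
  qed
  show ?thesis by (rule that[OF sets\<Theta> null closed\<Theta>])
qed

end

section \<open>Integration against complex measures on an interval\<close>

text \<open>Boundedness is assumed so that the positive variation can be computed with real suprema and is finite.\<close>

locale bounded_signed_measure =
  fixes T :: real and \<nu> :: "real set \<Rightarrow> real" and K :: real
  assumes countably_additive: "\<And>B :: nat \<Rightarrow> real set. range B \<subseteq> sets (restrict_space borel {0..T}) \<Longrightarrow>
      disjoint_family B \<Longrightarrow> (\<lambda>n. \<nu> (B n)) sums \<nu> (\<Union>n. B n)"
    and bounded: "\<And>B. B \<in> sets (restrict_space borel {0..T}) \<Longrightarrow> \<bar>\<nu> B\<bar> \<le> K"
begin

abbreviation "M \<equiv> restrict_space (borel :: real measure) {0..T}"

lemma negated: "bounded_signed_measure T (\<lambda>B. - \<nu> B) K"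
  by unfold_locales (use sums_minus[OF countably_additive] bounded in auto)

lemma empty: "\<nu> {} = 0"
proof -
  have "(\<lambda>n::nat. \<nu> {}) sums \<nu> (\<Union>n::nat. {})"
    by (rule countably_additive) (auto simp: disjoint_family_on_def)
  hence "(\<lambda>n::nat. \<nu> {}) \<longlonglongrightarrow> 0" by (intro summable_LIMSEQ_zero sums_summable)
  thus ?thesis by (simp add: LIMSEQ_const_iff)
qed

lemma union:
  assumes "A \<in> sets M" "B \<in> sets M" "A \<inter> B = {}"
  shows "\<nu> (A \<union> B) = \<nu> A + \<nu> B"
proof -
  let ?C = "\<lambda>n::nat. if n = 0 then A else if n = 1 then B else {}"
  have "(\<lambda>n. \<nu> (?C n)) sums \<nu> (\<Union>n. ?C n)"
    by (rule countably_additive) (use assms in \<open>auto simp: disjoint_family_on_def\<close>)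
  moreover have "(\<Union>n. ?C n) = A \<union> B" by (auto split: if_splits)
  moreover have "(\<lambda>n. \<nu> (?C n)) sums (\<Sum>n\<in>{0, 1}. \<nu> (?C n))"
    by (rule sums_finite) (auto simp: empty)
  ultimately show ?thesis using sums_unique2 by fastforce
qed

text \<open>The real-valued positive variation.\<close>

definition upper :: "real set \<Rightarrow> real" where
  "upper A = (SUP B\<in>{B \<in> sets M. B \<subseteq> A}. \<nu> B)"

lemma bdd: "bdd_above (\<nu> ` {B \<in> sets M. B \<subseteq> A})"
  by (rule bdd_aboveI[of _ K]) (use bounded in force)

lemma upper_ge: "B \<in> sets M \<Longrightarrow> B \<subseteq> A \<Longrightarrow> \<nu> B \<le> upper A"
  unfolding upper_def by (intro cSUP_upper bdd) auto

lemma upper_le: "(\<And>B. B \<in> sets M \<Longrightarrow> B \<subseteq> A \<Longrightarrow> \<nu> B \<le> c) \<Longrightarrow> upper A \<le> c"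
  unfolding upper_def by (intro cSUP_least) auto

lemma upper_nonneg: "0 \<le> upper A"
  using upper_ge[of "{}" A] by (simp add: empty)

lemma upper_mono: "A \<subseteq> B \<Longrightarrow> upper A \<le> upper B"
  by (rule upper_le, rule upper_ge) auto

lemma upper_superadditive:
  assumes "A \<inter> B = {}"
  shows "upper A + upper B \<le> upper (A \<union> B)"
proof -
  have 1: "\<nu> A' + \<nu> B' \<le> upper (A \<union> B)" if "A' \<in> sets M" "A' \<subseteq> A" "B' \<in> sets M" "B' \<subseteq> B" for A' B'
  proof -
    have "A' \<inter> B' = {}" using that assms by blast
    from union[OF that(1,3) this] show ?thesis using that upper_ge[of "A' \<union> B'" "A \<union> B"] by auto
  qed
  have 2: "upper A \<le> upper (A \<union> B) - \<nu> B'" if "B' \<in> sets M" "B' \<subseteq> B" for B'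
    by (rule upper_le) (use 1 that in \<open>force simp: le_diff_eq\<close>)
  have "upper B \<le> upper (A \<union> B) - upper A"
    by (rule upper_le) (use 2 in \<open>force simp: le_diff_eq add.commute\<close>)
  thus ?thesis by simp
qed

lemma SUP_eq_upper: "(SUP B\<in>{B \<in> sets M. B \<subseteq> A}. ennreal (\<nu> B)) = ennreal (upper A)"
proof (rule antisym)
  show "(SUP B\<in>{B \<in> sets M. B \<subseteq> A}. ennreal (\<nu> B)) \<le> ennreal (upper A)"
    by (rule SUP_least) (auto intro!: ennreal_leI upper_ge)
  show "ennreal (upper A) \<le> (SUP B\<in>{B \<in> sets M. B \<subseteq> A}. ennreal (\<nu> B))" (is "_ \<le> ?s")
  proof (cases ?s)
    case (real r)
    have "upper A \<le> r"
    proof (rule upper_le)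
      fix B assume "B \<in> sets M" "B \<subseteq> A"
      hence "ennreal (\<nu> B) \<le> ennreal r" unfolding real(2)[symmetric] by (intro SUP_upper) auto
      thus "\<nu> B \<le> r" using real(1) by (simp add: ennreal_le_iff)
    qed
    thus ?thesis unfolding real(2) by (rule ennreal_leI)
  next
    case top thus ?thesis by (simp only: top_greatest)
  qed
qed

text \<open>Countable additivity of the upper variation: superadditivity gives one inequality; for the other, a
  subset of the union is cut along the \<open>A i\<close>.\<close>

lemma emeasure_positive_variation:
  assumes "A \<in> sets M" shows "emeasure (positive_variation {0..T} \<nu>) A = ennreal (upper A)"
  unfolding positive_variation_def SUP_eq_upper
proof (rule emeasure_measure_of[OF refl])
  show "sets M \<subseteq> Pow {0..T}" using sets.sets_into_space[of _ M] by (auto simp: space_restrict_space)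
  have sg: "sigma_sets {0..T} (sets M) = sets M"
    using sets.sigma_sets_eq[of M] by (simp add: space_restrict_space)
  show "A \<in> sets (measure_of {0..T} (sets M) (\<lambda>A. ennreal (upper A)))"
    using assms \<open>sets M \<subseteq> Pow {0..T}\<close> by (simp add: sets_measure_of sg)
  show "positive (sets (measure_of {0..T} (sets M) (\<lambda>A. ennreal (upper A)))) (\<lambda>A. ennreal (upper A))"
  proof -
    have "upper {} \<le> 0" by (rule upper_le) (simp add: empty)
    thus ?thesis by (simp add: positive_def ennreal_neg)
  qed
  show "countably_additive (sets (measure_of {0..T} (sets M) (\<lambda>A. ennreal (upper A)))) (\<lambda>A. ennreal (upper A))"
    unfolding sets_measure_of[OF \<open>sets M \<subseteq> Pow {0..T}\<close>] sg
  proof (rule countably_additiveI)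
    fix A :: "nat \<Rightarrow> real set" assume A: "range A \<subseteq> sets M" "disjoint_family A"
    have fin: "(\<Sum>i<n. upper (A i)) \<le> upper (\<Union>i<n. A i)" for n
    proof (induction n)
      case (Suc n)
      have "A i \<inter> A n = {}" if "i < n" for i using that by (intro disjoint_family_onD[OF A(2)]) auto
      hence "(\<Union>i<n. A i) \<inter> A n = {}" by auto
      from upper_superadditive[OF this] Suc show ?case by (simp add: lessThan_Suc Un_commute)
    qed (simp add: upper_nonneg)
    have le1: "(\<Sum>i<n. upper (A i)) \<le> upper (\<Union>i. A i)" for n
      using fin[of n] upper_mono[of "\<Union>i<n. A i" "\<Union>i. A i"] by fastforce
    have sm: "summable (\<lambda>i. upper (A i))"
      by (rule bounded_imp_summable[of _ "upper (\<Union>i. A i)"]) (use upper_nonneg le1 lessThan_Suc_atMost in metis)+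
    have "upper (\<Union>i. A i) \<le> (\<Sum>i. upper (A i))"
    proof (rule upper_le)
      fix B assume B: "B \<in> sets M" "B \<subseteq> (\<Union>i. A i)"
      have "(\<lambda>i. \<nu> (B \<inter> A i)) sums \<nu> (\<Union>i. B \<inter> A i)"
        by (rule countably_additive) (use A B in \<open>auto simp: disjoint_family_on_def\<close>)
      moreover have "(\<Union>i. B \<inter> A i) = B" using B by auto
      ultimately have s: "(\<lambda>i. \<nu> (B \<inter> A i)) sums \<nu> B" by simp
      have le: "\<nu> (B \<inter> A i) \<le> upper (A i)" for i using A B by (intro upper_ge) auto
      show "\<nu> B \<le> (\<Sum>i. upper (A i))" by (rule sums_le[OF le s summable_sums[OF sm]])
    qed
    moreover have "(\<Sum>i. upper (A i)) \<le> upper (\<Union>i. A i)" by (rule suminf_le_const[OF sm le1])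
    ultimately have "(\<Sum>i. upper (A i)) = upper (\<Union>i. A i)" by (rule antisym[rotated])
    thus "(\<Sum>i. ennreal (upper (A i))) = ennreal (upper (\<Union>i. A i))"
      using suminf_ennreal2[OF upper_nonneg sm] by simp
  qed
qed

lemma sets_positive_variation: "sets (positive_variation {0..T} \<nu>) = sets M"
proof -
  have "sets M \<subseteq> Pow {0..T}" using sets.sets_into_space[of _ M] by (auto simp: space_restrict_space)
  thus ?thesis unfolding positive_variation_def
    using sets.sigma_sets_eq[of M] by (simp add: space_restrict_space sets_measure_of)
qed

lemma space_positive_variation: "space (positive_variation {0..T} \<nu>) = {0..T}"
  using sets_eq_imp_space_eq[OF sets_positive_variation] by (simp add: space_restrict_space)

lemma finite_positive_variation: "finite_measure (positive_variation {0..T} \<nu>)"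
proof (rule finite_measureI)
  have "{0..T} \<in> sets M" using sets.top[of M] by (simp add: space_restrict_space)
  thus "emeasure (positive_variation {0..T} \<nu>) (space (positive_variation {0..T} \<nu>)) \<noteq> \<infinity>"
    unfolding space_positive_variation by (simp add: emeasure_positive_variation)
qed

lemma measure_positive_variation: "A \<in> sets M \<Longrightarrow> measure (positive_variation {0..T} \<nu>) A = upper A"
  using upper_nonneg by (simp add: measure_def emeasure_positive_variation)

text \<open>Complementing within \<open>A\<close> turns the supremum of \<open>- \<nu>\<close> into that of \<open>\<nu>\<close>, shifted by \<open>\<nu> A\<close>.\<close>

lemma jordan:
  assumes A: "A \<in> sets M"
  shows "\<nu> A = measure (positive_variation {0..T} \<nu>) A - measure (positive_variation {0..T} (\<lambda>B. - \<nu> B)) A"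
proof -
  interpret neg: bounded_signed_measure T "\<lambda>B. - \<nu> B" K by (rule negated)
  have split: "\<nu> (A - B) = \<nu> A - \<nu> B" if "B \<in> sets M" "B \<subseteq> A" for B
  proof -
    have "\<nu> (B \<union> (A - B)) = \<nu> B + \<nu> (A - B)" using that A by (intro union) auto
    moreover have "B \<union> (A - B) = A" using that by auto
    ultimately show ?thesis by simp
  qed
  have "neg.upper A \<le> upper A - \<nu> A"
  proof (rule neg.upper_le)
    fix B assume B: "B \<in> sets M" "B \<subseteq> A"
    have "\<nu> (A - B) \<le> upper A" using A B by (intro upper_ge) auto
    thus "- \<nu> B \<le> upper A - \<nu> A" using split[OF B] by simp
  qed
  moreover have "upper A \<le> neg.upper A + \<nu> A"
  proof (rule upper_le)
    fix B assume B: "B \<in> sets M" "B \<subseteq> A"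
    have "- \<nu> (A - B) \<le> neg.upper A" using A B by (intro neg.upper_ge) auto
    thus "\<nu> B \<le> neg.upper A + \<nu> A" using split[OF B] by simp
  qed
  ultimately show ?thesis using A by (simp add: measure_positive_variation neg.measure_positive_variation)
qed

lemma sets_M_iff: "B \<in> sets M \<longleftrightarrow> B \<in> sets borel \<and> B \<subseteq> {0..T}"
  by (subst sets_restrict_space_iff) auto

lemma restricted:
  assumes t: "0 \<le> t" "t \<le> T"
  shows "bounded_signed_measure t \<nu> K"
proof -
  have sub: "B \<in> sets M" if "B \<in> sets (restrict_space borel {0..t})" for B
    using that t by (subst (asm) sets_restrict_space_iff) (auto simp: sets_M_iff)
  show ?thesis by unfold_locales (use sub countably_additive bounded in \<open>auto simp: image_subset_iff\<close>)
qed

text \<open>Integrals over \<open>[0,t]\<close> for different \<open>t\<close> involve different measures by definition; this makes them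
  integrals against one measure.\<close>

lemma integral_positive_variation:
  fixes g :: "real \<Rightarrow> complex"
  assumes t: "0 \<le> t" "t \<le> T"
  shows "(\<integral>x. g x \<partial>positive_variation {0..t} \<nu>) = (\<integral>x. indicator {0..t} x *\<^sub>R g x \<partial>positive_variation {0..T} \<nu>)"
proof -
  interpret r: bounded_signed_measure t \<nu> K by (rule restricted[OF t])
  let ?N = "positive_variation {0..T} \<nu>"
  have tM: "{0..t} \<in> sets ?N" unfolding sets_positive_variation sets_M_iff using t by auto
  have sp: "{0..t} \<inter> space ?N \<in> sets ?N" using tM sets.Int_space_eq2[OF tM] by simp
  have "positive_variation {0..t} \<nu> = restrict_space ?N {0..t}"
  proof (rule measure_eqI)
    show s: "sets (positive_variation {0..t} \<nu>) = sets (restrict_space ?N {0..t})"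
      unfolding r.sets_positive_variation
    proof (intro set_eqI)
      fix B
      show "B \<in> sets r.M \<longleftrightarrow> B \<in> sets (restrict_space ?N {0..t})"
        unfolding r.sets_M_iff sets_restrict_space_iff[OF sp] sets_positive_variation sets_M_iff using t by auto
    qed
    fix A assume "A \<in> sets (positive_variation {0..t} \<nu>)"
    hence A: "A \<in> sets borel" "A \<subseteq> {0..t}" unfolding r.sets_positive_variation r.sets_M_iff by auto
    have "{B \<in> sets r.M. B \<subseteq> A} = {B \<in> sets M. B \<subseteq> A}"
      unfolding r.sets_M_iff sets_M_iff using A t by auto
    hence "r.upper A = upper A" unfolding r.upper_def upper_def by simp
    moreover have "A \<in> sets r.M" "A \<in> sets M" unfolding r.sets_M_iff sets_M_iff using A t by auto
    ultimately show "emeasure (positive_variation {0..t} \<nu>) A = emeasure (restrict_space ?N {0..t}) A"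
      using A by (simp add: r.emeasure_positive_variation emeasure_positive_variation emeasure_restrict_space[OF sp])
  qed
  thus ?thesis using integral_restrict_space[OF sp, of g] by simp
qed

lemma positive_part_increment:
  fixes g :: "real \<Rightarrow> complex"
  assumes g: "continuous_on {0..T} g" and uv: "0 \<le> u" "u \<le> v" "v \<le> T"
    and e: "\<And>r. r \<in> {u<..v} \<Longrightarrow> norm (g r - c) \<le> e"
  shows "norm ((\<integral>x. g x \<partial>positive_variation {0..v} \<nu>) - (\<integral>x. g x \<partial>positive_variation {0..u} \<nu>)
      - c * of_real (measure (positive_variation {0..T} \<nu>) {u<..v})) \<le> e * measure (positive_variation {0..T} \<nu>) {u<..v}"
proof -
  let ?N = "positive_variation {0..T} \<nu>"
  interpret finite_measure ?N by (rule finite_positive_variation)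
  have Sm: "{u<..v} \<in> sets ?N" "{0..u} \<in> sets ?N" "{0..v} \<in> sets ?N" unfolding sets_positive_variation sets_M_iff using uv by auto
  have gm: "g \<in> borel_measurable ?N"
    unfolding measurable_cong_sets[OF sets_positive_variation refl]
    by (rule borel_measurable_continuous_on_restrict[OF g])
  obtain Bd where Bd: "\<And>x. x \<in> {0..T} \<Longrightarrow> norm (g x) \<le> Bd"
    using compact_imp_bounded[OF compact_continuous_image[OF g compact_Icc]] unfolding bounded_iff by blast
  have int: "integrable ?N g"
    by (rule integrable_const_bound[of _ Bd]) (use Bd gm space_positive_variation in \<open>auto intro!: AE_I2\<close>)
  have ints: "integrable ?N (\<lambda>x. indicator A x *\<^sub>R g x)" if "A \<in> sets ?N" for A
    using integrable_mult_indicator[OF that int] .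
  have r: "(\<integral>x. g x \<partial>positive_variation {0..t} \<nu>) = (\<integral>x. indicator {0..t} x *\<^sub>R g x \<partial>?N)"
    if "t \<in> {u, v}" for t using that uv by (intro integral_positive_variation) auto
  have "(\<integral>x. g x \<partial>positive_variation {0..v} \<nu>) - (\<integral>x. g x \<partial>positive_variation {0..u} \<nu>)
      = (\<integral>x. indicator {0..v} x *\<^sub>R g x \<partial>?N) - (\<integral>x. indicator {0..u} x *\<^sub>R g x \<partial>?N)"
    using r[of u] r[of v] by (simp only: insert_iff simp_thms)
  also have "\<dots> = (\<integral>x. indicator {0..v} x *\<^sub>R g x - indicator {0..u} x *\<^sub>R g x \<partial>?N)"
    by (rule Bochner_Integration.integral_diff[OF ints[OF Sm(3)] ints[OF Sm(2)], symmetric])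
  also have "\<dots> = (\<integral>x. indicator {u<..v} x *\<^sub>R g x \<partial>?N)"
    using uv by (intro Bochner_Integration.integral_cong) (auto split: split_indicator)
  finally have 1: "(\<integral>x. g x \<partial>positive_variation {0..v} \<nu>) - (\<integral>x. g x \<partial>positive_variation {0..u} \<nu>) = (\<integral>x. indicator {u<..v} x *\<^sub>R g x \<partial>?N)" .
  have ic: "integrable ?N (\<lambda>x. indicator {u<..v} x *\<^sub>R c)"
    using integrable_mult_indicator[OF Sm(1), of "\<lambda>_. c"] by simp
  have "(\<integral>x. indicator {u<..v} x *\<^sub>R c \<partial>?N) = c * of_real (measure ?N {u<..v})"
    using Sm(1) sets.Int_space_eq2[OF Sm(1)] by (simp add: scaleR_conv_of_real mult.commute)
  hence 2: "(\<integral>x. indicator {u<..v} x *\<^sub>R g x \<partial>?N) - c * of_real (measure ?N {u<..v}) = (\<integral>x. indicator {u<..v} x *\<^sub>R g x - indicator {u<..v} x *\<^sub>R c \<partial>?N)"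
    using Bochner_Integration.integral_diff[OF ints[OF Sm(1)] ic] by (simp only:)
  have "norm (\<integral>x. indicator {u<..v} x *\<^sub>R g x - indicator {u<..v} x *\<^sub>R c \<partial>?N) \<le> (\<integral>x. e * indicator {u<..v} x \<partial>?N)"
  proof (rule Bochner_Integration.integral_norm_bound_integral)
    show "integrable ?N (\<lambda>x. indicator {u<..v} x *\<^sub>R g x - indicator {u<..v} x *\<^sub>R c)"
      using ints[OF Sm(1)] ic by (rule Bochner_Integration.integrable_diff)
    show "integrable ?N (\<lambda>x. e * indicat_real {u<..v} x)" using Sm(1) by (intro integrable_mult_right) (auto simp: emeasure_eq_measure)
    show "norm (indicator {u<..v} x *\<^sub>R g x - indicator {u<..v} x *\<^sub>R c) \<le> e * indicat_real {u<..v} x" for x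
      using e[of x] by (auto split: split_indicator)
  qed
  also have "\<dots> = e * measure ?N {u<..v}" using Sm(1) sets.Int_space_eq2[OF Sm(1)] by simp
  finally show ?thesis unfolding 1 2 .
qed

text \<open>On a short interval the integral is the value \<open>c\<close> times the measure of the interval, up to the
  oscillation of \<open>g\<close>. The total variation enters through its distribution function \<open>\<kappa>\<close>, which is the same for all \<open>g\<close>.\<close>

lemma signed_integral_increment:
  fixes g :: "real \<Rightarrow> complex"
  obtains \<kappa> where
    "\<And>g u v c e. continuous_on {0..T} g \<Longrightarrow> 0 \<le> u \<Longrightarrow> u \<le> v \<Longrightarrow> v \<le> T \<Longrightarrow> (\<And>r. r \<in> {u<..v} \<Longrightarrow> norm (g r - c) \<le> e) \<Longrightarrow>
      norm (signed_integral {0..v} \<nu> g - signed_integral {0..u} \<nu> g - c * of_real (\<nu> {u<..v})) \<le> e * (\<kappa> v - \<kappa> u)"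
proof
  interpret neg: bounded_signed_measure T "\<lambda>B. - \<nu> B" K by (rule negated)
  let ?p = "positive_variation {0..T} \<nu>" and ?n = "positive_variation {0..T} (\<lambda>B. - \<nu> B)"
  interpret p: finite_measure ?p by (rule finite_positive_variation)
  interpret n: finite_measure ?n by (rule neg.finite_positive_variation)
  fix g :: "real \<Rightarrow> complex" and u v c e
  assume a: "continuous_on {0..T} g" "0 \<le> u" "u \<le> v" "v \<le> T" "\<And>r. r \<in> {u<..v} \<Longrightarrow> norm (g r - c) \<le> e"
  let ?m = "\<lambda>N. measure N {u<..v}"
  have Sm: "{u<..v} \<in> sets M" "{0..u} \<in> sets M" "{0..v} \<in> sets M" unfolding sets_M_iff using a by auto
  have d: "measure N {0..v} - measure N {0..u} = ?m N" if "finite_measure N" "sets N = sets M" for N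
  proof -
    interpret finite_measure N by fact
    have "measure N ({0..v} - {0..u}) = measure N {0..v} - measure N {0..u}"
      using Sm that a by (intro finite_measure_Diff) auto
    moreover have "{0..v} - {0..u} = {u<..v}" using a by auto
    ultimately show ?thesis by simp
  qed
  have j: "c * of_real (\<nu> {u<..v}) = c * of_real (?m ?p) - c * of_real (?m ?n)"
    unfolding jordan[OF Sm(1)] by (simp add: right_diff_distrib)
  have "norm (signed_integral {0..v} \<nu> g - signed_integral {0..u} \<nu> g - c * of_real (\<nu> {u<..v})) \<le> e * ?m ?p + e * ?m ?n"
    unfolding signed_integral_def j
    using norm_triangle_le_diff[OF add_mono[OF positive_part_increment[OF a] neg.positive_part_increment[OF a]]]
    by (simp add: algebra_simps)
  also have "\<dots> = e * ((measure ?p {0..v} + measure ?n {0..v}) - (measure ?p {0..u} + measure ?n {0..u}))"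
    using d[OF p.finite_measure_axioms sets_positive_variation] d[OF n.finite_measure_axioms neg.sets_positive_variation]
    by (simp add: algebra_simps)
  finally show "norm (signed_integral {0..v} \<nu> g - signed_integral {0..u} \<nu> g - c * of_real (\<nu> {u<..v}))
     \<le> e * ((\<lambda>t. measure ?p {0..t} + measure ?n {0..t}) v - (\<lambda>t. measure ?p {0..t} + measure ?n {0..t}) u)" by simp
qed

lemma signed_integral_zero:
  assumes T: "0 \<le> T" and n: "\<nu> {0} = 0"
  shows "signed_integral {0..0} \<nu> g = 0"
proof -
  have *: "(\<integral>x. g x \<partial>positive_variation {0..0} \<mu>) = 0" if "bounded_signed_measure T \<mu> K" "\<mu> {0} = 0" for \<mu>
  proof -
    interpret m: bounded_signed_measure T \<mu> K by fact
    interpret m0: bounded_signed_measure 0 \<mu> K by (rule m.restricted) (use T in auto)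
    have s: "{0} \<in> sets m0.M" unfolding m0.sets_M_iff by auto
    have "m0.upper {0} \<le> 0"
    proof (rule m0.upper_le)
      fix B :: "real set" assume "B \<subseteq> {0}"
      hence "B = {} \<or> B = {0}" by auto
      thus "\<mu> B \<le> 0" using that(2) m.empty by auto
    qed
    hence "emeasure (positive_variation {0..0} \<mu>) {0} = 0"
      using m0.emeasure_positive_variation[OF s] by (simp add: ennreal_neg)
    hence "AE x in positive_variation {0..0} \<mu>. False"
      using m0.space_positive_variation m0.sets_positive_variation s by (intro AE_I[of _ _ "{0}"]) auto
    hence "AE x in positive_variation {0..0} \<mu>. g x = 0" by (rule AE_mp) auto
    thus ?thesis by (rule integral_eq_zero_AE)
  qed
  show ?thesis unfolding signed_integral_def
    using *[OF bounded_signed_measure_axioms n] *[OF negated] n by simp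
qed

end

locale bounded_complex_measure =
  fixes T :: real and \<nu> :: "real set \<Rightarrow> complex" and K :: real
  assumes T: "0 \<le> T" and countably_additive: "\<And>B :: nat \<Rightarrow> real set. range B \<subseteq> sets (restrict_space borel {0..T}) \<Longrightarrow>
      disjoint_family B \<Longrightarrow> (\<lambda>n. \<nu> (B n)) sums \<nu> (\<Union>n. B n)"
    and bounded: "\<And>B. B \<in> sets (restrict_space borel {0..T}) \<Longrightarrow> norm (\<nu> B) \<le> K"
    and null_zero: "\<nu> {0} = 0"
begin

sublocale Re: bounded_signed_measure T "\<lambda>B. Re (\<nu> B)" K
  by unfold_locales (use sums_Re[OF countably_additive] order_trans[OF abs_Re_le_cmod bounded] in auto)

sublocale Im: bounded_signed_measure T "\<lambda>B. Im (\<nu> B)" K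
  by unfold_locales (use sums_Im[OF countably_additive] order_trans[OF abs_Im_le_cmod bounded] in auto)

lemma complex_integral_increment:
  obtains \<kappa> where
    "\<And>g u v c e. continuous_on {0..T} g \<Longrightarrow> 0 \<le> u \<Longrightarrow> u \<le> v \<Longrightarrow> v \<le> T \<Longrightarrow> (\<And>r. r \<in> {u<..v} \<Longrightarrow> norm (g r - c) \<le> e) \<Longrightarrow>
      norm (complex_measure_integral {0..v} \<nu> g - complex_measure_integral {0..u} \<nu> g - c * \<nu> {u<..v}) \<le> e * (\<kappa> v - \<kappa> u)"
proof -
  obtain \<kappa>1 where k1: "\<And>g u v c e. continuous_on {0..T} g \<Longrightarrow> 0 \<le> u \<Longrightarrow> u \<le> v \<Longrightarrow> v \<le> T \<Longrightarrow> (\<And>r. r \<in> {u<..v} \<Longrightarrow> norm (g r - c) \<le> e) \<Longrightarrow>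
      norm (signed_integral {0..v} (\<lambda>B. Re (\<nu> B)) g - signed_integral {0..u} (\<lambda>B. Re (\<nu> B)) g - c * of_real (Re (\<nu> {u<..v}))) \<le> e * (\<kappa>1 v - \<kappa>1 u)"
    using Re.signed_integral_increment by metis
  obtain \<kappa>2 where k2: "\<And>g u v c e. continuous_on {0..T} g \<Longrightarrow> 0 \<le> u \<Longrightarrow> u \<le> v \<Longrightarrow> v \<le> T \<Longrightarrow> (\<And>r. r \<in> {u<..v} \<Longrightarrow> norm (g r - c) \<le> e) \<Longrightarrow>
      norm (signed_integral {0..v} (\<lambda>B. Im (\<nu> B)) g - signed_integral {0..u} (\<lambda>B. Im (\<nu> B)) g - c * of_real (Im (\<nu> {u<..v}))) \<le> e * (\<kappa>2 v - \<kappa>2 u)"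
    using Im.signed_integral_increment by metis
  show ?thesis
  proof
    fix g :: "real \<Rightarrow> complex" and u v c e
    assume a: "continuous_on {0..T} g" "0 \<le> u" "u \<le> v" "v \<le> T" "\<And>r. r \<in> {u<..v} \<Longrightarrow> norm (g r - c) \<le> e"
    let ?R = "signed_integral {0..v} (\<lambda>B. Re (\<nu> B)) g - signed_integral {0..u} (\<lambda>B. Re (\<nu> B)) g - c * of_real (Re (\<nu> {u<..v}))"
    let ?J = "signed_integral {0..v} (\<lambda>B. Im (\<nu> B)) g - signed_integral {0..u} (\<lambda>B. Im (\<nu> B)) g - c * of_real (Im (\<nu> {u<..v}))"
    have "complex_measure_integral {0..v} \<nu> g - complex_measure_integral {0..u} \<nu> g - c * \<nu> {u<..v} = ?R + \<i> * ?J"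
      unfolding complex_measure_integral_def by (subst (13) complex_eq) (simp add: algebra_simps)
    also have "norm \<dots> \<le> e * (\<kappa>1 v - \<kappa>1 u) + e * (\<kappa>2 v - \<kappa>2 u)"
      using k1[OF a] k2[OF a] by (intro norm_triangle_le add_mono) (auto simp: norm_mult)
    finally show "norm (complex_measure_integral {0..v} \<nu> g - complex_measure_integral {0..u} \<nu> g - c * \<nu> {u<..v})
       \<le> e * ((\<lambda>t. \<kappa>1 t + \<kappa>2 t) v - (\<lambda>t. \<kappa>1 t + \<kappa>2 t) u)" by (simp add: algebra_simps)
  qed
qed

lemma complex_integral_zero: "complex_measure_integral {0..0} \<nu> g = 0"
  unfolding complex_measure_integral_def using null_zero T
  by (simp add: Re.signed_integral_zero[simplified] Im.signed_integral_zero[simplified])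

lemma initial_increment:
  assumes "0 \<le> u" "u \<le> v" "v \<le> T"
  shows "\<nu> {0..v} - \<nu> {0..u} = \<nu> {u<..v}"
proof -
  have s: "{0..u} \<in> sets Re.M" "{u<..v} \<in> sets Re.M" unfolding Re.sets_M_iff using assms by auto
  have "{0..v} = {0..u} \<union> {u<..v}" using assms by auto
  moreover have "\<nu> ({0..u} \<union> {u<..v}) = \<nu> {0..u} + \<nu> {u<..v}"
  proof -
    have "{0..u} \<inter> {u<..v} = {}" by auto
    from Re.union[OF s this] Im.union[OF s this] show ?thesis by (simp add: complex_eq_iff)
  qed
  ultimately show ?thesis by simp
qed

end

lemma uniform_small_oscillation:
  fixes g :: "real \<Rightarrow> complex"
  assumes "continuous_on {0..T} g" "0 < e"
  obtains d where "0 < d" "\<And>u v. 0 \<le> u \<Longrightarrow> u \<le> T \<Longrightarrow> 0 \<le> v \<Longrightarrow> v \<le> T \<Longrightarrow> \<bar>v - u\<bar> < d \<Longrightarrow> norm (g v - g u) \<le> e"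
proof -
  have "uniformly_continuous_on {0..T} g" using compact_uniformly_continuous[OF assms(1)] by simp
  then obtain d where "0 < d" "\<And>x x'. x \<in> {0..T} \<Longrightarrow> x' \<in> {0..T} \<Longrightarrow> dist x' x < d \<Longrightarrow> dist (g x') (g x) < e"
    using assms(2) unfolding uniformly_continuous_on_def by metis
  thus ?thesis by (intro that[of d]) (auto simp: dist_norm less_imp_le)
qed

text \<open>On short intervals the integrals are \<open>g v\<close> times the two measures, up to small errors. As \<open>|g|\<close>
  is bounded below, the difference of the distribution functions has small increments and vanishes. Dynkin's
  lemma extends the equality from the intervals \<open>[0,t]\<close> to Borel sets.\<close>

theorem complex_measure_determined_by_integrals:
  assumes "bounded_complex_measure T \<nu>1 K1" "bounded_complex_measure T \<nu>2 K2"
    and g: "continuous_on {0..T} g" "\<And>t. t \<in> {0..T} \<Longrightarrow> g t \<noteq> 0"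
    and eq: "\<And>t. t \<in> {0..T} \<Longrightarrow> complex_measure_integral {0..t} \<nu>1 g = complex_measure_integral {0..t} \<nu>2 g"
    and B: "B \<in> sets (restrict_space borel {0..T})"
  shows "\<nu>1 B = \<nu>2 B"
proof -
  interpret n1: bounded_complex_measure T \<nu>1 K1 by fact
  interpret n2: bounded_complex_measure T \<nu>2 K2 by fact
  let ?M = "restrict_space borel {0..T}"
  obtain \<kappa>1 where k1: "\<And>g u v c e. continuous_on {0..T} g \<Longrightarrow> 0 \<le> u \<Longrightarrow> u \<le> v \<Longrightarrow> v \<le> T \<Longrightarrow> (\<And>r. r \<in> {u<..v} \<Longrightarrow> norm (g r - c) \<le> e) \<Longrightarrow>
      norm (complex_measure_integral {0..v} \<nu>1 g - complex_measure_integral {0..u} \<nu>1 g - c * \<nu>1 {u<..v}) \<le> e * (\<kappa>1 v - \<kappa>1 u)"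
    using n1.complex_integral_increment by metis
  obtain \<kappa>2 where k2: "\<And>g u v c e. continuous_on {0..T} g \<Longrightarrow> 0 \<le> u \<Longrightarrow> u \<le> v \<Longrightarrow> v \<le> T \<Longrightarrow> (\<And>r. r \<in> {u<..v} \<Longrightarrow> norm (g r - c) \<le> e) \<Longrightarrow>
      norm (complex_measure_integral {0..v} \<nu>2 g - complex_measure_integral {0..u} \<nu>2 g - c * \<nu>2 {u<..v}) \<le> e * (\<kappa>2 v - \<kappa>2 u)"
    using n2.complex_integral_increment by metis
  have "\<exists>x\<in>{0..T}. \<forall>y\<in>{0..T}. norm (g x) \<le> norm (g y)"
    using n1.T by (intro continuous_attains_inf continuous_on_norm g) auto
  then obtain x where x: "x \<in> {0..T}" "\<And>y. y \<in> {0..T} \<Longrightarrow> norm (g x) \<le> norm (g y)" by blast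
  define \<delta> where "\<delta> = norm (g x)"
  have \<delta>: "0 < \<delta>" "\<And>y. y \<in> {0..T} \<Longrightarrow> \<delta> \<le> norm (g y)" using x g(2)[of x] by (auto simp: \<delta>_def)
  have init: "\<nu>1 {0..t} = \<nu>2 {0..t}" if t: "t \<in> {0..T}" for t
  proof -
    let ?D = "\<lambda>t. \<nu>1 {0..t} - \<nu>2 {0..t}"
    have "?D t = ?D 0"
    proof (rule constant_if_small_increments[where K="\<lambda>t. \<kappa>1 t + \<kappa>2 t" and s=0 and T=t])
      fix e :: real assume e: "0 < e"
      obtain d where d: "0 < d" "\<And>u v. 0 \<le> u \<Longrightarrow> u \<le> T \<Longrightarrow> 0 \<le> v \<Longrightarrow> v \<le> T \<Longrightarrow> \<bar>v - u\<bar> < d \<Longrightarrow> norm (g v - g u) \<le> e * \<delta>"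
        using uniform_small_oscillation[OF g(1), of "e * \<delta>"] e \<delta>(1) by (metis mult_pos_pos)
      have "norm (?D v - ?D u) \<le> e * ((\<kappa>1 v + \<kappa>2 v) - (\<kappa>1 u + \<kappa>2 u))"
        if uv: "0 \<le> u" "u \<le> v" "v \<le> t" "v - u < d" for u v
      proof -
        have vT: "v \<le> T" using uv t by simp
        have osc: "norm (g r - g v) \<le> e * \<delta>" if "r \<in> {u<..v}" for r
          using that uv vT by (intro d(2)) auto
        let ?J1 = "complex_measure_integral {0..v} \<nu>1 g - complex_measure_integral {0..u} \<nu>1 g"
        let ?J2 = "complex_measure_integral {0..v} \<nu>2 g - complex_measure_integral {0..u} \<nu>2 g"
        have J: "?J1 = ?J2" using eq uv vT by simp
        have Deq: "?D v - ?D u = \<nu>1 {u<..v} - \<nu>2 {u<..v}"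
          using n1.initial_increment[OF uv(1,2) vT] n2.initial_increment[OF uv(1,2) vT] by (simp add: algebra_simps)
        have "\<delta> * norm (?D v - ?D u) \<le> norm (g v) * norm (?D v - ?D u)" using \<delta>(2)[of v] uv vT by (intro mult_right_mono) auto
        also have "\<dots> = norm ((?J2 - g v * \<nu>2 {u<..v}) - (?J1 - g v * \<nu>1 {u<..v}))"
          unfolding Deq norm_mult[symmetric] J by (simp add: algebra_simps)
        also have "\<dots> \<le> e * \<delta> * (\<kappa>2 v - \<kappa>2 u) + e * \<delta> * (\<kappa>1 v - \<kappa>1 u)"
          by (rule norm_triangle_le_diff[OF add_mono[OF k2[OF g(1) uv(1,2) vT osc] k1[OF g(1) uv(1,2) vT osc]]])
        also have "\<dots> = \<delta> * (e * ((\<kappa>1 v + \<kappa>2 v) - (\<kappa>1 u + \<kappa>2 u)))" by (simp add: algebra_simps)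
        finally show ?thesis using \<delta>(1) by (simp add: mult_le_cancel_left)
      qed
      thus "\<exists>d>0. \<forall>u v. 0 \<le> u \<and> u \<le> v \<and> v \<le> t \<and> v - u < d \<longrightarrow> norm (?D v - ?D u) \<le> e * ((\<kappa>1 v + \<kappa>2 v) - (\<kappa>1 u + \<kappa>2 u))"
        using d(1) by blast
    qed (use t in auto)
    thus ?thesis using n1.null_zero n2.null_zero by simp
  qed
  have "sets ?M = sigma_sets {0..T} ((\<inter>) {0..T} ` range (\<lambda>a. {..a}))"
  proof -
    have sb: "sets (borel :: real measure) = sigma_sets UNIV (range (\<lambda>a. {..a}))"
      unfolding borel_eq_atMost by (simp add: sets_measure_of)
    have "{0..T} \<in> sets (borel :: real measure)" by simp
    hence "{0..T} \<in> sigma_sets UNIV (range (\<lambda>a. {..a}))" unfolding sb .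
    from sigma_sets_Int[OF this] show ?thesis unfolding sets_restrict_space sb by simp
  qed
  hence B': "B \<in> sigma_sets {0..T} ((\<inter>) {0..T} ` range (\<lambda>a. {..a}))" using B by simp
  have "Int_stable ((\<inter>) {0..T} ` range (\<lambda>a. {..a}))"
  proof (rule Int_stableI)
    fix a b assume "a \<in> (\<inter>) {0..T} ` range (\<lambda>a. {..a})" "b \<in> (\<inter>) {0..T} ` range (\<lambda>a. {..a})"
    then obtain x y where "a = {0..T} \<inter> {..x}" "b = {0..T} \<inter> {..y}" by blast
    hence "a \<inter> b = {0..T} \<inter> {..min x y}" by auto
    thus "a \<inter> b \<in> (\<inter>) {0..T} ` range (\<lambda>a. {..a})" by blast
  qed
  moreover have "(\<inter>) {0..T} ` range (\<lambda>a. {..a}) \<subseteq> Pow {0..T}" by auto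
  ultimately show ?thesis using B'
  proof (induction rule: sigma_sets_induct_disjoint)
    case (basic A)
    then obtain x where A: "A = {0..T} \<inter> {..x}" by blast
    show ?case
    proof (cases "0 \<le> x")
      case True
      hence "A = {0..min x T}" unfolding A by auto
      thus ?thesis using init[of "min x T"] True n1.T by simp
    next
      case False
      hence "A = {}" unfolding A by auto
      thus ?thesis using n1.Re.empty n1.Im.empty n2.Re.empty n2.Im.empty by (simp add: complex_eq_iff)
    qed
  next
    case empty
    thus ?case using n1.Re.empty n1.Im.empty n2.Re.empty n2.Im.empty by (simp add: complex_eq_iff)
  next
    case (compl A)
    hence A: "A \<in> sets ?M" using \<open>sets ?M = _\<close> by simp
    hence sub: "A \<subseteq> {0..T}" and cA: "{0..T} - A \<in> sets ?M" unfolding n1.Re.sets_M_iff by auto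
    have e: "A \<union> ({0..T} - A) = {0..T}" using sub by auto
    have dj: "A \<inter> ({0..T} - A) = {}" by auto
    have "\<nu>1 {0..T} = \<nu>1 A + \<nu>1 ({0..T} - A)" "\<nu>2 {0..T} = \<nu>2 A + \<nu>2 ({0..T} - A)"
      using n1.Re.union[OF A cA dj] n1.Im.union[OF A cA dj] n2.Re.union[OF A cA dj] n2.Im.union[OF A cA dj] unfolding e
      by (auto simp: complex_eq_iff)
    thus ?case using compl init[of T] n1.T by simp
  next
    case (union A)
    hence A: "range A \<subseteq> sets ?M" using \<open>sets ?M = _\<close> by simp
    have "(\<lambda>n. \<nu>1 (A n)) sums \<nu>1 (\<Union>n. A n)" "(\<lambda>n. \<nu>2 (A n)) sums \<nu>2 (\<Union>n. A n)"
      using n1.countably_additive[OF A] n2.countably_additive[OF A] union by auto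
    moreover have "(\<lambda>n. \<nu>1 (A n)) = (\<lambda>n. \<nu>2 (A n))" using union by auto
    ultimately show ?case using sums_unique2 by fastforce
  qed
qed

section \<open>Time intervals and precompact Borel sets\<close>

lemma time_interval_facts:
  assumes "time_interval I"
  shows "0 \<in> I" "\<And>t. t \<in> I \<Longrightarrow> 0 \<le> t" "\<And>s t. t \<in> I \<Longrightarrow> 0 \<le> s \<Longrightarrow> s \<le> t \<Longrightarrow> s \<in> I" "I \<in> sets borel"
  using assms by (auto simp: time_interval_def)

lemma time_interval_subset: "time_interval I \<Longrightarrow> t \<in> I \<Longrightarrow> {0..t} \<subseteq> I"
  by (auto simp: time_interval_def)

lemma time_interval_exhaustion:
  assumes "time_interval I"
  obtains T :: "nat \<Rightarrow> real" where "incseq T" "\<And>n. T n \<in> I" "(\<Union>n. {0..T n}) = I"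
proof -
  consider "I = {0..}" | b where "0 < b" "I = {0..<b}" | b where "0 < b" "I = {0..b}"
    using assms by (auto simp: time_interval_def)
  thus ?thesis
  proof cases
    case 1
    have "(\<Union>n. {0..real n}) = {0..}" using real_arch_simple by auto
    thus ?thesis using 1 by (intro that[of real]) (auto simp: incseq_def)
  next
    case (2 b)
    let ?T = "\<lambda>n. b - b / real (Suc n)"
    have in0: "?T n \<in> {0..<b}" for n using 2 by (auto simp: field_simps)
    have "t \<in> (\<Union>n. {0..?T n})" if t: "t \<in> {0..<b}" for t
    proof -
      obtain n where n: "b / (b - t) < real n" using reals_Archimedean2 by blast
      have "b < real n * (b - t)" using n t by (simp add: field_simps)
      also have "\<dots> \<le> real (Suc n) * (b - t)" using t by (intro mult_right_mono) auto
      finally have "b / real (Suc n) \<le> b - t" by (simp add: pos_divide_le_eq mult.commute del: of_nat_Suc)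
      thus ?thesis using t by (intro UN_I[of n]) auto
    qed
    moreover have "(\<Union>n. {0..?T n}) \<subseteq> {0..<b}"
    proof (rule UN_least)
      show "{0..?T n} \<subseteq> {0..<b}" for n using in0[of n] by (auto simp del: of_nat_Suc)
    qed
    ultimately have "(\<Union>n. {0..?T n}) = {0..<b}" by blast
    moreover have "incseq ?T" using 2 by (intro incseq_SucI) (auto intro!: divide_left_mono simp del: of_nat_Suc)
    ultimately show ?thesis using 2 in0 by (intro that[of ?T]) auto
  next
    case (3 b) thus ?thesis by (intro that[of "\<lambda>_. b"]) auto
  qed
qed

lemma precompact_borelI:
  assumes "time_interval I" "t \<in> I" "B \<in> sets borel" "B \<subseteq> {0..t}"
  shows "B \<in> precompact_borel I"
proof -
  have c: "closure B \<subseteq> {0..t}" using assms(4) by (intro closure_minimal) auto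
  have "bounded B" using bounded_subset[OF bounded_closed_interval assms(4)] .
  moreover have "{0..t} \<subseteq> I" by (rule time_interval_subset[OF assms(1,2)])
  ultimately show ?thesis using c assms(3) by (auto simp: precompact_borel_def)
qed

lemma precompact_borelD:
  assumes "time_interval I" "B \<in> precompact_borel I"
  obtains t where "t \<in> I" "B \<in> sets borel" "B \<subseteq> {0..t}"
proof (cases "B = {}")
  case True
  thus ?thesis using that[of 0] time_interval_facts(1)[OF assms(1)] by auto
next
  case False
  have c: "compact (closure B)" "closure B \<subseteq> I" "B \<in> sets borel" using assms(2) by (auto simp: precompact_borel_def)
  obtain t where t: "t \<in> closure B" "\<And>s. s \<in> closure B \<Longrightarrow> s \<le> t"
    using compact_attains_sup[OF c(1)] False by auto
  have "B \<subseteq> {0..t}"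
  proof
    fix s assume "s \<in> B"
    hence s: "s \<in> closure B" using closure_subset by blast
    thus "s \<in> {0..t}" using t(2)[OF s] c(2) time_interval_facts(2)[OF assms(1)] by auto
  qed
  thus ?thesis using that[of t] t c by auto
qed

section \<open>Herglotz families and space-time measures\<close>

text \<open>The bound uniform in \<open>B\<close> comes from \<open>pick_bound\<close>: the imaginary part of \<open>lim y P(iy,B)\<close> is monotone in
  \<open>B\<close>, because \<open>Im P\<close> is additive and nonnegative.\<close>

lemma herglotz_complex_measure:
  assumes I: "time_interval I" and P: "herglotz_family I P" and T: "T \<in> I" and z: "0 < Im z"
  obtains K where "bounded_complex_measure T (\<lambda>B. P (z, B)) K"
proof -
  have Tp: "0 \<le> T" by (rule time_interval_facts(2)[OF I T])
  have pc: "B \<in> precompact_borel I" if "B \<in> sets (restrict_space borel {0..T})" for B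
    using that by (intro precompact_borelI[OF I T]) (auto simp: sets_restrict_space_iff)
  have ca: "(\<lambda>n. P (w, B n)) sums P (w, \<Union>n. B n)"
    if "range B \<subseteq> sets (restrict_space borel {0..T})" "disjoint_family B" "0 < Im w" for B :: "nat \<Rightarrow> real set" and w
  proof -
    have "(\<Union>n. B n) \<in> sets (restrict_space borel {0..T})" using that(1) by auto
    hence "range B \<subseteq> precompact_borel I \<and> disjoint_family B \<and> (\<Union>n. B n) \<in> precompact_borel I"
      using that pc by blast
    thus ?thesis using P that(3) unfolding herglotz_family_def HM1_def by auto
  qed
  have Imp: "0 \<le> Im (P (w, B))" if "B \<in> sets (restrict_space borel {0..T})" "0 < Im w" for B w
  proof -
    have "(w, B) \<in> upper_half_plane \<times> precompact_borel I" using pc[OF that(1)] that(2) by simp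
    hence "P (w, B) \<in> closed_upper_half_plane" using P unfolding herglotz_family_def by blast
    thus ?thesis by (simp add: closed_upper_half_plane_def)
  qed
  have add: "P (w, {0..T}) = P (w, B) + P (w, {0..T} - B)" if B: "B \<in> sets (restrict_space borel {0..T})" and w: "0 < Im w" for B w
  proof -
    have e: "P (w, {}) = 0"
    proof -
      have "(\<lambda>n::nat. P (w, {})) sums P (w, \<Union>n::nat. {})" by (rule ca) (auto simp: disjoint_family_on_def w)
      hence "(\<lambda>n::nat. P (w, {})) \<longlonglongrightarrow> 0" by (intro summable_LIMSEQ_zero sums_summable)
      thus ?thesis by (simp add: LIMSEQ_const_iff)
    qed
    have Bs: "B \<subseteq> {0..T}" "{0..T} - B \<in> sets (restrict_space borel {0..T})" using B by (auto simp: sets_restrict_space_iff)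
    let ?C = "\<lambda>n::nat. if n = 0 then B else if n = 1 then {0..T} - B else {}"
    have "(\<lambda>n. P (w, ?C n)) sums P (w, \<Union>n. ?C n)"
      by (rule ca) (use B Bs w in \<open>auto simp: disjoint_family_on_def\<close>)
    moreover have "(\<Union>n. ?C n) = {0..T}" using Bs by (auto split: if_splits)
    moreover have "(\<lambda>n. P (w, ?C n)) sums (\<Sum>n\<in>{0, 1}. P (w, ?C n))"
      by (rule sums_finite) (auto simp: e)
    ultimately show ?thesis using sums_unique2 by fastforce
  qed
  have lim: "\<exists>L. ((\<lambda>y. of_real y * P (\<i> * of_real y, B)) \<longlongrightarrow> L) at_top" if "B \<in> sets (restrict_space borel {0..T})" for B
    using P pc[OF that] unfolding herglotz_family_def HM4_def by blast
  have TS: "{0..T} \<in> sets (restrict_space borel {0..T})" by (auto simp: sets_restrict_space_iff)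
  obtain L where L: "((\<lambda>y. of_real y * P (\<i> * of_real y, {0..T})) \<longlongrightarrow> L) at_top" using lim[OF TS] by blast
  have bd: "norm (P (z, B)) \<le> Im L / Im z" if B: "B \<in> sets (restrict_space borel {0..T})" for B
  proof -
    obtain L' where L': "((\<lambda>y. of_real y * P (\<i> * of_real y, B)) \<longlongrightarrow> L') at_top" using lim[OF B] by blast
    have "Im L' \<le> Im L"
    proof (rule tendsto_le[OF trivial_limit_at_top_linorder tendsto_Im[OF L] tendsto_Im[OF L']])
      have Bs: "{0..T} - B \<in> sets (restrict_space borel {0..T})" using B by (auto simp: sets_restrict_space_iff)
      show "eventually (\<lambda>y. Im (of_real y * P (\<i> * of_real y, B)) \<le> Im (of_real y * P (\<i> * of_real y, {0..T}))) at_top"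
        using eventually_gt_at_top[of 0]
      proof eventually_elim
        case (elim y)
        have "Im (P (\<i> * of_real y, B)) \<le> Im (P (\<i> * of_real y, {0..T}))"
          using add[OF B, of "\<i> * of_real y"] Imp[OF Bs, of "\<i> * of_real y"] elim by simp
        thus ?case using elim by (simp add: mult_left_mono)
      qed
    qed
    moreover have "norm (P (z, B)) \<le> Im L' / Im z"
    proof (rule pick_bound[where g="\<lambda>z. P (z, B)", OF _ _ L' z])
      show "(\<lambda>z. P (z, B)) holomorphic_on upper_half_plane"
        using P pc[OF B] unfolding herglotz_family_def HM3_def by blast
    qed (rule Imp[OF B])
    ultimately show ?thesis using z by (meson divide_right_mono less_imp_le order_trans)
  qed
  have "P (z, {0}) = 0" using P time_interval_facts(1)[OF I] z unfolding herglotz_family_def HM2_def by auto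
  hence "bounded_complex_measure T (\<lambda>B. P (z, B)) (Im L / Im z)"
    using Tp ca[OF _ _ z] bd by unfold_locales
  thus ?thesis by (rule that)
qed

locale spacetime =
  fixes I :: "real set" and \<Theta> :: "(real \<times> real) measure"
  assumes time_interval: "time_interval I"
    and sets_\<Theta>: "sets \<Theta> = sets (restrict_space borel (UNIV \<times> I))"
    and finite_slab: "\<And>t. t \<in> I \<Longrightarrow> emeasure \<Theta> (UNIV \<times> {0..t}) < \<infinity>"
    and null_slice: "\<And>t. t \<in> I \<Longrightarrow> emeasure \<Theta> (UNIV \<times> {t}) = 0"
begin

lemmas I = time_interval_facts[OF time_interval]

lemma space_\<Theta>: "space \<Theta> = UNIV \<times> I"
  using sets_eq_imp_space_eq[OF sets_\<Theta>] by (simp add: space_restrict_space)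

lemma sets_\<Theta>_iff: "X \<in> sets \<Theta> \<longleftrightarrow> X \<in> sets borel \<and> X \<subseteq> UNIV \<times> I"
proof -
  have "(UNIV::real set) \<times> I \<in> sets borel" using I(4) unfolding borel_prod[symmetric] by simp
  thus ?thesis unfolding sets_\<Theta> by (subst sets_restrict_space_iff) auto
qed

lemma rectangle_sets: "A \<in> sets borel \<Longrightarrow> B \<in> sets borel \<Longrightarrow> B \<subseteq> I \<Longrightarrow> A \<times> B \<in> sets \<Theta>"
  unfolding sets_\<Theta>_iff borel_prod[symmetric] by auto

lemma measurable_\<Theta>: "g \<in> borel_measurable borel \<Longrightarrow> g \<in> borel_measurable \<Theta>"
  unfolding measurable_cong_sets[OF sets_\<Theta> refl] by (rule measurable_restrict_space1)

lemma precompact_slab: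
  assumes "B \<in> precompact_borel I"
  shows "UNIV \<times> B \<in> sets \<Theta>" "emeasure \<Theta> (UNIV \<times> B) < \<infinity>"
proof -
  obtain t where t: "t \<in> I" "B \<in> sets borel" "B \<subseteq> {0..t}" using precompact_borelD[OF time_interval assms] .
  have sub: "{0..t} \<subseteq> I" by (rule time_interval_subset[OF time_interval t(1)])
  show "UNIV \<times> B \<in> sets \<Theta>" using t sub by (intro rectangle_sets) auto
  have "emeasure \<Theta> (UNIV \<times> B) \<le> emeasure \<Theta> (UNIV \<times> {0..t})"
    using t sub by (intro emeasure_mono rectangle_sets) auto
  also have "\<dots> < \<infinity>" by (rule finite_slab[OF t(1)])
  finally show "emeasure \<Theta> (UNIV \<times> B) < \<infinity>" .
qed

text \<open>As an image measure the section allows the transfer of integrals.\<close>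

lemma section_measure_distr:
  assumes "B \<in> precompact_borel I"
  shows "section_measure \<Theta> B = distr (restrict_space \<Theta> (UNIV \<times> B)) borel fst"
    and "A \<in> sets borel \<Longrightarrow> emeasure (section_measure \<Theta> B) A = emeasure \<Theta> (A \<times> B)"
    and "finite_real_measure (section_measure \<Theta> B)"
proof -
  obtain t where t: "t \<in> I" "B \<in> sets borel" "B \<subseteq> {0..t}" using precompact_borelD[OF time_interval assms] .
  have BI: "B \<subseteq> I" using t time_interval_subset[OF time_interval t(1)] by auto
  have S: "UNIV \<times> B \<inter> space \<Theta> \<in> sets \<Theta>" using precompact_slab(1)[OF assms] by auto
  have fm: "fst \<in> measurable (restrict_space \<Theta> (UNIV \<times> B)) borel"
    by (intro measurable_restrict_space1 measurable_\<Theta> borel_measurable_continuous_onI continuous_intros)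
  have em: "emeasure (distr (restrict_space \<Theta> (UNIV \<times> B)) borel fst) A = emeasure \<Theta> (A \<times> B)" if A: "A \<in> sets borel" for A
  proof -
    have "fst -` A \<inter> space (restrict_space \<Theta> (UNIV \<times> B)) = A \<times> B"
      using BI by (auto simp: space_restrict_space space_\<Theta>)
    moreover have "A \<times> B \<subseteq> UNIV \<times> B" by auto
    ultimately show ?thesis using A emeasure_restrict_space[OF S, of "A \<times> B"] by (simp add: emeasure_distr[OF fm])
  qed
  have "section_measure \<Theta> B = measure_of UNIV (sets borel) (emeasure (distr (restrict_space \<Theta> (UNIV \<times> B)) borel fst))"
    unfolding section_measure_def
    using sets.sigma_sets_eq[of "borel :: real measure"] by (intro measure_of_eq) (auto simp: em)
  also have "\<dots> = distr (restrict_space \<Theta> (UNIV \<times> B)) borel fst"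
    using measure_of_of_measure[of "distr (restrict_space \<Theta> (UNIV \<times> B)) borel fst"] by simp
  finally show e: "section_measure \<Theta> B = distr (restrict_space \<Theta> (UNIV \<times> B)) borel fst" .
  show "A \<in> sets borel \<Longrightarrow> emeasure (section_measure \<Theta> B) A = emeasure \<Theta> (A \<times> B)" unfolding e by (rule em)
  have "emeasure (section_measure \<Theta> B) UNIV < \<infinity>" unfolding e using em[of UNIV] precompact_slab(2)[OF assms] by simp
  thus "finite_real_measure (section_measure \<Theta> B)"
    by (intro finite_real_measure.intro finite_real_measure_axioms.intro finite_measureI) (auto simp: e)
qed

lemma stieltjes_section:
  assumes "B \<in> precompact_borel I"
  shows "stieltjes (section_measure \<Theta> B) z = (\<integral>w. indicator (UNIV \<times> B) w *\<^sub>R (1 / (of_real (fst w) - z)) \<partial>\<Theta>)"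
proof -
  have S: "UNIV \<times> B \<inter> space \<Theta> \<in> sets \<Theta>" using precompact_slab(1)[OF assms] by auto
  have fm: "fst \<in> measurable (restrict_space \<Theta> (UNIV \<times> B)) borel"
    by (intro measurable_restrict_space1 measurable_\<Theta> borel_measurable_continuous_onI continuous_intros)
  have "stieltjes (section_measure \<Theta> B) z = (\<integral>w. 1 / (of_real (fst w) - z) \<partial>restrict_space \<Theta> (UNIV \<times> B))"
    unfolding stieltjes_def section_measure_distr(1)[OF assms] by (rule integral_distr[OF fm]) measurable
  also have "\<dots> = (\<integral>w. indicator (UNIV \<times> B) w *\<^sub>R (1 / (of_real (fst w) - z)) \<partial>\<Theta>)"
    by (rule integral_restrict_space[OF S])
  finally show ?thesis .
qed

lemma integrable_slab:
  fixes h :: "real \<times> real \<Rightarrow> complex"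
  assumes "B \<in> precompact_borel I" and h: "h \<in> borel_measurable \<Theta>" and b: "\<And>w. norm (h w) \<le> c"
  shows "integrable \<Theta> (\<lambda>w. indicator (UNIV \<times> B) w *\<^sub>R h w)"
    and "norm (\<integral>w. indicator (UNIV \<times> B) w *\<^sub>R h w \<partial>\<Theta>) \<le> c * measure \<Theta> (UNIV \<times> B)"
proof -
  note s = precompact_slab[OF assms(1)]
  have ic: "integrable \<Theta> (\<lambda>w. c * indicat_real (UNIV \<times> B) w)" using s by (intro integrable_mult_right) auto
  show i: "integrable \<Theta> (\<lambda>w. indicator (UNIV \<times> B) w *\<^sub>R h w)"
  proof (rule Bochner_Integration.integrable_bound[OF ic])
    show "(\<lambda>w. indicator (UNIV \<times> B) w *\<^sub>R h w) \<in> borel_measurable \<Theta>" using s(1) h by measurable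
    show "AE w in \<Theta>. norm (indicator (UNIV \<times> B) w *\<^sub>R h w) \<le> norm (c * indicat_real (UNIV \<times> B) w)"
      using b order_trans[OF norm_ge_zero b] by (auto split: split_indicator)
  qed
  have "norm (\<integral>w. indicator (UNIV \<times> B) w *\<^sub>R h w \<partial>\<Theta>) \<le> (\<integral>w. c * indicat_real (UNIV \<times> B) w \<partial>\<Theta>)"
    by (rule Bochner_Integration.integral_norm_bound_integral[OF i ic]) (use b in \<open>auto split: split_indicator\<close>)
  also have "\<dots> = c * measure \<Theta> (UNIV \<times> B)" using sets.Int_space_eq2[OF s(1)] by simp
  finally show "norm (\<integral>w. indicator (UNIV \<times> B) w *\<^sub>R h w \<partial>\<Theta>) \<le> c * measure \<Theta> (UNIV \<times> B)" .
qed

lemma resolvent_measurable: "(\<lambda>w. 1 / (complex_of_real (fst w) - z)) \<in> borel_measurable \<Theta>"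
proof (rule measurable_\<Theta>)
  have "(fst :: real \<times> real \<Rightarrow> real) \<in> borel_measurable borel" by (intro borel_measurable_continuous_onI continuous_intros)
  thus "(\<lambda>w :: real \<times> real. 1 / (complex_of_real (fst w) - z)) \<in> borel_measurable borel" by measurable
qed

lemma stieltjes_section_sums:
  assumes B: "range B \<subseteq> precompact_borel I" "disjoint_family B" "(\<Union>n. B n) \<in> precompact_borel I" and z: "0 < Im z"
  shows "(\<lambda>n::nat. stieltjes (section_measure \<Theta> (B n)) z) sums stieltjes (section_measure \<Theta> (\<Union>n. B n)) z"
proof -
  let ?h = "\<lambda>w :: real \<times> real. 1 / (complex_of_real (fst w) - z)"
  let ?A = "\<lambda>n. (UNIV :: real set) \<times> B n"
  let ?U = "(UNIV :: real set) \<times> (\<Union>n. B n)"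
  have hb: "norm (?h w) \<le> 1 / Im z" for w by (rule norm_resolvent_le) (use z in auto)
  have Bn: "B n \<in> precompact_borel I" for n using B(1) by auto
  have AU: "(\<Union>n. ?A n) = ?U" by auto
  have ind: "(\<lambda>n. indicat_real (?A n) w) sums indicat_real ?U w" for w
    unfolding AU[symmetric] by (rule indicator_sums) (use B(2) in \<open>auto simp: disjoint_family_on_def\<close>)
  have part: "(\<Sum>i<n. stieltjes (section_measure \<Theta> (B i)) z) = (\<integral>w. (\<Sum>i<n. indicat_real (?A i) w) *\<^sub>R ?h w \<partial>\<Theta>)" for n
    unfolding stieltjes_section[OF Bn] scaleR_sum_left
    by (rule Bochner_Integration.integral_sum[symmetric], rule integrable_slab(1)[OF Bn resolvent_measurable hb])
  have "(\<lambda>n. \<integral>w. (\<Sum>i<n. indicat_real (?A i) w) *\<^sub>R ?h w \<partial>\<Theta>) \<longlonglongrightarrow> (\<integral>w. indicat_real ?U w *\<^sub>R ?h w \<partial>\<Theta>)"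
  proof (rule integral_dominated_convergence[where w="\<lambda>w. 1 / Im z * indicat_real ?U w"])
    note s = precompact_slab[OF B(3)]
    show "(\<lambda>w. indicat_real ?U w *\<^sub>R ?h w) \<in> borel_measurable \<Theta>" using s(1) resolvent_measurable by measurable
    have "?A i \<in> sets \<Theta>" for i by (rule precompact_slab(1)[OF Bn])
    thus "(\<lambda>w. (\<Sum>i<n. indicat_real (?A i) w) *\<^sub>R ?h w) \<in> borel_measurable \<Theta>" for n
      using resolvent_measurable by measurable
    show "integrable \<Theta> (\<lambda>w. 1 / Im z * indicat_real ?U w)" using s by (intro integrable_mult_right) auto
    show "AE w in \<Theta>. (\<lambda>n. (\<Sum>i<n. indicat_real (?A i) w) *\<^sub>R ?h w) \<longlonglongrightarrow> indicat_real ?U w *\<^sub>R ?h w"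
      using ind unfolding sums_def by (intro AE_I2 tendsto_intros) auto
    show "AE w in \<Theta>. norm ((\<Sum>i<n. indicat_real (?A i) w) *\<^sub>R ?h w) \<le> 1 / Im z * indicat_real ?U w" for n
    proof (intro AE_I2)
      fix w
      have 1: "(\<Sum>i<n. indicat_real (?A i) w) \<le> indicat_real ?U w"
        using sum_le_suminf[OF sums_summable[OF ind], of "{..<n}" w] sums_unique[OF ind, of w] by simp
      have 0: "0 \<le> (\<Sum>i<n. indicat_real (?A i) w)" by (intro sum_nonneg) auto
      have "norm ((\<Sum>i<n. indicat_real (?A i) w) *\<^sub>R ?h w) = (\<Sum>i<n. indicat_real (?A i) w) * norm (?h w)" using 0 by (simp only: norm_scaleR abs_of_nonneg)
      also have "\<dots> \<le> indicat_real ?U w * (1 / Im z)" using 0 1 hb z by (intro mult_mono) auto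
      finally show "norm ((\<Sum>i<n. indicat_real (?A i) w) *\<^sub>R ?h w) \<le> 1 / Im z * indicat_real ?U w" by (simp only: mult.commute)
    qed
  qed
  thus ?thesis unfolding sums_def part stieltjes_section[OF B(3)] .
qed

definition driving_function :: "complex \<times> real set \<Rightarrow> complex" where
  "driving_function = restrict (\<lambda>(z, B). stieltjes (section_measure \<Theta> B) z) (upper_half_plane \<times> precompact_borel I)"

lemma driving_function_eq: "0 < Im z \<Longrightarrow> B \<in> precompact_borel I \<Longrightarrow> driving_function (z, B) = stieltjes (section_measure \<Theta> B) z"
  by (simp add: driving_function_def)

lemma herglotz_driving_function: "herglotz_family I driving_function"
  unfolding herglotz_family_def
proof (intro conjI)
  show "driving_function \<in> upper_half_plane \<times> precompact_borel I \<rightarrow>\<^sub>E closed_upper_half_plane"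
  proof (rule PiE_I)
    fix x assume "x \<in> upper_half_plane \<times> precompact_borel I"
    then obtain z B where x: "x = (z, B)" "0 < Im z" "B \<in> precompact_borel I" by auto
    show "driving_function x \<in> closed_upper_half_plane"
      using finite_real_measure.Im_stieltjes_nonneg[OF section_measure_distr(3)[OF x(3)] x(2)]
      by (simp add: x driving_function_eq closed_upper_half_plane_def)
  qed (auto simp: driving_function_def)
  show "HM1 I driving_function" unfolding HM1_def
  proof (intro ballI allI impI)
    fix z and B :: "nat \<Rightarrow> real set"
    assume z: "z \<in> upper_half_plane" and B: "range B \<subseteq> precompact_borel I \<and> disjoint_family B \<and> (\<Union>n. B n) \<in> precompact_borel I"
    have "B n \<in> precompact_borel I" for n using B by auto
    thus "(\<lambda>n. driving_function (z, B n)) sums driving_function (z, \<Union>n. B n)"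
      using stieltjes_section_sums[of B z] B z by (simp add: driving_function_eq)
  qed
  show "HM2 I driving_function" unfolding HM2_def
  proof (intro ballI)
    fix z t assume z: "z \<in> upper_half_plane" and t: "t \<in> I"
    have pc: "{t} \<in> precompact_borel I" using t I(2) by (intro precompact_borelI[OF time_interval t]) auto
    interpret finite_real_measure "section_measure \<Theta> {t}" by (rule section_measure_distr(3)[OF pc])
    have "measure (section_measure \<Theta> {t}) UNIV = 0"
      using section_measure_distr(2)[OF pc, of UNIV] null_slice[OF t] by (simp add: measure_def)
    thus "driving_function (z, {t}) = 0" using norm_stieltjes_le[of z] z pc by (simp add: driving_function_eq)
  qed
  show "HM3 I driving_function" unfolding HM3_def
  proof
    fix B assume B: "B \<in> precompact_borel I"
    show "(\<lambda>z. driving_function (z, B)) holomorphic_on upper_half_plane"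
      by (rule holomorphic_transform[OF finite_real_measure.holomorphic_stieltjes[OF section_measure_distr(3)[OF B]]])
        (simp add: driving_function_eq B)
  qed
  show "HM4 I driving_function" unfolding HM4_def
  proof
    fix B assume B: "B \<in> precompact_borel I"
    have "eventually (\<lambda>y. of_real y * stieltjes (section_measure \<Theta> B) (\<i> * of_real y) = complex_of_real y * driving_function (\<i> * complex_of_real y, B)) at_top"
      using eventually_gt_at_top[of 0] by eventually_elim (simp add: driving_function_eq B)
    from Lim_transform_eventually[OF finite_real_measure.stieltjes_asymptotics[OF section_measure_distr(3)[OF B]] this]
    show "\<exists>L. ((\<lambda>y. complex_of_real y * driving_function (\<i> * complex_of_real y, B)) \<longlongrightarrow> L) at_top" by blast
  qed
qed

lemma compound_driving_function: "is_compound_driving_measure I driving_function \<Theta>"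
  unfolding is_compound_driving_measure_def using sets_\<Theta> finite_slab null_slice
  by (auto simp: driving_function_eq stieltjes_def)

end

text \<open>Rectangles over precompact sets exhaust all rectangles, and these generate the product \<open>\<sigma>\<close>-algebra.\<close>

lemma spacetime_unique:
  assumes "spacetime I \<Theta>" "spacetime I \<Theta>'"
    and eq: "\<And>A B. A \<in> sets borel \<Longrightarrow> B \<in> precompact_borel I \<Longrightarrow> emeasure \<Theta> (A \<times> B) = emeasure \<Theta>' (A \<times> B)"
  shows "\<Theta> = \<Theta>'"
proof -
  interpret a: spacetime I \<Theta> by fact
  interpret b: spacetime I \<Theta>' by fact
  obtain T where T: "incseq T" "\<And>n. T n \<in> I" "(\<Union>n. {0..T n}) = I" using time_interval_exhaustion[OF a.time_interval] by metis
  let ?E = "(\<inter>) ((UNIV :: real set) \<times> I) ` {A \<times> B |A B. A \<in> sets borel \<and> B \<in> sets borel}"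
  have E: "\<exists>(A :: real set) (B :: real set). X = A \<times> B \<and> A \<in> sets borel \<and> B \<in> sets borel \<and> B \<subseteq> I" if XE: "X \<in> ?E" for X
  proof -
    obtain A B :: "real set" where "X = (UNIV \<times> I) \<inter> (A \<times> B)" "A \<in> sets borel" "B \<in> sets borel" using XE by blast
    hence "X = A \<times> (I \<inter> B)" "A \<in> sets borel" "I \<inter> B \<in> sets borel" using a.I(4) by auto
    thus ?thesis by blast
  qed
  have E': "A \<times> B \<in> ?E" if "A \<in> sets borel" "B \<in> sets borel" "B \<subseteq> I" for A B :: "real set"
  proof -
    have "A \<times> B = (UNIV \<times> I) \<inter> (A \<times> B)" using that by auto
    thus ?thesis using that by blast
  qed
  have UI: "(UNIV :: real set) \<times> I \<in> sets borel" using a.I(4) unfolding borel_prod[symmetric] by simp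
  have sets: "sets (restrict_space borel ((UNIV :: real set) \<times> I)) = sigma_sets (UNIV \<times> I) ?E"
  proof -
    have sb: "sets (borel :: (real \<times> real) measure) = sigma_sets UNIV {A \<times> B |A B. A \<in> sets borel \<and> B \<in> sets borel}"
      unfolding borel_prod[symmetric] sets_pair_measure by simp
    show ?thesis using sigma_sets_Int[OF UI[unfolded sb]] unfolding sets_restrict_space sb by simp
  qed
  show ?thesis
  proof (rule measure_eqI_generator_eq[where \<Omega>="UNIV \<times> I" and E="?E" and A="\<lambda>n. UNIV \<times> {0..T n}"])
    show "Int_stable ?E"
    proof (rule Int_stableI)
      fix X Y assume XE: "X \<in> ?E" and YE: "Y \<in> ?E"
      obtain A B where X: "X = A \<times> B" "A \<in> sets borel" "B \<in> sets borel" "B \<subseteq> I" using E[OF XE] by blast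
      obtain A' B' where Y: "Y = A' \<times> B'" "A' \<in> sets borel" "B' \<in> sets borel" "B' \<subseteq> I" using E[OF YE] by blast
      have "X \<inter> Y = (A \<inter> A') \<times> (B \<inter> B')" unfolding X Y by blast
      also have "\<dots> \<in> ?E" by (rule E') (use X Y in auto)
      finally show "X \<inter> Y \<in> ?E" .
    qed
    show "?E \<subseteq> Pow (UNIV \<times> I)" by auto
    show "sets \<Theta> = sigma_sets (UNIV \<times> I) ?E" "sets \<Theta>' = sigma_sets (UNIV \<times> I) ?E"
      unfolding a.sets_\<Theta> b.sets_\<Theta> by (rule sets)+
    show "range (\<lambda>n. (UNIV::real set) \<times> {0..T n}) \<subseteq> ?E"
    proof (rule image_subsetI)
      fix n
      have "{0..T n} \<subseteq> I" using T(3) by blast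
      thus "(UNIV::real set) \<times> {0..T n} \<in> ?E" by (intro E') auto
    qed
    show "(\<Union>n. (UNIV::real set) \<times> {0..T n}) = UNIV \<times> I" using T(3) by auto
    show "emeasure \<Theta> (UNIV \<times> {0..T n}) \<noteq> \<infinity>" for n using a.finite_slab[OF T(2)] by (simp add: less_top)
    fix X assume XE: "X \<in> ?E"
    obtain A B where X: "X = A \<times> B" "A \<in> sets borel" "B \<in> sets borel" "B \<subseteq> I" using E[OF XE] by blast
    have U: "(\<Union>n. A \<times> (B \<inter> {0..T n})) = X" using X T(3) by auto
    have inc: "incseq (\<lambda>n. A \<times> (B \<inter> {0..T n}))" using T(1) by (force simp: incseq_def)
    have pc: "B \<inter> {0..T n} \<in> precompact_borel I" for n using X by (intro precompact_borelI[OF a.time_interval T(2)]) auto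
    have "(\<lambda>n. emeasure \<Theta> (A \<times> (B \<inter> {0..T n}))) \<longlonglongrightarrow> emeasure \<Theta> X"
      unfolding U[symmetric] by (rule Lim_emeasure_incseq[OF _ inc]) (use X in \<open>auto intro!: a.rectangle_sets\<close>)
    moreover have "(\<lambda>n. emeasure \<Theta>' (A \<times> (B \<inter> {0..T n}))) \<longlonglongrightarrow> emeasure \<Theta>' X"
      unfolding U[symmetric] by (rule Lim_emeasure_incseq[OF _ inc]) (use X in \<open>auto intro!: b.rectangle_sets\<close>)
    ultimately show "emeasure \<Theta> X = emeasure \<Theta>' X" unfolding eq[OF X(2) pc] by (rule LIMSEQ_unique)
  qed
qed

text \<open>The Stieltjes transform of each section determines the section, hence the masses of all rectangles.\<close>

lemma (in spacetime) compound_driving_measure_eq: "compound_driving_measure I driving_function = \<Theta>"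
  unfolding compound_driving_measure_def
proof (rule the_equality)
  show "is_compound_driving_measure I driving_function \<Theta>" by (rule compound_driving_function)
next
  fix \<Theta>' assume c: "is_compound_driving_measure I driving_function \<Theta>'"
  have sp: "spacetime I \<Theta>'" using c time_interval unfolding is_compound_driving_measure_def by unfold_locales auto
  interpret b: spacetime I \<Theta>' by fact
  show "\<Theta>' = \<Theta>"
  proof (rule spacetime_unique[OF sp spacetime_axioms])
    fix A B :: "real set" assume A: "A \<in> sets borel" and B: "B \<in> precompact_borel I"
    have "section_measure \<Theta>' B = section_measure \<Theta> B"
    proof (rule stieltjes_unique[OF b.section_measure_distr(3)[OF B] section_measure_distr(3)[OF B]])
      fix z assume z: "0 < Im z"
      hence "driving_function (z, B) = stieltjes (section_measure \<Theta>' B) z"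
        using c B unfolding is_compound_driving_measure_def stieltjes_def by simp
      thus "stieltjes (section_measure \<Theta>' B) z = stieltjes (section_measure \<Theta> B) z"
        using z B by (simp add: driving_function_eq)
    qed
    thus "emeasure \<Theta>' (A \<times> B) = emeasure \<Theta> (A \<times> B)"
      using section_measure_distr(2)[OF B A] b.section_measure_distr(2)[OF B A] by simp
  qed
qed

section \<open>Loewner chains\<close>

locale loewner_chain =
  fixes I :: "real set" and f :: "real \<Rightarrow> complex \<Rightarrow> complex"
  assumes time_interval: "time_interval I" and P20_DLC: "P20_DLC I f"
begin

abbreviation \<phi> :: "real \<Rightarrow> real \<Rightarrow> complex \<Rightarrow> complex" where
  "\<phi> \<equiv> reverse_evolution f"

text \<open>The coefficient of the expansion at infinity, that is, the variance of the measure of \<open>f t\<close>.\<close>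

definition V :: "real \<Rightarrow> real" where
  "V t = (SOME v. hydrodynamic v (f t))"

lemma zero_in_I: "0 \<in> I"
  by (rule time_interval_facts(1)[OF time_interval])

lemma nonneg_I: "t \<in> I \<Longrightarrow> 0 \<le> t"
  by (rule time_interval_facts(2)[OF time_interval])

lemma down_I: "t \<in> I \<Longrightarrow> 0 \<le> s \<Longrightarrow> s \<le> t \<Longrightarrow> s \<in> I"
  by (rule time_interval_facts(3)[OF time_interval])

lemma hydrodynamic_V: "t \<in> I \<Longrightarrow> hydrodynamic (V t) (f t)"
proof -
  assume "t \<in> I"
  hence "f t \<in> P20" "f t holomorphic_on upper_half_plane" using P20_DLC by (auto simp: P20_DLC_def)
  hence "\<exists>v. hydrodynamic v (f t)" using P20_hydrodynamic by blast
  thus ?thesis unfolding V_def by (rule someI_ex)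
qed

lemma hol_f: "t \<in> I \<Longrightarrow> f t holomorphic_on upper_half_plane"
  and inj_f: "t \<in> I \<Longrightarrow> inj_on (f t) upper_half_plane"
  and f_zero: "0 < Im z \<Longrightarrow> f 0 z = z"
  using P20_DLC by (auto simp: P20_DLC_def)

lemma image_f: "s \<in> I \<Longrightarrow> t \<in> I \<Longrightarrow> s \<le> t \<Longrightarrow> 0 < Im z \<Longrightarrow> \<exists>w. 0 < Im w \<and> f s w = f t z"
proof -
  assume a: "s \<in> I" "t \<in> I" "s \<le> t" "0 < Im z"
  hence "f t ` upper_half_plane \<subseteq> f s ` upper_half_plane" using P20_DLC by (auto simp: P20_DLC_def)
  hence "f t z \<in> f s ` upper_half_plane" using a(4) by (auto simp: image_subset_iff)
  thus ?thesis by auto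
qed

lemma f_limit: "t \<in> I \<Longrightarrow> compact K \<Longrightarrow> K \<subseteq> upper_half_plane \<Longrightarrow> uniform_limit K f (f t) (at t within I)"
  using P20_DLC by (auto simp: P20_DLC_def)

lemma \<phi>_pos: "s \<in> I \<Longrightarrow> t \<in> I \<Longrightarrow> s \<le> t \<Longrightarrow> 0 < Im z \<Longrightarrow> 0 < Im (\<phi> s t z)"
  and f_\<phi>: "s \<in> I \<Longrightarrow> t \<in> I \<Longrightarrow> s \<le> t \<Longrightarrow> 0 < Im z \<Longrightarrow> f s (\<phi> s t z) = f t z"
proof -
  assume a: "s \<in> I" "t \<in> I" "s \<le> t" "0 < Im z"
  have m: "f t z \<in> f s ` upper_half_plane" using image_f[OF a] by (metis image_eqI uhp_iff)
  show "0 < Im (\<phi> s t z)" using inv_into_into[OF m] by (simp add: reverse_evolution_def)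
  show "f s (\<phi> s t z) = f t z" using f_inv_into_f[OF m] by (simp add: reverse_evolution_def)
qed

lemma \<phi>_eqI:
  assumes "s \<in> I" "0 < Im w" "f s w = f t z"
  shows "\<phi> s t z = w"
proof -
  have "inv_into upper_half_plane (f s) (f s w) = w" using assms by (intro inv_into_f_f inj_f) auto
  thus ?thesis using assms by (simp add: reverse_evolution_def)
qed

lemma \<phi>_self: "t \<in> I \<Longrightarrow> 0 < Im z \<Longrightarrow> \<phi> t t z = z"
  by (rule \<phi>_eqI) auto

lemma \<phi>_compose:
  assumes "s \<in> I" "t \<in> I" "u \<in> I" "s \<le> t" "t \<le> u" "0 < Im z"
  shows "\<phi> s t (\<phi> t u z) = \<phi> s u z"
proof (rule \<phi>_eqI[OF assms(1), symmetric])
  have "0 < Im (\<phi> t u z)" using assms by (intro \<phi>_pos)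
  thus "0 < Im (\<phi> s t (\<phi> t u z))" "f s (\<phi> s t (\<phi> t u z)) = f u z"
    using assms by (simp_all add: f_\<phi> \<phi>_pos)
qed

lemma hol_\<phi>:
  assumes "s \<in> I" "t \<in> I" "s \<le> t"
  shows "\<phi> s t holomorphic_on upper_half_plane"
proof -
  obtain g where g: "g holomorphic_on f s ` upper_half_plane" "\<And>z. z \<in> upper_half_plane \<Longrightarrow> g (f s z) = z"
    using holomorphic_has_inverse[OF hol_f[OF assms(1)] open_uhp inj_f[OF assms(1)]] by metis
  have sub: "f t ` upper_half_plane \<subseteq> f s ` upper_half_plane"
    using image_f[OF assms] by (force simp: image_iff)
  have "(g \<circ> f t) holomorphic_on upper_half_plane"
    by (rule holomorphic_on_compose_gen[OF hol_f[OF assms(2)] g(1) sub])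
  moreover have "(g \<circ> f t) z = \<phi> s t z" if "z \<in> upper_half_plane" for z
    using that g(2)[of "\<phi> s t z"] assms by (simp add: f_\<phi> \<phi>_pos)
  ultimately show ?thesis by (rule holomorphic_transform)
qed

text \<open>Near infinity \<open>\<phi> s t z\<close> solves \<open>w = \<zeta> - (f s w - w)\<close> with \<open>\<zeta> = f t z\<close>. For large \<open>y\<close> the right-hand side
  maps the disc about \<open>\<zeta>\<close> of radius \<open>Im \<zeta> / 2\<close> into itself, so Brouwer's theorem provides a solution there,
  and by univalence of \<open>f s\<close> it is \<open>\<phi> s t z\<close>.\<close>

lemma \<phi>_near:
  assumes "s \<in> I" "t \<in> I" "s \<le> t" "0 < y" "4 * V s \<le> y\<^sup>2"
  defines "z \<equiv> \<i> * of_real y"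
  shows "y / 2 \<le> Im (\<phi> s t z)" and "norm (\<phi> s t z - z) \<le> (2 * V s + V t) / y"
proof -
  have z: "0 < Im z" "Im z = y" using assms by auto
  define \<zeta> where "\<zeta> = f t z"
  have \<zeta>: "y \<le> Im \<zeta>" using hydrodynamic_V[OF assms(2)] z by (auto simp: hydrodynamic_def \<zeta>_def)
  have V: "0 \<le> V s" "0 \<le> V t" using hydrodynamic_nonneg hydrodynamic_V assms by auto
  define B where "B = cball \<zeta> (Im \<zeta> / 2)"
  have ImB: "Im \<zeta> / 2 \<le> Im w" if "w \<in> B" for w
    using that abs_Im_le_cmod[of "\<zeta> - w"] by (auto simp: B_def dist_norm)
  have small: "norm (f s w - w) \<le> V s / (Im \<zeta> / 2)" if "w \<in> B" for w
  proof -
    have "norm (f s w - w) \<le> V s / Im w"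
      using ImB[OF that] \<zeta> assms(4) by (intro hydrodynamic_bound hydrodynamic_V assms) auto
    also have "\<dots> \<le> V s / (Im \<zeta> / 2)" using V ImB[OF that] \<zeta> assms(4) by (intro divide_left_mono) auto
    finally show ?thesis .
  qed
  have "y\<^sup>2 \<le> (Im \<zeta>)\<^sup>2" using \<zeta> assms(4) by (intro power_mono) auto
  hence "4 * V s \<le> (Im \<zeta>)\<^sup>2" using assms(5) by linarith
  hence q: "V s / (Im \<zeta> / 2) \<le> Im \<zeta> / 2" using \<zeta> assms(4)
    by (simp add: field_simps power2_eq_square)
  obtain w where w: "w \<in> B" "\<zeta> - (f s w - w) = w"
  proof (rule brouwer[of B "\<lambda>w. \<zeta> - (f s w - w)"])
    show "compact B" "convex B" "B \<noteq> {}" unfolding B_def using \<zeta> assms(4) by auto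
    have "B \<subseteq> upper_half_plane" using ImB \<zeta> assms(4) by force
    thus "continuous_on B (\<lambda>w. \<zeta> - (f s w - w))"
      by (intro continuous_intros continuous_on_subset[OF holomorphic_on_imp_continuous_on[OF hol_f[OF assms(1)]]])
    show "(\<lambda>w. \<zeta> - (f s w - w)) \<in> B \<rightarrow> B" using order_trans[OF small q] by (auto simp: B_def dist_norm)
  qed
  have "f s w = \<zeta>" using w(2) by (simp add: algebra_simps)
  hence e: "\<phi> s t z = w" using ImB[OF w(1)] \<zeta> assms(4) by (intro \<phi>_eqI assms) (auto simp: \<zeta>_def)
  show "y / 2 \<le> Im (\<phi> s t z)" using ImB[OF w(1)] \<zeta> e by simp
  have "norm (w - z) = norm ((\<zeta> - z) - (f s w - w))" using \<open>f s w = \<zeta>\<close> by (simp add: algebra_simps)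
  also have "\<dots> \<le> norm (\<zeta> - z) + norm (f s w - w)" by (rule norm_triangle_ineq4)
  also have "norm (\<zeta> - z) \<le> V t / y" using hydrodynamic_bound[OF hydrodynamic_V[OF assms(2)] z(1)] z(2) by (simp add: \<zeta>_def)
  also have "norm (f s w - w) \<le> V s / (y / 2)"
    using small[OF w(1)] V \<zeta> assms(4) by (elim order_trans) (auto intro!: divide_left_mono)
  finally show "norm (\<phi> s t z - z) \<le> (2 * V s + V t) / y" unfolding e by (simp add: add_divide_distrib mult.commute)
qed

text \<open>With \<open>w = \<phi> s t z\<close> one has \<open>w - z = (f t z - z) - (f s w - w)\<close>. Since \<open>w - z = O(1/y)\<close> and \<open>f s - id\<close>
  has Lipschitz constant \<open>O(1/y\<^sup>2)\<close> there, \<open>w\<close> may be replaced by \<open>z\<close> in the last bracket.\<close>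

lemma hydrodynamic_\<phi>:
  assumes "s \<in> I" "t \<in> I" "s \<le> t"
  shows "hydrodynamic (V t - V s) (\<phi> s t)"
proof (rule hydrodynamicI[OF hol_\<phi>[OF assms] \<phi>_pos[OF assms]])
  let ?z = "\<lambda>y::real. \<i> * complex_of_real y"
  let ?g = "\<lambda>t z. f t z - z"
  have V: "0 \<le> V s" "0 \<le> V t" using hydrodynamic_nonneg hydrodynamic_V assms by auto
  have ev: "eventually (\<lambda>y. 0 < y \<and> 4 * V s \<le> y\<^sup>2) at_top"
  proof -
    have "eventually (\<lambda>y. max 1 (4 * V s) \<le> y) at_top" by (rule eventually_ge_at_top)
    thus ?thesis
    proof eventually_elim
      case (elim y)
      hence "y * 1 \<le> y * y" by (intro mult_left_mono) auto
      moreover have "0 < y" "4 * V s \<le> y" using elim by auto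
      ultimately show ?case unfolding power2_eq_square by linarith
    qed
  qed
  have "((\<lambda>y. of_real y * ?g s (?z y) - of_real y * ?g s (\<phi> s t (?z y))) \<longlongrightarrow> 0) at_top"
  proof (rule Lim_null_comparison)
    show "((\<lambda>y. (2 * V s * (2 * V s + V t)) * (inverse y * inverse y)) \<longlongrightarrow> 0) at_top"
      by (rule tendsto_eq_rhs) (rule tendsto_intros tendsto_inverse_0_at_top filterlim_ident | simp)+
    show "eventually (\<lambda>y. norm (of_real y * ?g s (?z y) - of_real y * ?g s (\<phi> s t (?z y))) \<le> (2 * V s * (2 * V s + V t)) * (inverse y * inverse y)) at_top"
      using ev
    proof eventually_elim
      case (elim y)
      note n = \<phi>_near[OF assms, of y]
      let ?w = "\<phi> s t (?z y)"
      have w: "y / 2 \<le> Im ?w" "norm (?z y - ?w) \<le> (2 * V s + V t) / y" using n elim by (auto simp: norm_minus_commute)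
      have "norm (of_real y * ?g s (?z y) - of_real y * ?g s ?w) = y * norm (?g s (?z y) - ?g s ?w)"
        using elim by (simp add: right_diff_distrib[symmetric] norm_mult)
      also have "\<dots> \<le> y * (V s * norm (?z y - ?w) / (y * Im ?w))"
        using hydrodynamic_lipschitz[OF hydrodynamic_V[OF assms(1)], of "?z y" ?w] w elim by (intro mult_left_mono) auto
      also have "\<dots> = V s * norm (?z y - ?w) / Im ?w" using elim by simp
      also have "\<dots> \<le> V s * ((2 * V s + V t) / y) / (y / 2)"
        using w V elim by (intro frac_le mult_left_mono mult_nonneg_nonneg divide_nonneg_nonneg) auto
      finally show ?case using elim by (simp add: field_simps)
    qed
  qed
  hence "((\<lambda>y. of_real y * ?g t (?z y) - of_real y * ?g s (?z y) + (of_real y * ?g s (?z y) - of_real y * ?g s (\<phi> s t (?z y)))) \<longlongrightarrow> \<i> * of_real (V t) - \<i> * of_real (V s) + 0) at_top"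
    using hydrodynamic_V[OF assms(1)] hydrodynamic_V[OF assms(2)] by (intro tendsto_add tendsto_diff) (auto simp: hydrodynamic_def)
  moreover have "eventually (\<lambda>y. of_real y * ?g t (?z y) - of_real y * ?g s (?z y) + (of_real y * ?g s (?z y) - of_real y * ?g s (\<phi> s t (?z y))) = of_real y * (\<phi> s t (?z y) - ?z y)) at_top"
    using eventually_gt_at_top[of 0] by eventually_elim (simp add: f_\<phi>[OF assms] algebra_simps)
  ultimately have "((\<lambda>y. of_real y * (\<phi> s t (?z y) - ?z y)) \<longlongrightarrow> \<i> * of_real (V t) - \<i> * of_real (V s) + 0) at_top"
    by (rule Lim_transform_eventually)
  thus "((\<lambda>y. of_real y * (\<phi> s t (?z y) - ?z y)) \<longlongrightarrow> \<i> * of_real (V t - V s)) at_top"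
    by (simp add: right_diff_distrib)
qed

lemma sub_I: "s \<in> I \<Longrightarrow> t \<in> I \<Longrightarrow> {s..t} \<subseteq> I"
proof
  fix r assume "s \<in> I" "t \<in> I" "r \<in> {s..t}"
  thus "r \<in> I" using down_I[of t r] nonneg_I[of s] by simp
qed

lemma V_mono: "s \<in> I \<Longrightarrow> t \<in> I \<Longrightarrow> s \<le> t \<Longrightarrow> V s \<le> V t"
  using hydrodynamic_nonneg[OF hydrodynamic_\<phi>, of s t] by simp

lemma V_nonneg: "t \<in> I \<Longrightarrow> 0 \<le> V t"
  using hydrodynamic_nonneg[OF hydrodynamic_V] .

lemma V_zero: "V 0 = 0"
  by (rule hydrodynamic_unique[OF hydrodynamic_V[OF zero_in_I] hydrodynamic_id]) (rule f_zero)

lemma \<phi>_Im_mono: "s \<in> I \<Longrightarrow> t \<in> I \<Longrightarrow> s \<le> t \<Longrightarrow> 0 < Im z \<Longrightarrow> Im z \<le> Im (\<phi> s t z)"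
  using hydrodynamic_\<phi> unfolding hydrodynamic_def by blast

lemma \<phi>_bound: "s \<in> I \<Longrightarrow> t \<in> I \<Longrightarrow> s \<le> t \<Longrightarrow> 0 < Im z \<Longrightarrow> norm (\<phi> s t z - z) \<le> (V t - V s) / Im z"
  using hydrodynamic_bound[OF hydrodynamic_\<phi>] .

text \<open>The points \<open>\<phi> u T z\<close> stay in a compact set, on which \<open>f u\<close> tends to \<open>f t0\<close> uniformly. As \<open>f u (\<phi> u T z)\<close>
  is always \<open>f T z\<close>, continuity of the inverse of \<open>f t0\<close> applies.\<close>

lemma \<phi>_right_limit:
  assumes "t0 \<in> I" "T \<in> I" "t0 < T" "0 < Im z"
  shows "((\<lambda>u. \<phi> u T z) \<longlongrightarrow> \<phi> t0 T z) (at t0 within {t0..T})"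
proof -
  have sub: "{t0..T} \<subseteq> I" using sub_I[OF assms(1,2)] .
  define w where "w = \<phi> t0 T z"
  define K where "K = cball z (V T / Im z) \<inter> {w. Im z \<le> Im w}"
  have wK: "\<phi> u T z \<in> K" if "u \<in> {t0..T}" for u
  proof -
    have u: "u \<in> I" "u \<le> T" using that sub by auto
    have "norm (\<phi> u T z - z) \<le> (V T - V u) / Im z" using u assms by (intro \<phi>_bound) auto
    also have "\<dots> \<le> V T / Im z" using assms V_nonneg[OF u(1)] by (intro divide_right_mono) auto
    finally show ?thesis using \<phi>_Im_mono[OF u(1) assms(2) u(2) assms(4)]
      by (simp add: K_def dist_norm norm_minus_commute)
  qed
  have K: "compact K" "K \<subseteq> upper_half_plane" unfolding K_def
    using assms(4) by (auto intro!: compact_Int_closed closed_halfspace_Im_ge)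
  obtain g where g: "g holomorphic_on f t0 ` upper_half_plane" "\<And>z. z \<in> upper_half_plane \<Longrightarrow> g (f t0 z) = z"
    using holomorphic_has_inverse[OF hol_f[OF assms(1)] open_uhp inj_f[OF assms(1)]] by metis
  have op: "open (f t0 ` upper_half_plane)"
    using open_mapping_thm3[OF hol_f[OF assms(1)] open_uhp inj_f[OF assms(1)]] .
  have wpos: "0 < Im w" unfolding w_def using assms by (intro \<phi>_pos) auto
  have ul: "uniform_limit K f (f t0) (at t0 within {t0..T})"
    using at_le[OF sub] f_limit[OF assms(1) K] by (rule filterlim_mono[OF _ order_refl, rotated])
  have "((\<lambda>u. f t0 (\<phi> u T z)) \<longlongrightarrow> f t0 w) (at t0 within {t0..T})"
  proof (rule tendstoI)
    fix e :: real assume "0 < e"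
    with ul have "eventually (\<lambda>u. \<forall>x\<in>K. dist (f u x) (f t0 x) < e) (at t0 within {t0..T})"
      unfolding uniform_limit_iff by auto
    moreover have "eventually (\<lambda>u. u \<in> {t0..T}) (at t0 within {t0..T})"
      by (auto simp: eventually_at_filter)
    ultimately show "eventually (\<lambda>u. dist (f t0 (\<phi> u T z)) (f t0 w) < e) (at t0 within {t0..T})"
    proof eventually_elim
      case (elim u)
      have "f t0 w = f T z" unfolding w_def using assms by (intro f_\<phi>) auto
      also have "\<dots> = f u (\<phi> u T z)" using elim(2) sub assms by (intro f_\<phi>[symmetric]) auto
      finally show ?case using elim(1) wK[OF elim(2)] by (simp add: dist_commute)
    qed
  qed
  moreover have "isCont g (f t0 w)"
    using holomorphic_on_imp_continuous_on[OF g(1)] op wpos by (auto simp: continuous_on_eq_continuous_at)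
  ultimately have "((\<lambda>u. g (f t0 (\<phi> u T z))) \<longlongrightarrow> g (f t0 w)) (at t0 within {t0..T})"
    by (rule isCont_tendsto_compose[rotated])
  moreover have "eventually (\<lambda>u. g (f t0 (\<phi> u T z)) = \<phi> u T z) (at t0 within {t0..T})"
    unfolding eventually_at_filter using wK K by (auto intro!: always_eventually g(2))
  ultimately have "((\<lambda>u. \<phi> u T z) \<longlongrightarrow> g (f t0 w)) (at t0 within {t0..T})" by (rule Lim_transform_eventually)
  thus ?thesis using g(2)[of w] wpos by (simp add: w_def)
qed

text \<open>Lower semicontinuity along \<open>f\<close> and monotonicity leave only a jump to the right to be excluded. For that,
  lower semicontinuity is applied to \<open>\<phi> u T\<close>, whose coefficient \<open>V T - V u\<close> has the opposite monotonicity.\<close>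

lemma V_continuous: "continuous_on I V"
  unfolding continuous_on_def
proof (intro ballI order_tendstoI)
  fix t0 a assume t0: "t0 \<in> I" and a: "a < V t0"
  have inI: "eventually (\<lambda>u. u \<in> I) (at t0 within I)" by (auto simp: eventually_at_filter)
  have "eventually (\<lambda>u. V t0 - (V t0 - a) < V u) (at t0 within I)"
  proof (rule hydrodynamic_lower_semicontinuous[where k=f and ?k0.0="f t0"])
    show "eventually (\<lambda>u. hydrodynamic (V u) (f u)) (at t0 within I)" using inI by eventually_elim (rule hydrodynamic_V)
    show "((\<lambda>u. f u z) \<longlongrightarrow> f t0 z) (at t0 within I)" if "0 < Im z" for z
      using tendsto_uniform_limitI[OF f_limit[OF t0, of "{z}"], of z] that by simp
    show "hydrodynamic (V t0) (f t0)" using t0 by (rule hydrodynamic_V)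
    show "0 < V t0 - a" using a by simp
  qed
  thus "eventually (\<lambda>u. a < V u) (at t0 within I)" by simp
next
  fix t0 a assume t0: "t0 \<in> I" and a: "V t0 < a"
  show "eventually (\<lambda>u. V u < a) (at t0 within I)"
  proof (cases "\<exists>T\<in>I. t0 < T")
    case False
    hence "V u < a" if "u \<in> I" for u using that V_mono[OF that t0] a by (metis le_less_trans not_le)
    thus ?thesis unfolding eventually_at_filter by (intro always_eventually) auto
  next
    case True
    then obtain T where T: "T \<in> I" "t0 < T" by blast
    have sub: "{t0..T} \<subseteq> I" using sub_I[OF t0 T(1)] .
    have "eventually (\<lambda>u. (V T - V t0) - (a - V t0) < V T - V u) (at t0 within {t0..T})"
    proof (rule hydrodynamic_lower_semicontinuous[where k="\<lambda>u. \<phi> u T" and ?k0.0="\<phi> t0 T"])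
      show "eventually (\<lambda>u. hydrodynamic (V T - V u) (\<phi> u T)) (at t0 within {t0..T})"
        unfolding eventually_at_filter
      proof (intro always_eventually allI impI)
        fix u assume "u \<in> {t0..T}"
        thus "hydrodynamic (V T - V u) (\<phi> u T)" using sub T by (intro hydrodynamic_\<phi>) auto
      qed
      show "((\<lambda>u. \<phi> u T z) \<longlongrightarrow> \<phi> t0 T z) (at t0 within {t0..T})" if "0 < Im z" for z
        using \<phi>_right_limit t0 T that by auto
      show "hydrodynamic (V T - V t0) (\<phi> t0 T)" using t0 T by (intro hydrodynamic_\<phi>) auto
      show "0 < a - V t0" using a by simp
    qed
    hence "eventually (\<lambda>u. u \<noteq> t0 \<longrightarrow> u \<in> {t0..T} \<longrightarrow> V u < a) (nhds t0)"
      by (simp add: eventually_at_filter)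
    moreover have "eventually (\<lambda>u. u < T) (nhds t0)" using T by (intro order_tendstoD(2)[OF filterlim_ident]) 
    ultimately have "eventually (\<lambda>u. u \<noteq> t0 \<longrightarrow> u \<in> I \<longrightarrow> V u < a) (nhds t0)"
    proof eventually_elim
      case (elim u)
      show ?case
      proof (intro impI)
        assume u: "u \<noteq> t0" "u \<in> I"
        show "V u < a"
        proof (cases "u \<le> t0")
          case True thus ?thesis using V_mono[OF u(2) t0 True] a by simp
        next
          case False thus ?thesis using elim u by auto
        qed
      qed
    qed
    thus ?thesis by (simp add: eventually_at_filter)
  qed
qed

lemma I_borel: "I \<in> sets borel"
  by (rule time_interval_facts(4)[OF time_interval])

sublocale time?: clock I V
  by (rule clock.intro[OF zero_in_I nonneg_I down_I V_zero V_mono V_continuous I_borel])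

lemma \<phi>_time_lipschitz:
  assumes "u \<in> I" "v \<in> I" "t \<in> I" "u \<le> v" "v \<le> t" "0 < Im z"
  shows "norm (\<phi> u t z - \<phi> v t z) \<le> (V v - V u) / Im z"
proof -
  let ?w = "\<phi> v t z"
  have w: "0 < Im ?w" "Im z \<le> Im ?w" using assms by (auto intro!: \<phi>_pos \<phi>_Im_mono)
  have "norm (\<phi> u v ?w - ?w) \<le> (V v - V u) / Im ?w" using assms w by (intro \<phi>_bound) auto
  also have "\<dots> \<le> (V v - V u) / Im z" using w assms V_mono[of u v] by (intro divide_left_mono) auto
  finally show ?thesis using \<phi>_compose[of u v t z] assms by simp
qed

text \<open>The displacement is almost additive: by the composition rule the defect is the variation of \<open>\<phi> s t - id\<close>
  between \<open>\<phi> t u z\<close> and \<open>z\<close>.\<close>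

lemma \<phi>_defect:
  assumes "s \<in> I" "t \<in> I" "u \<in> I" "s \<le> t" "t \<le> u" "0 < Im z"
  shows "norm ((\<phi> s u z - z) - (\<phi> s t z - z) - (\<phi> t u z - z)) \<le> 1 / (Im z)^3 * ((V t - V s) * (V u - V t))"
proof -
  let ?w = "\<phi> t u z"
  have w: "0 < Im ?w" "Im z \<le> Im ?w" using assms by (auto intro!: \<phi>_pos \<phi>_Im_mono)
  have V: "0 \<le> V t - V s" "0 \<le> V u - V t" using V_mono assms by auto
  have "(\<phi> s u z - z) - (\<phi> s t z - z) - (\<phi> t u z - z) = (\<phi> s t ?w - ?w) - (\<phi> s t z - z)"
    using \<phi>_compose[of s t u z] assms by simp
  also have "norm \<dots> \<le> (V t - V s) * norm (?w - z) / (Im ?w * Im z)"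
    using assms w by (intro hydrodynamic_lipschitz hydrodynamic_\<phi>) auto
  also have "\<dots> \<le> (V t - V s) * ((V u - V t) / Im z) / (Im z * Im z)"
    using V w assms \<phi>_bound[of t u z] by (intro frac_le mult_left_mono mult_right_mono mult_nonneg_nonneg) auto
  finally show ?thesis by (simp add: power3_eq_cube)
qed

lemma f_time_lipschitz:
  assumes "s \<in> I" "t \<in> I" "s \<le> t" "0 < y" "y \<le> Im z" "V s \<le> b"
  shows "norm (f t z - f s z) \<le> (1 + b / y\<^sup>2) / y * (V t - V s)"
proof -
  have z: "0 < Im z" using assms by simp
  let ?w = "\<phi> s t z"
  have w: "0 < Im ?w" "Im z \<le> Im ?w" using assms z by (auto intro!: \<phi>_pos \<phi>_Im_mono)
  have V: "0 \<le> V t - V s" "0 \<le> V s" "0 \<le> b" using V_mono V_nonneg[of s] assms by auto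
  have wz: "norm (?w - z) \<le> (V t - V s) / y"
  proof -
    have "norm (?w - z) \<le> (V t - V s) / Im z" using assms z by (intro \<phi>_bound) auto
    also have "\<dots> \<le> (V t - V s) / y" using V assms by (intro divide_left_mono) auto
    finally show ?thesis .
  qed
  have "norm ((f s ?w - ?w) - (f s z - z)) \<le> V s * norm (?w - z) / (Im ?w * Im z)"
    using assms w z by (intro hydrodynamic_lipschitz hydrodynamic_V) auto
  also have "\<dots> \<le> b * norm (?w - z) / (y * y)"
    using V w z assms by (intro frac_le mult_mono mult_right_mono mult_nonneg_nonneg) auto
  finally have 1: "norm ((f s ?w - ?w) - (f s z - z)) \<le> b / y\<^sup>2 * norm (?w - z)" by (simp add: power2_eq_square)
  have "f t z - f s z = (?w - z) + ((f s ?w - ?w) - (f s z - z))" using f_\<phi>[of s t z] assms z by simp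
  hence "norm (f t z - f s z) \<le> norm (?w - z) + b / y\<^sup>2 * norm (?w - z)" using 1 by (metis norm_triangle_le add_left_mono)
  also have "\<dots> = (1 + b / y\<^sup>2) * norm (?w - z)" by (simp add: algebra_simps)
  also have "\<dots> \<le> (1 + b / y\<^sup>2) * ((V t - V s) / y)" using wz V by (intro mult_left_mono) auto
  finally show ?thesis by simp
qed

lemma deriv_f_time_lipschitz:
  assumes "s \<in> I" "t \<in> I" "s \<le> t" "0 < Im z" "V s \<le> b"
  shows "norm (deriv (f t) z - deriv (f s) z) \<le> (1 + b / (Im z / 2)\<^sup>2) / (Im z / 2) / (Im z / 2) * (V t - V s)"
proof -
  let ?y = "Im z / 2"
  let ?h = "\<lambda>z. f t z - f s z"
  have Im: "?y \<le> Im x" if "x \<in> cball z ?y" for x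
    using that abs_Im_le_cmod[of "z - x"] by (auto simp: dist_norm)
  have sub: "cball z ?y \<subseteq> upper_half_plane" using Im assms(4) by force
  have hol: "?h holomorphic_on upper_half_plane" by (intro holomorphic_intros hol_f assms)
  have "norm ((deriv ^^ 1) ?h z) \<le> fact 1 * ((1 + b / ?y\<^sup>2) / ?y * (V t - V s)) / ?y ^ 1"
  proof (rule Cauchy_inequality)
    show "?h holomorphic_on ball z ?y" using hol sub ball_subset_cball by (meson holomorphic_on_subset order_trans)
    show "continuous_on (cball z ?y) ?h" by (rule continuous_on_subset[OF holomorphic_on_imp_continuous_on[OF hol] sub])
    show "0 < ?y" using assms by simp
    fix x assume "norm (z - x) = ?y"
    thus "norm (?h x) \<le> (1 + b / ?y\<^sup>2) / ?y * (V t - V s)" using assms Im[of x] by (intro f_time_lipschitz) (auto simp: dist_norm)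
  qed
  moreover have "(deriv ^^ 1) ?h z = deriv (f t) z - deriv (f s) z"
    using hol_f assms open_uhp by (simp, intro deriv_diff) (auto intro!: holomorphic_on_imp_differentiable_at)
  moreover have "fact 1 * (q * d) / y ^ 1 = q / y * d" for q d y :: real by simp
  ultimately show ?thesis by (simp only:)
qed

lemma deriv_f_continuous:
  assumes "t \<in> I" "0 < Im z"
  shows "continuous_on {0..t} (\<lambda>s. deriv (f s) z)"
  unfolding continuous_on_def
proof
  fix s0 assume s0: "s0 \<in> {0..t}"
  define K where "K = (1 + V t / (Im z / 2)\<^sup>2) / (Im z / 2) / (Im z / 2)"
  have lip: "norm (deriv (f u) z - deriv (f v) z) \<le> K * \<bar>V u - V v\<bar>" if "u \<in> {0..t}" "v \<in> {0..t}" "v \<le> u" for u v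
  proof -
    have uv: "u \<in> I" "v \<in> I" using that subset_I[OF assms(1)] by auto
    have "norm (deriv (f u) z - deriv (f v) z) \<le> K * (V u - V v)"
      unfolding K_def using that uv assms V_mono[of v t] by (intro deriv_f_time_lipschitz) auto
    thus ?thesis using V_mono[of v u] uv that by simp
  qed
  have lip': "norm (deriv (f s) z - deriv (f s0) z) \<le> K * \<bar>V s - V s0\<bar>" if "s \<in> {0..t}" for s
  proof (cases "s0 \<le> s")
    case True thus ?thesis using lip[OF that s0] by simp
  next
    case False
    hence "norm (deriv (f s0) z - deriv (f s) z) \<le> K * \<bar>V s0 - V s\<bar>" using lip[OF s0 that] by simp
    thus ?thesis by (simp only: norm_minus_commute abs_minus_commute)
  qed
  have "((\<lambda>s. deriv (f s) z - deriv (f s0) z) \<longlongrightarrow> 0) (at s0 within {0..t})"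
  proof (rule Lim_null_comparison)
    show "eventually (\<lambda>s. norm (deriv (f s) z - deriv (f s0) z) \<le> K * \<bar>V s - V s0\<bar>) (at s0 within {0..t})"
      unfolding eventually_at_filter by (intro always_eventually allI impI lip')
    have "(V \<longlongrightarrow> V s0) (at s0 within {0..t})"
      using continuous_on_subset[OF V_continuous subset_I[OF assms(1)]] s0 by (auto simp: continuous_on_def)
    hence "((\<lambda>s. K * \<bar>V s - V s0\<bar>) \<longlongrightarrow> K * \<bar>V s0 - V s0\<bar>) (at s0 within {0..t})" by (intro tendsto_intros)
    thus "((\<lambda>s. K * \<bar>V s - V s0\<bar>) \<longlongrightarrow> 0) (at s0 within {0..t})" by simp
  qed
  thus "((\<lambda>s. deriv (f s) z) \<longlongrightarrow> deriv (f s0) z) (at s0 within {0..t})" using Lim_null by blast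
qed

lemma deriv_f_nonzero: "t \<in> I \<Longrightarrow> 0 < Im z \<Longrightarrow> deriv (f t) z \<noteq> 0"
  by (rule holomorphic_injective_imp_regular[OF hol_f open_uhp inj_f]) auto

text \<open>First-order expansion of \<open>f u\<close> at \<open>z\<close>, evaluated at \<open>\<phi> u v z\<close>, where \<open>f u\<close> takes the value \<open>f v z\<close>.
  The bound on the second derivative is Cauchy's estimate on discs of radius \<open>Im z / 4\<close>.\<close>

lemma f_taylor:
  assumes "u \<in> I" "v \<in> I" "u \<le> v" "0 < Im z" "V u \<le> b"
  shows "norm (f v z - f u z - deriv (f u) z * (\<phi> u v z - z)) \<le> 128 * b / (Im z)^5 * (V v - V u)\<^sup>2"
proof -
  define y where "y = Im z"
  have y: "0 < y" using assms by (simp add: y_def)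
  define g where "g = (\<lambda>z. f u z - z)"
  let ?w = "\<phi> u v z"
  have V: "0 \<le> V u" "0 \<le> b" "0 \<le> V v - V u" using V_nonneg[OF assms(1)] assms V_mono by auto
  have w: "y \<le> Im ?w" unfolding y_def using assms by (intro \<phi>_Im_mono) auto
  have holg: "g holomorphic_on upper_half_plane" unfolding g_def by (intro holomorphic_intros hol_f assms)
  have gb: "norm (g x) \<le> b / (y / 4)" if "y / 4 \<le> Im x" for x
  proof -
    have "norm (g x) \<le> V u / Im x" unfolding g_def using assms that y by (intro hydrodynamic_bound hydrodynamic_V) auto
    also have "\<dots> \<le> b / (y / 4)" using V that y assms by (intro frac_le) auto
    finally show ?thesis .
  qed
  have d2: "norm ((deriv ^^ 2) g x) \<le> 128 * b / y^3" if "x \<in> {x. y / 2 < Im x}" for x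
  proof -
    have Im: "y / 4 \<le> Im a" if "a \<in> cball x (y / 4)" for a
      using that \<open>x \<in> _\<close> abs_Im_le_cmod[of "x - a"] y by (auto simp: dist_norm)
    have sub: "cball x (y / 4) \<subseteq> upper_half_plane" using Im y by force
    have "norm ((deriv ^^ 2) g x) \<le> fact 2 * (b / (y / 4)) / (y / 4) ^ 2"
    proof (rule Cauchy_inequality)
      show "g holomorphic_on ball x (y / 4)" using holg sub ball_subset_cball by (meson holomorphic_on_subset order_trans)
      show "continuous_on (cball x (y / 4)) g" by (rule continuous_on_subset[OF holomorphic_on_imp_continuous_on[OF holg] sub])
      fix a assume "norm (x - a) = y / 4"
      thus "norm (g a) \<le> b / (y / 4)" by (intro gb Im) (simp add: dist_norm)
    qed (use y in simp)
    also have "\<dots> = 128 * b / y^3" by (simp add: fact_2 power2_eq_square power3_eq_cube)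
    finally show ?thesis .
  qed
  have "norm ((deriv ^^ 0) g ?w - (\<Sum>i\<le>1. (deriv ^^ i) g z * (?w - z) ^ i / fact i)) \<le> 128 * b / y^3 * norm (?w - z) ^ Suc 1 / fact 1"
  proof (rule complex_Taylor[where S="{x. y / 2 < Im x}"])
    show "convex {x. y / 2 < Im x}" by (rule convex_halfspace_Im_gt)
    fix i x assume x: "x \<in> {x. y / 2 < Im x}"
    have "(deriv ^^ i) g field_differentiable at x"
      using holomorphic_higher_deriv[OF holg open_uhp] open_uhp x y by (intro holomorphic_on_imp_differentiable_at) auto
    thus "((deriv ^^ i) g has_field_derivative (deriv ^^ Suc i) g x) (at x within {x. y / 2 < Im x})"
      by (auto simp: DERIV_deriv_iff_field_differentiable intro: has_field_derivative_at_within)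
  next
    fix x assume "x \<in> {x. y / 2 < Im x}"
    from d2[OF this] show "norm ((deriv ^^ Suc 1) g x) \<le> 128 * b / y^3" by (simp add: numeral_2_eq_2)
  qed (use w y in \<open>auto simp: y_def\<close>)
  hence "norm (g ?w - g z - deriv g z * (?w - z)) \<le> 128 * b / y^3 * norm (?w - z) ^ 2" by (simp add: power2_eq_square algebra_simps)
  moreover have dg: "deriv g z = deriv (f u) z - 1" unfolding g_def
    using hol_f[OF assms(1)] open_uhp assms(4) by (subst deriv_diff) (auto intro!: holomorphic_on_imp_differentiable_at)
  have "g ?w - g z - deriv g z * (?w - z) = f u ?w - f u z - deriv (f u) z * (?w - z)"
    unfolding dg by (simp add: g_def algebra_simps)
  ultimately have 1: "norm (f u ?w - f u z - deriv (f u) z * (?w - z)) \<le> 128 * b / y^3 * norm (?w - z) ^ 2"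
    by (simp only:)
  have "norm (?w - z) \<le> (V v - V u) / y" unfolding y_def using assms by (intro \<phi>_bound) auto
  hence "norm (?w - z) ^ 2 \<le> ((V v - V u) / y)\<^sup>2" by (intro power_mono) auto
  hence "128 * b / y^3 * norm (?w - z) ^ 2 \<le> 128 * b / y^3 * ((V v - V u) / y)\<^sup>2" using V y by (intro mult_left_mono) auto
  also have "\<dots> = 128 * b / y^5 * (V v - V u)\<^sup>2" by (simp add: power_divide eval_nat_numeral)
  finally show ?thesis using 1 f_\<phi>[of u v z] assms by (simp add: y_def)
qed

text \<open>The additive function of time that the displacements \<open>\<phi> s t z - z\<close> determine; it becomes \<open>P(z,[0,t])\<close>.\<close>

definition drive :: "real \<Rightarrow> complex \<Rightarrow> complex" where
  "drive t z = sewn (\<lambda>s t. \<phi> s t z - z) t - sewn (\<lambda>s t. \<phi> s t z - z) 0"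

context
  fixes z :: complex
  assumes z: "0 < Im z"
begin

lemma sew_bound: "s \<in> I \<Longrightarrow> t \<in> I \<Longrightarrow> s \<le> t \<Longrightarrow> norm (\<phi> s t z - z) \<le> 1 / Im z * (V t - V s)"
  using \<phi>_bound[OF _ _ _ z] by simp

lemma sew_defect: "s \<in> I \<Longrightarrow> t \<in> I \<Longrightarrow> u \<in> I \<Longrightarrow> s \<le> t \<Longrightarrow> t \<le> u \<Longrightarrow>
    norm ((\<phi> s u z - z) - (\<phi> s t z - z) - (\<phi> t u z - z)) \<le> 1 / (Im z)^3 * ((V t - V s) * (V u - V t))"
  by (rule \<phi>_defect[OF _ _ _ _ _ z])

lemma sew_consts: "0 \<le> 1 / Im z" "0 \<le> 1 / (Im z)^3"
  using z by auto

lemma drive_approx: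
  assumes "s \<in> I" "t \<in> I" "s \<le> t"
  shows "norm (drive t z - drive s z - (\<phi> s t z - z)) \<le> 1 / (Im z)^3 * (V t - V s)\<^sup>2"
  using sewing[OF sew_bound sew_defect sew_consts assms] by (simp add: drive_def)

lemma drive_increment_norm:
  assumes "s \<in> I" "t \<in> I" "s \<le> t"
  shows "norm (drive t z - drive s z) \<le> (V t - V s) / Im z"
  using sewn_increment_norm[OF sew_bound sew_defect sew_consts assms] by (simp add: drive_def)

lemma drive_increment_Im:
  assumes "s \<in> I" "t \<in> I" "s \<le> t"
  shows "0 \<le> Im (drive t z - drive s z)"
proof -
  have "0 \<le> Im (sewn (\<lambda>s t. \<phi> s t z - z) t - sewn (\<lambda>s t. \<phi> s t z - z) s)"
  proof (rule sewn_Im_mono[OF sew_bound sew_defect sew_consts assms])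
    fix s t assume "s \<in> I" "t \<in> I" "s \<le> t"
    from \<phi>_Im_mono[OF this z] show "0 \<le> Im (\<phi> s t z - z)" by simp
  qed
  thus ?thesis by (simp add: drive_def)
qed

lemma drive_dyadic:
  assumes "t \<in> I"
  shows "norm (sewn (\<lambda>s t. \<phi> s t z - z) t - dyadic_sum (\<lambda>s t. \<phi> s t z - z) n t) \<le> (1 / (Im z)^3 * V t / 2 + 1 / Im z) * (1 / 2) ^ n"
  by (rule dyadic_sum_bound(1)[OF sew_bound sew_defect sew_consts assms])

end

lemma drive_zero: "drive 0 z = 0"
  by (simp add: drive_def)

text \<open>The dyadic sums converge locally uniformly, since the error bound depends on \<open>z\<close> only through \<open>Im z\<close>.\<close>

lemma holomorphic_sewn:
  assumes t: "t \<in> I"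
  shows "(\<lambda>z. sewn (\<lambda>s t. \<phi> s t z - z) t) holomorphic_on upper_half_plane"
proof (rule holomorphic_uniform_sequence[OF open_uhp])
  fix n
  have "grid n i \<in> I \<and> grid n (Suc i) \<in> I \<and> grid n i \<le> grid n (Suc i)" if "i \<in> {0..<cells n t}" for i
    using that by (auto intro!: grid(1)[OF t] grid_mono[OF t])
  thus "(\<lambda>z. dyadic_sum (\<lambda>s t. \<phi> s t z - z) n t) holomorphic_on upper_half_plane"
    unfolding dyadic_sum_def by (intro holomorphic_intros hol_\<phi>) auto
next
  fix z assume "z \<in> upper_half_plane"
  hence z: "0 < Im z" by simp
  let ?y = "Im z / 2"
  have Im: "?y \<le> Im x" if "x \<in> cball z ?y" for x
    using that abs_Im_le_cmod[of "z - x"] by (auto simp: dist_norm)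
  have sub: "cball z ?y \<subseteq> upper_half_plane" using Im z by force
  have "uniform_limit (cball z ?y) (\<lambda>n z. dyadic_sum (\<lambda>s t. \<phi> s t z - z) n t) (\<lambda>z. sewn (\<lambda>s t. \<phi> s t z - z) t) sequentially"
  proof (rule uniform_limitI)
    fix e :: real assume e: "0 < e"
    let ?K = "1 / ?y^3 * V t / 2 + 1 / ?y"
    have "(\<lambda>n. ?K * (1 / 2) ^ n) \<longlonglongrightarrow> ?K * 0" by (intro tendsto_intros) auto
    hence "eventually (\<lambda>n. ?K * (1 / 2) ^ n < e) sequentially" using e by (intro order_tendstoD) auto
    thus "eventually (\<lambda>n. \<forall>x\<in>cball z ?y. dist (dyadic_sum (\<lambda>s t. \<phi> s t x - x) n t) (sewn (\<lambda>s t. \<phi> s t x - x) t) < e) sequentially"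
    proof eventually_elim
      case (elim n)
      show ?case
      proof
        fix x assume x: "x \<in> cball z ?y"
        have xy: "?y \<le> Im x" by (rule Im[OF x])
        have x0: "0 < Im x" using xy z by linarith
        have p1: "1 / (Im x)^3 \<le> 1 / ?y^3"
          by (rule divide_left_mono[OF power_mono[OF xy]]) (use x0 z in simp_all)
        have p2: "1 / Im x \<le> 1 / ?y"
          by (rule divide_left_mono[OF xy]) (use x0 z in simp_all)
        have "norm (sewn (\<lambda>s t. \<phi> s t x - x) t - dyadic_sum (\<lambda>s t. \<phi> s t x - x) n t) \<le> (1 / (Im x)^3 * V t / 2 + 1 / Im x) * (1 / 2) ^ n"
          by (rule drive_dyadic[OF x0 t])
        also have "\<dots> \<le> ?K * (1 / 2) ^ n"
          by (intro mult_right_mono add_mono divide_right_mono p1 p2 V_nonneg[OF t]) auto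
        finally show "dist (dyadic_sum (\<lambda>s t. \<phi> s t x - x) n t) (sewn (\<lambda>s t. \<phi> s t x - x) t) < e"
          using elim by (simp add: dist_norm norm_minus_commute)
      qed
    qed
  qed
  thus "\<exists>d>0. cball z d \<subseteq> upper_half_plane \<and> uniform_limit (cball z d) (\<lambda>n z. dyadic_sum (\<lambda>s t. \<phi> s t z - z) n t) (\<lambda>z. sewn (\<lambda>s t. \<phi> s t z - z) t) sequentially"
    using z sub by (intro exI[of _ ?y]) auto
qed

lemma holomorphic_drive: "t \<in> I \<Longrightarrow> drive t holomorphic_on upper_half_plane"
  unfolding drive_def[abs_def] by (intro holomorphic_intros holomorphic_sewn zero_in)

lemma drive_measure:
  assumes "s \<in> I" "t \<in> I" "s \<le> t"
  obtains \<rho> where "finite_real_measure \<rho>" "measure \<rho> UNIV \<le> V t - V s"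
    "\<And>z. 0 < Im z \<Longrightarrow> drive t z - drive s z = stieltjes \<rho> z"
proof (rule herglotz_representation)
  show "(\<lambda>z. drive t z - drive s z) holomorphic_on upper_half_plane"
    by (intro holomorphic_intros holomorphic_drive assms)
qed (use drive_increment_Im[OF _ assms] drive_increment_norm[OF _ assms] in auto)

text \<open>The measures of \<open>drive t\<close> increase with \<open>t\<close>, because the measure of an increment of \<open>drive\<close> is their
  difference.\<close>

lemma driving_measure_exists:
  obtains \<Theta> where "sets \<Theta> = sets (restrict_space borel (UNIV \<times> I))"
    "\<And>t. t \<in> I \<Longrightarrow> emeasure \<Theta> (UNIV \<times> {t}) = 0"
    "\<And>t. t \<in> I \<Longrightarrow> emeasure \<Theta> (UNIV \<times> {0..t}) < \<infinity>"
    "\<And>s t. s \<in> I \<Longrightarrow> t \<in> I \<Longrightarrow> s \<le> t \<Longrightarrow> measure \<Theta> (UNIV \<times> {0..t}) - measure \<Theta> (UNIV \<times> {0..s}) \<le> V t - V s"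
    "\<And>t z. t \<in> I \<Longrightarrow> 0 < Im z \<Longrightarrow> drive t z = stieltjes (section_measure \<Theta> {0..t}) z"
proof -
  have "\<exists>\<rho>. finite_real_measure \<rho> \<and> measure \<rho> UNIV \<le> V t \<and> (\<forall>z. 0 < Im z \<longrightarrow> drive t z = stieltjes \<rho> z)" if t: "t \<in> I" for t
    using drive_measure[OF zero_in t nonneg[OF t]] drive_zero V_zero by (metis diff_zero)
  then obtain \<theta> where fin: "\<And>t. t \<in> I \<Longrightarrow> finite_real_measure (\<theta> t)" and mass: "\<And>t. t \<in> I \<Longrightarrow> measure (\<theta> t) UNIV \<le> V t"
    and rep: "\<And>t z. t \<in> I \<Longrightarrow> 0 < Im z \<Longrightarrow> drive t z = stieltjes (\<theta> t) z" by metis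
  have inc: "measure (\<theta> s) A \<le> measure (\<theta> t) A \<and> measure (\<theta> t) A \<le> measure (\<theta> s) A + (V t - V s)"
    if st: "s \<in> I" "t \<in> I" "s \<le> t" and A: "A \<in> sets borel" for s t A
  proof -
    obtain \<rho> where \<rho>: "finite_real_measure \<rho>" "measure \<rho> UNIV \<le> V t - V s" "\<And>z. 0 < Im z \<Longrightarrow> drive t z - drive s z = stieltjes \<rho> z"
      using drive_measure[OF st] by metis
    interpret finite_real_measure \<rho> by fact
    have "measure (\<theta> t) A = measure (\<theta> s) A + measure \<rho> A"
      by (rule measure_add_if_stieltjes_add[OF fin[OF st(2)] fin[OF st(1)] \<rho>(1) _ A])
        (simp add: rep[symmetric] st \<rho>(3)[symmetric])
    moreover have "measure \<rho> A \<le> measure \<rho> UNIV" using A by (intro finite_measure_mono) (auto simp: sets_eq)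
    ultimately show ?thesis using \<rho>(2) measure_nonneg[of \<rho> A] by linarith
  qed
  have inc1: "measure (\<theta> s) A \<le> measure (\<theta> t) A"
    and inc2: "measure (\<theta> t) A \<le> measure (\<theta> s) A + (V t - V s)"
    if "s \<in> I" "t \<in> I" "s \<le> t" "A \<in> sets borel" for s t A using inc[OF that] by auto
  have zero: "measure (\<theta> 0) UNIV = 0" using mass[OF zero_in] V_zero measure_nonneg[of "\<theta> 0" UNIV] by linarith
  obtain \<Theta> where \<Theta>: "sets \<Theta> = sets (restrict_space borel (UNIV \<times> I))"
    "\<And>t. t \<in> I \<Longrightarrow> emeasure \<Theta> (UNIV \<times> {t}) = 0"
    "\<And>t A. t \<in> I \<Longrightarrow> A \<in> sets borel \<Longrightarrow> emeasure \<Theta> (A \<times> {0..t}) = emeasure (\<theta> t) A"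
    using spacetime_measure[OF fin inc1 inc2 zero] by blast
  have sec: "section_measure \<Theta> {0..t} = \<theta> t" if t: "t \<in> I" for t
  proof -
    interpret finite_real_measure "\<theta> t" by (rule fin[OF t])
    have "section_measure \<Theta> {0..t} = measure_of UNIV (sets borel) (emeasure (\<theta> t))"
      unfolding section_measure_def
      using sets.sigma_sets_eq[of "borel :: real measure"] by (intro measure_of_eq) (auto simp: \<Theta>(3)[OF t])
    also have "\<dots> = \<theta> t" using measure_of_of_measure[of "\<theta> t"] by (simp add: sets_eq)
    finally show ?thesis .
  qed
  have eq: "emeasure \<Theta> (UNIV \<times> {0..t}) = ennreal (measure (\<theta> t) UNIV)" if t: "t \<in> I" for t
  proof -
    interpret finite_real_measure "\<theta> t" by (rule fin[OF t])
    show ?thesis using \<Theta>(3)[OF t, of UNIV] by (simp add: emeasure_eq_measure)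
  qed
  show ?thesis
  proof (rule that[OF \<Theta>(1,2)])
    show "emeasure \<Theta> (UNIV \<times> {0..t}) < \<infinity>" if "t \<in> I" for t using eq[OF that] by simp
    show "measure \<Theta> (UNIV \<times> {0..t}) - measure \<Theta> (UNIV \<times> {0..s}) \<le> V t - V s" if "s \<in> I" "t \<in> I" "s \<le> t" for s t
      using inc[OF that, of UNIV] eq[OF that(1)] eq[OF that(2)] by (simp add: measure_def)
    show "drive t z = stieltjes (section_measure \<Theta> {0..t}) z" if "t \<in> I" "0 < Im z" for t z
      using rep[OF that] sec[OF that(1)] by simp
  qed
qed

lemma small_clock_increments:
  assumes t: "t \<in> I" and e: "0 < e"
  obtains d where "0 < d" "\<And>u v. 0 \<le> u \<Longrightarrow> u \<le> v \<Longrightarrow> v \<le> t \<Longrightarrow> v - u < d \<Longrightarrow> V v - V u \<le> e"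
proof -
  have "uniformly_continuous_on {0..t} V"
    by (rule compact_uniformly_continuous[OF continuous_on_subset[OF V_continuous subset_I[OF t]]]) simp
  then obtain d where d: "0 < d" "\<And>x x'. x \<in> {0..t} \<Longrightarrow> x' \<in> {0..t} \<Longrightarrow> dist x' x < d \<Longrightarrow> dist (V x') (V x) < e"
    using e unfolding uniformly_continuous_on_def by metis
  show ?thesis
  proof (rule that[OF d(1)])
    fix u v assume "0 \<le> u" "u \<le> v" "v \<le> t" "v - u < d"
    hence "dist (V v) (V u) < e" by (intro d(2)) (auto simp: dist_real_def)
    thus "V v - V u \<le> e" by (simp add: dist_real_def)
  qed
qed

text \<open>For fixed \<open>z\<close> the integrand \<open>deriv (f s) z\<close> is continuous and nowhere zero.\<close>

lemma driving_function_unique: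
  assumes P1: "herglotz_family I P1" "loewner_integral_equation I f P1"
    and P2: "herglotz_family I P2" "loewner_integral_equation I f P2"
  shows "P1 = P2"
proof (rule PiE_ext)
  show "P1 \<in> upper_half_plane \<times> precompact_borel I \<rightarrow>\<^sub>E closed_upper_half_plane"
    "P2 \<in> upper_half_plane \<times> precompact_borel I \<rightarrow>\<^sub>E closed_upper_half_plane"
    using P1 P2 by (auto simp: herglotz_family_def)
  fix x assume "x \<in> upper_half_plane \<times> precompact_borel I"
  then obtain z B where x: "x = (z, B)" "0 < Im z" "B \<in> precompact_borel I" by auto
  obtain T where T: "T \<in> I" "B \<in> sets borel" "B \<subseteq> {0..T}" using precompact_borelD[OF time_interval x(3)] .
  obtain K1 where K1: "bounded_complex_measure T (\<lambda>B. P1 (z, B)) K1" using herglotz_complex_measure[OF time_interval P1(1) T(1) x(2)] .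
  obtain K2 where K2: "bounded_complex_measure T (\<lambda>B. P2 (z, B)) K2" using herglotz_complex_measure[OF time_interval P2(1) T(1) x(2)] .
  have "P1 (z, B) = P2 (z, B)"
  proof (rule complex_measure_determined_by_integrals[OF K1 K2 deriv_f_continuous[OF T(1) x(2)]])
    show "deriv (f t) z \<noteq> 0" if "t \<in> {0..T}" for t using that subset_I[OF T(1)] x(2) by (intro deriv_f_nonzero) auto
    show "B \<in> sets (restrict_space borel {0..T})" using T by (subst sets_restrict_space_iff) auto
    fix t assume "t \<in> {0..T}"
    hence t: "t \<in> I" using subset_I[OF T(1)] by auto
    have "f t z = z + complex_measure_integral {0..t} (\<lambda>B. P1 (z, B)) (\<lambda>s. deriv (f s) z)"
      using P1(2) t x(2) unfolding loewner_integral_equation_def by auto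
    moreover have "f t z = z + complex_measure_integral {0..t} (\<lambda>B. P2 (z, B)) (\<lambda>s. deriv (f s) z)"
      using P2(2) t x(2) unfolding loewner_integral_equation_def by auto
    ultimately show "complex_measure_integral {0..t} (\<lambda>B. P1 (z, B)) (\<lambda>s. deriv (f s) z) = complex_measure_integral {0..t} (\<lambda>B. P2 (z, B)) (\<lambda>s. deriv (f s) z)"
      by simp
  qed
  thus "P1 x = P2 x" by (simp add: x)
qed

end

section \<open>The equations driven by the measure\<close>

locale driven_chain = loewner_chain I f + spacetime I \<Theta> for I f \<Theta> +
  assumes mass: "\<And>s t. s \<in> I \<Longrightarrow> t \<in> I \<Longrightarrow> s \<le> t \<Longrightarrow> measure \<Theta> (UNIV \<times> {0..t}) - measure \<Theta> (UNIV \<times> {0..s}) \<le> V t - V s"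
    and drive_eq: "\<And>t z. t \<in> I \<Longrightarrow> 0 < Im z \<Longrightarrow> drive t z = stieltjes (section_measure \<Theta> {0..t}) z"
begin

lemma slab_precompact:
  assumes "t \<in> I" "0 \<le> u" "v \<le> t"
  shows "{0..v} \<in> precompact_borel I" "{u..v} \<in> precompact_borel I" "{u<..v} \<in> precompact_borel I"
  using assms by (auto intro!: precompact_borelI[OF time_interval assms(1)])

lemma driving_function_increment:
  assumes "v \<in> I" "0 \<le> u" "u \<le> v" "0 < Im z"
  shows "driving_function (z, {u<..v}) = drive v z - drive u z"
proof -
  have u: "u \<in> I" using down[OF assms(1)] assms by auto
  obtain K where "bounded_complex_measure v (\<lambda>B. driving_function (z, B)) K"
    using herglotz_complex_measure[OF time_interval herglotz_driving_function assms(1,4)] .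
  then interpret bounded_complex_measure v "\<lambda>B. driving_function (z, B)" K .
  have "driving_function (z, {0..v}) = drive v z" "driving_function (z, {0..u}) = drive u z"
    using drive_eq assms u slab_precompact(1)[OF assms(1), of 0] by (simp_all add: driving_function_eq)
  thus ?thesis using initial_increment[OF assms(2,3) order_refl] by simp
qed

text \<open>Both sides increase by \<open>deriv (f u) z\<close> times \<open>P(z,(u,v])\<close> up to small errors: the integral by continuity of the
  derivative, and \<open>f\<close> because \<open>f v = f u \<circ> \<phi> u v\<close> and \<open>\<phi> u v z - z\<close> agrees with \<open>P(z,(u,v])\<close> to first order.\<close>

lemma loewner_equation: "loewner_integral_equation I f driving_function"
  unfolding loewner_integral_equation_def
proof (intro ballI)
  fix t z assume t: "t \<in> I" and "z \<in> upper_half_plane"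
  hence z: "0 < Im z" by simp
  have t0: "0 \<le> t" by (rule nonneg[OF t])
  obtain K where K: "bounded_complex_measure t (\<lambda>B. driving_function (z, B)) K"
    using herglotz_complex_measure[OF time_interval herglotz_driving_function t z] .
  interpret bounded_complex_measure t "\<lambda>B. driving_function (z, B)" K by (rule K)
  let ?g = "\<lambda>s. deriv (f s) z"
  let ?J = "\<lambda>r. complex_measure_integral {0..r} (\<lambda>B. driving_function (z, B)) ?g"
  obtain \<kappa> where \<kappa>: "\<And>g u v c e. continuous_on {0..t} g \<Longrightarrow> 0 \<le> u \<Longrightarrow> u \<le> v \<Longrightarrow> v \<le> t \<Longrightarrow> (\<And>r. r \<in> {u<..v} \<Longrightarrow> norm (g r - c) \<le> e) \<Longrightarrow>
      norm (complex_measure_integral {0..v} (\<lambda>B. driving_function (z, B)) g - complex_measure_integral {0..u} (\<lambda>B. driving_function (z, B)) g - c * driving_function (z, {u<..v})) \<le> e * (\<kappa> v - \<kappa> u)"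
    using complex_integral_increment by metis
  note cont = deriv_f_continuous[OF t z]
  obtain G where G: "\<And>s. s \<in> {0..t} \<Longrightarrow> norm (?g s) \<le> G"
    using compact_imp_bounded[OF compact_continuous_image[OF cont compact_Icc]] unfolding bounded_iff by blast
  have G0: "0 \<le> G" using order_trans[OF norm_ge_zero G[of 0]] t0 by simp
  \<comment> \<open>The coefficient of the square of the clock increment in the total error, plus 1 to make it positive.\<close>
  define C where "C = 128 * V t / (Im z)^5 + G * (1 / (Im z)^3) + 1"
  have C: "0 < C" unfolding C_def using V_nonneg[OF t] G0 z by (intro add_nonneg_pos add_nonneg_nonneg) auto
  let ?D = "\<lambda>r. ?J r - f r z"
  have "?D t = ?D 0"
  proof (rule constant_if_small_increments[where K="\<lambda>r. \<kappa> r + V r", OF t0])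
    fix e :: real assume e: "0 < e"
    obtain d1 where d1: "0 < d1" "\<And>u v. 0 \<le> u \<Longrightarrow> u \<le> t \<Longrightarrow> 0 \<le> v \<Longrightarrow> v \<le> t \<Longrightarrow> \<bar>v - u\<bar> < d1 \<Longrightarrow> norm (?g v - ?g u) \<le> e"
      using uniform_small_oscillation[OF cont e] by metis
    obtain d2 where d2: "0 < d2" "\<And>u v. 0 \<le> u \<Longrightarrow> u \<le> v \<Longrightarrow> v \<le> t \<Longrightarrow> v - u < d2 \<Longrightarrow> V v - V u \<le> e / C"
      using small_clock_increments[OF t, of "e / C"] e C by (metis divide_pos_pos)
    have "norm (?D v - ?D u) \<le> e * ((\<kappa> v + V v) - (\<kappa> u + V u))"
      if uv: "0 \<le> u" "u \<le> v" "v \<le> t" "v - u < min d1 d2" for u v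
    proof -
      have inI: "u \<in> I" "v \<in> I" using uv down[OF t] by auto
      have \<Delta>: "0 \<le> V v - V u" "V v - V u \<le> e / C" "V u \<le> V t" using V_mono inI uv t d2(2)[of u v] by auto
      have 1: "norm (?J v - ?J u - ?g u * driving_function (z, {u<..v})) \<le> e * (\<kappa> v - \<kappa> u)"
        by (rule \<kappa>[OF cont uv(1-3)]) (use uv in \<open>intro d1(2), auto\<close>)
      have 2: "norm (f v z - f u z - ?g u * (\<phi> u v z - z)) \<le> 128 * V t / (Im z)^5 * (V v - V u)\<^sup>2"
        using inI uv z \<Delta> by (intro f_taylor) auto
      have 3: "norm (?g u * (driving_function (z, {u<..v}) - (\<phi> u v z - z))) \<le> G * (1 / (Im z)^3 * (V v - V u)\<^sup>2)"
        unfolding norm_mult driving_function_increment[OF inI(2) uv(1,2) z]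
        by (intro mult_mono G drive_approx z inI uv) (use uv G0 in auto)
      have eq: "?D v - ?D u = (?J v - ?J u - ?g u * driving_function (z, {u<..v}))
          - (f v z - f u z - ?g u * (\<phi> u v z - z)) + ?g u * (driving_function (z, {u<..v}) - (\<phi> u v z - z))"
        by (simp add: algebra_simps)
      have le: "norm (?D v - ?D u) \<le> e * (\<kappa> v - \<kappa> u) + 128 * V t / (Im z)^5 * (V v - V u)\<^sup>2 + G * (1 / (Im z)^3 * (V v - V u)\<^sup>2)"
        unfolding eq by (rule norm_triangle_le[OF add_mono[OF norm_triangle_le_diff[OF add_mono[OF 1 2]] 3]])
      have "C * (V v - V u) \<le> e" using \<Delta>(2) C by (simp add: field_simps)
      from mult_right_mono[OF this \<Delta>(1)] have small: "C * (V v - V u)\<^sup>2 \<le> e * (V v - V u)"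
        by (simp add: power2_eq_square mult.assoc)
      have "C * (V v - V u)\<^sup>2 = 128 * V t / (Im z)^5 * (V v - V u)\<^sup>2 + G * (1 / (Im z)^3 * (V v - V u)\<^sup>2) + (V v - V u)\<^sup>2"
        unfolding C_def by (simp only: distrib_right mult.assoc mult_1)
      moreover have "0 \<le> (V v - V u)\<^sup>2" by simp
      ultimately have "norm (?D v - ?D u) \<le> e * (\<kappa> v - \<kappa> u) + e * (V v - V u)"
        using le small by linarith
      thus ?thesis by (simp only: distrib_left right_diff_distrib)
    qed
    thus "\<exists>d>0. \<forall>u v. 0 \<le> u \<and> u \<le> v \<and> v \<le> t \<and> v - u < d \<longrightarrow> norm (?D v - ?D u) \<le> e * ((\<kappa> v + V v) - (\<kappa> u + V u))"
      using d1(1) d2(1) by (intro exI[of _ "min d1 d2"]) auto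
  qed
  thus "f t z = z + ?J t" using complex_integral_zero f_zero[OF z] by (simp add: algebra_simps)
qed

text \<open>The sum of \<open>\<phi> r t z\<close> and of the integral over \<open>[s,r]\<close> does not depend on \<open>r\<close>. When \<open>r\<close> moves from \<open>u\<close> to \<open>v\<close>, the first
  term loses \<open>\<phi> u v w - w\<close> with \<open>w = \<phi> v t z\<close>, which to first order is \<open>P(w,(u,v])\<close>; the integral gains the same,
  as its integrand is close to \<open>1/(x - w)\<close> there. The values at \<open>r = t\<close> and \<open>r = s\<close> give the formula.\<close>

lemma evolution_equation:
  assumes st: "s \<in> I" "t \<in> I" "s \<le> t" and z: "0 < Im z"
  shows "\<phi> s t z = z + (LINT (x, r) : UNIV \<times> {s..t} | \<Theta>. 1 / (complex_of_real x - \<phi> r t z))"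
proof -
  \<comment> \<open>Outside \<open>[0,t]\<close> the curve is continued by \<open>z\<close>, which makes it Borel measurable with the same lower bound on the
    imaginary part.\<close>
  define c where "c = (\<lambda>r. indicator {0..t} r *\<^sub>R (\<phi> r t z - z) + z)"
  have c_in: "c r = \<phi> r t z" if "r \<in> {0..t}" for r using that by (simp add: c_def)
  have Im_c: "Im z \<le> Im (c r)" for r
  proof (cases "r \<in> {0..t}")
    case True
    thus ?thesis unfolding c_in[OF True] using subset_I[OF st(2)] st z by (intro \<phi>_Im_mono) auto
  qed (simp add: c_def)
  have Im_c0: "0 < Im (c r)" for r using Im_c[of r] z by linarith
  have c_lip: "norm (c u - c v) \<le> (V v - V u) / Im z" if "0 \<le> u" "u \<le> v" "v \<le> t" for u v
    using that down[OF st(2)] st z by (simp add: c_in \<phi>_time_lipschitz)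
  have c_cont: "continuous_on {0..t} (\<lambda>r. \<phi> r t z - z)"
    unfolding continuous_on_def
  proof
    fix r0 assume r0: "r0 \<in> {0..t}"
    have lip: "norm (\<phi> r t z - \<phi> r0 t z) \<le> \<bar>V r - V r0\<bar> / Im z" if r: "r \<in> {0..t}" for r
    proof (cases "r \<le> r0")
      case True
      have "V r \<le> V r0" using True r r0 subset_I[OF st(2)] by (intro V_mono) auto
      thus ?thesis using c_lip[of r r0] True r r0 by (simp add: c_in)
    next
      case False
      have "V r0 \<le> V r" using False r r0 subset_I[OF st(2)] by (intro V_mono) auto
      thus ?thesis using c_lip[of r0 r] False r r0 by (simp add: c_in norm_minus_commute)
    qed
    have "((\<lambda>r. (\<phi> r t z - z) - (\<phi> r0 t z - z)) \<longlongrightarrow> 0) (at r0 within {0..t})"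
    proof (rule Lim_null_comparison)
      show "eventually (\<lambda>r. norm ((\<phi> r t z - z) - (\<phi> r0 t z - z)) \<le> \<bar>V r - V r0\<bar> / Im z) (at r0 within {0..t})"
        unfolding eventually_at_filter using lip by (intro always_eventually) simp
      have "(V \<longlongrightarrow> V r0) (at r0 within {0..t})"
        using continuous_on_subset[OF V_continuous subset_I[OF st(2)]] r0 by (auto simp: continuous_on_def)
      hence "((\<lambda>r. \<bar>V r - V r0\<bar> / Im z) \<longlongrightarrow> \<bar>V r0 - V r0\<bar> / Im z) (at r0 within {0..t})"
        using z by (intro tendsto_intros) auto
      thus "((\<lambda>r. \<bar>V r - V r0\<bar> / Im z) \<longlongrightarrow> 0) (at r0 within {0..t})" by simp
    qed
    thus "((\<lambda>r. \<phi> r t z - z) \<longlongrightarrow> \<phi> r0 t z - z) (at r0 within {0..t})" using Lim_null by blast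
  qed
  have c_meas[measurable]: "c \<in> borel_measurable borel"
    unfolding c_def by (intro borel_measurable_add borel_measurable_continuous_on_indicator c_cont) auto
  define H where "H = (\<lambda>w :: real \<times> real. 1 / (complex_of_real (fst w) - c (snd w)))"
  have H_meas: "H \<in> borel_measurable \<Theta>"
  proof (rule measurable_\<Theta>)
    have [measurable]: "(fst :: real \<times> real \<Rightarrow> real) \<in> borel_measurable borel" "(snd :: real \<times> real \<Rightarrow> real) \<in> borel_measurable borel"
      by (intro borel_measurable_continuous_onI continuous_intros)+
    show "H \<in> borel_measurable borel" unfolding H_def by measurable
  qed
  have H_bound: "norm (H w) \<le> 1 / Im z" for w unfolding H_def using z Im_c by (intro norm_resolvent_le)
  define S where "S = (\<lambda>B. \<integral>w. indicator (UNIV \<times> B) w *\<^sub>R H w \<partial>\<Theta>)"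
  have tp: "0 \<le> s" "0 \<le> t" using nonneg st by auto
  have S_inc: "S {s..v} - S {s..u} = S {u<..v}" if uv: "s \<le> u" "u \<le> v" "v \<le> t" for u v
  proof -
    have pc: "{s..v} \<in> precompact_borel I" "{s..u} \<in> precompact_borel I"
      using slab_precompact(2)[OF st(2) tp(1)] uv by auto
    have "S {s..v} - S {s..u} = (\<integral>w. indicator (UNIV \<times> {s..v}) w *\<^sub>R H w - indicator (UNIV \<times> {s..u}) w *\<^sub>R H w \<partial>\<Theta>)"
      unfolding S_def
      by (rule Bochner_Integration.integral_diff[symmetric]; rule integrable_slab(1)[OF _ H_meas H_bound]; rule pc)
    also have "\<dots> = S {u<..v}" unfolding S_def
      using uv by (intro Bochner_Integration.integral_cong) (auto simp: indicator_def)
    finally show ?thesis .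
  qed
  have slab_mass: "measure \<Theta> (UNIV \<times> {u<..v}) \<le> V v - V u" if uv: "0 \<le> u" "u \<le> v" "v \<le> t" for u v
  proof -
    have inI: "u \<in> I" "v \<in> I" using uv down[OF st(2)] by auto
    have pc: "{0..u} \<in> precompact_borel I" "{0..v} \<in> precompact_borel I" "{u<..v} \<in> precompact_borel I"
      using slab_precompact[OF st(2)] uv by auto
    have eq: "(UNIV :: real set) \<times> {0..v} = UNIV \<times> {0..u} \<union> UNIV \<times> {u<..v}" using uv by auto
    have "measure \<Theta> (UNIV \<times> {0..v}) = measure \<Theta> (UNIV \<times> {0..u}) + measure \<Theta> (UNIV \<times> {u<..v})"
      unfolding eq using precompact_slab[OF pc(1)] precompact_slab[OF pc(3)]
      by (intro measure_Union) auto
    thus ?thesis using mass[OF inI uv(2)] by simp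
  qed
  let ?D = "\<lambda>r. c r + S {s..r}"
  have "?D t = ?D s"
  proof (rule constant_if_small_increments[where K=V, OF st(3)])
    fix e :: real assume e: "0 < e"
    define C where "C = 2 / (Im z)^3"
    have C: "0 < C" using z by (simp add: C_def)
    obtain d where d: "0 < d" "\<And>u v. 0 \<le> u \<Longrightarrow> u \<le> v \<Longrightarrow> v \<le> t \<Longrightarrow> v - u < d \<Longrightarrow> V v - V u \<le> e / C"
      using small_clock_increments[OF st(2), of "e / C"] e C by (metis divide_pos_pos)
    have "norm (?D v - ?D u) \<le> e * (V v - V u)"
      if uv: "s \<le> u" "u \<le> v" "v \<le> t" "v - u < d" for u v
    proof -
      have u0: "0 \<le> u" using uv tp by simp
      have inI: "u \<in> I" "v \<in> I" using uv u0 down[OF st(2)] by auto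
      have \<Delta>: "0 \<le> V v - V u" "V v - V u \<le> e / C" using V_mono inI uv u0 d(2)[of u v] by auto
      let ?w = "c v"
      have w: "0 < Im ?w" "Im z \<le> Im ?w" using Im_c0 Im_c by auto
      have pc: "{u<..v} \<in> precompact_borel I" using slab_precompact(3)[OF st(2) u0 uv(3)] .
      have cu: "\<phi> u v ?w = c u" using \<phi>_compose[of u v t z] inI st uv z u0 by (simp add: c_in)
      have 1: "norm (drive v ?w - drive u ?w - (c u - ?w)) \<le> 1 / (Im z)^3 * (V v - V u)\<^sup>2"
      proof -
        have "norm (drive v ?w - drive u ?w - (\<phi> u v ?w - ?w)) \<le> 1 / (Im ?w)^3 * (V v - V u)\<^sup>2"
          by (rule drive_approx[OF w(1) inI uv(2)])
        also have "\<dots> \<le> 1 / (Im z)^3 * (V v - V u)\<^sup>2"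
          using w z by (intro mult_right_mono divide_left_mono power_mono) auto
        finally show ?thesis unfolding cu .
      qed
      let ?R = "\<lambda>w' :: real \<times> real. 1 / (complex_of_real (fst w') - ?w)"
      have R_bound: "norm (?R w') \<le> 1 / Im z" for w' using z w by (intro norm_resolvent_le) auto
      have dr: "drive v ?w - drive u ?w = (\<integral>w'. indicator (UNIV \<times> {u<..v}) w' *\<^sub>R ?R w' \<partial>\<Theta>)"
        using driving_function_increment[OF inI(2) u0 uv(2) w(1)] driving_function_eq[OF w(1) pc] stieltjes_section[OF pc] by simp
      \<comment> \<open>Truncated to the slab, where alone the two resolvents are close.\<close>
      define h where "h = (\<lambda>w'. if snd w' \<in> {u<..v} then H w' - ?R w' else 0)"
      have h_meas: "h \<in> borel_measurable \<Theta>"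
      proof -
        have "h = (\<lambda>w'. indicator (UNIV \<times> {u<..v}) w' *\<^sub>R (H w' - ?R w'))" by (auto simp: h_def indicator_def)
        thus ?thesis using H_meas resolvent_measurable precompact_slab(1)[OF pc] by simp
      qed
      have h_bound: "norm (h w') \<le> (V v - V u) / (Im z)^3" for w'
      proof (cases "snd w' \<in> {u<..v}")
        case True
        let ?r = "snd w'" and ?x = "complex_of_real (fst w')"
        have r: "0 \<le> ?r" "?r \<le> v" "u \<le> ?r" "?r \<in> I" using True u0 uv down[OF st(2)] by auto
        have ne: "?x - c ?r \<noteq> 0" "?x - ?w \<noteq> 0" using of_real_minus_ne[OF Im_c0] by auto
        have "h w' = (c ?r - ?w) * (1 / (?x - c ?r)) * (1 / (?x - ?w))"
          using True ne by (simp add: h_def H_def divide_simps)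
        also have "norm \<dots> \<le> (V v - V u) / Im z * (1 / Im z) * (1 / Im z)"
        proof -
          have "norm (c ?r - ?w) \<le> (V v - V ?r) / Im z" using r uv by (intro c_lip) auto
          also have "\<dots> \<le> (V v - V u) / Im z" using V_mono[OF inI(1) r(4,3)] z by (intro divide_right_mono) auto
          finally show ?thesis unfolding norm_mult
            using norm_resolvent_le[OF z Im_c[of ?r], of "fst w'"] norm_resolvent_le[OF z w(2), of "fst w'"] \<Delta>(1) z
            by (intro mult_mono mult_nonneg_nonneg) auto
        qed
        finally show ?thesis by (simp add: power3_eq_cube)
      next
        case False
        hence "h w' = 0" unfolding h_def by (rule if_not_P)
        thus ?thesis using \<Delta>(1) z by simp
      qed
      have "S {u<..v} - (drive v ?w - drive u ?w) = (\<integral>w'. indicator (UNIV \<times> {u<..v}) w' *\<^sub>R h w' \<partial>\<Theta>)"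
      proof -
        have "S {u<..v} - (drive v ?w - drive u ?w) = (\<integral>w'. indicator (UNIV \<times> {u<..v}) w' *\<^sub>R H w' - indicator (UNIV \<times> {u<..v}) w' *\<^sub>R ?R w' \<partial>\<Theta>)"
          unfolding S_def dr
          by (rule Bochner_Integration.integral_diff[symmetric, OF integrable_slab(1)[OF pc H_meas H_bound] integrable_slab(1)[OF pc resolvent_measurable R_bound]])
        also have "\<dots> = (\<integral>w'. indicator (UNIV \<times> {u<..v}) w' *\<^sub>R h w' \<partial>\<Theta>)"
          by (intro Bochner_Integration.integral_cong) (auto simp: indicator_def h_def)
        finally show ?thesis .
      qed
      also have "norm \<dots> \<le> (V v - V u) / (Im z)^3 * measure \<Theta> (UNIV \<times> {u<..v})"
        by (rule integrable_slab(2)[OF pc h_meas h_bound])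
      also have "\<dots> \<le> (V v - V u) / (Im z)^3 * (V v - V u)"
        using slab_mass[OF u0 uv(2,3)] \<Delta>(1) z by (intro mult_left_mono) auto
      finally have 2: "norm (S {u<..v} - (drive v ?w - drive u ?w)) \<le> 1 / (Im z)^3 * (V v - V u)\<^sup>2" by (simp add: power2_eq_square)
      have eq: "?D v - ?D u = (S {u<..v} - (drive v ?w - drive u ?w)) + (drive v ?w - drive u ?w - (c u - ?w))"
        using S_inc[OF uv(1-3)] by (simp add: algebra_simps)
      have "norm (?D v - ?D u) \<le> 1 / (Im z)^3 * (V v - V u)\<^sup>2 + 1 / (Im z)^3 * (V v - V u)\<^sup>2"
        unfolding eq by (rule norm_triangle_le[OF add_mono[OF 2 1]])
      also have "\<dots> = C * (V v - V u) * (V v - V u)" by (simp add: C_def power2_eq_square)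
      also have "\<dots> \<le> e * (V v - V u)" using \<Delta> C by (intro mult_right_mono) (auto simp: field_simps)
      finally show ?thesis .
    qed
    thus "\<exists>d>0. \<forall>u v. s \<le> u \<and> u \<le> v \<and> v \<le> t \<and> v - u < d \<longrightarrow> norm (?D v - ?D u) \<le> e * (V v - V u)"
      using d(1) by blast
  qed
  moreover have "S {s..s} = 0"
  proof -
    have pc: "{s..s} \<in> precompact_borel I" using slab_precompact(2)[OF st(1) tp(1) order_refl] .
    have "measure \<Theta> (UNIV \<times> {s..s}) = 0" using null_slice[OF st(1)] by (simp add: measure_def)
    thus ?thesis using integrable_slab(2)[OF pc H_meas H_bound] by (simp add: S_def)
  qed
  moreover have "c t = z" "c s = \<phi> s t z" using tp st z by (simp_all add: c_in \<phi>_self)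
  ultimately have "\<phi> s t z = z + S {s..t}" by simp
  also have "S {s..t} = (LINT (x, r) : UNIV \<times> {s..t} | \<Theta>. 1 / (complex_of_real x - \<phi> r t z))"
    unfolding S_def set_lebesgue_integral_def
    using tp by (intro Bochner_Integration.integral_cong) (auto simp: indicator_def H_def c_in)
  finally show ?thesis .
qed

end

section \<open>Existence, uniqueness and the evolution equation\<close>

theorem theorem5p16:
  fixes I :: "real set" and f :: "real \<Rightarrow> complex \<Rightarrow> complex"
  assumes "time_interval I" and "P20_DLC I f"
  shows "(\<exists>!P. herglotz_family I P \<and> loewner_integral_equation I f P) \<and>
    (\<forall>P. herglotz_family I P \<and> loewner_integral_equation I f P \<longrightarrow>
      (\<forall>s\<in>I. \<forall>t\<in>I. \<forall>z\<in>upper_half_plane. s \<le> t \<longrightarrow>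
        reverse_evolution f s t z = z +
          (LINT (x, r) : UNIV \<times> {s..t} | compound_driving_measure I P.
             1 / (complex_of_real x - reverse_evolution f r t z))))"
proof -
  interpret chain: loewner_chain I f using assms by unfold_locales
  obtain \<Theta> where \<Theta>: "sets \<Theta> = sets (restrict_space borel (UNIV \<times> I))"
    "\<And>t. t \<in> I \<Longrightarrow> emeasure \<Theta> (UNIV \<times> {t}) = 0"
    "\<And>t. t \<in> I \<Longrightarrow> emeasure \<Theta> (UNIV \<times> {0..t}) < \<infinity>"
    "\<And>s t. s \<in> I \<Longrightarrow> t \<in> I \<Longrightarrow> s \<le> t \<Longrightarrow> measure \<Theta> (UNIV \<times> {0..t}) - measure \<Theta> (UNIV \<times> {0..s}) \<le> chain.V t - chain.V s"
    "\<And>t z. t \<in> I \<Longrightarrow> 0 < Im z \<Longrightarrow> chain.drive t z = stieltjes (section_measure \<Theta> {0..t}) z"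
    using chain.driving_measure_exists by blast
  interpret driven: driven_chain I f \<Theta>
    by (intro driven_chain.intro spacetime.intro driven_chain_axioms.intro chain.loewner_chain_axioms assms(1) \<Theta>)
  let ?P = "driven.driving_function"
  have P: "herglotz_family I ?P" "loewner_integral_equation I f ?P"
    by (rule driven.herglotz_driving_function, rule driven.loewner_equation)
  have unique: "P = ?P" if "herglotz_family I P \<and> loewner_integral_equation I f P" for P
    using chain.driving_function_unique that P by blast
  show ?thesis
  proof (intro conjI allI impI ballI)
    show "\<exists>!P. herglotz_family I P \<and> loewner_integral_equation I f P"
      using P unique by blast
    fix P s t z
    assume PP: "herglotz_family I P \<and> loewner_integral_equation I f P"
      and st: "s \<in> I" "t \<in> I" "s \<le> t" and z: "z \<in> upper_half_plane"
    show "reverse_evolution f s t z = z + (LINT (x, r) : UNIV \<times> {s..t} | compound_driving_measure I P.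
             1 / (complex_of_real x - reverse_evolution f r t z))"
      unfolding unique[OF PP] driven.compound_driving_measure_eq
      using driven.evolution_equation[OF st] z by simp
  qed
qed

end
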